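(* Let $N\ge 1$ be a fixed integer and let $p_1,\dots,p_N\ge 0$ with $\sum_{j=1}^N p_j=1$. On a rich enough probability space one can define a Brownian spider $\{\mathbf{B}(t),\,t\ge 0\}$ and a random walk $\{\mathbf{S}_n,\,n=0,1,2,\dots\}$, both on the spider $\mathbf{SP}(N)$ and both selecting their legs with the same probabilities $p_j$, $j=1,\dots,N$, so that, as $n\to\infty$, $$|\mathbf{S}_n-\mathbf{B}(n)|=O\big((n\log\log n)^{1/4}(\log n)^{1/2}\big)\quad\text{almost surely.}$$
   Context: Spider: $\mathbf{SP}(N)$ consists of $N$ half-lines (legs) joined at a common endpoint $\mathbf 0$ (the body). For real $r\ge 0$ and $j\in\{1,\dots,N\}$, $v(r,j)=v_N(r,j)$ denotes the point on leg $j$ at height $r$ (one may take $v_N(r,j)=r\exp(2\pi i j/N)$), with $v(0,1)=\dots=v(0,N)=v(0)=\mathbf 0$. The distance on the spider is $|v(x,j)-v(y,j)|=|x-y|$ and $|v(x,j)-v(y,k)|=x+y$ for $j\ne k$. Random walk on the spider with leg probabilities $p_1,\dots,p_N$: the Markov chain $\mathbf{S}_n$, $n=0,1,2,\dots$, on the vertices $v(r,j)$, $r=0,1,2,\dots$, $j=1,\dots,N$, with $\mathbf{S}_0=\mathbf 0$, $\mathbf{P}(\mathbf{S}_{n+1}=v(1,j)\mid \mathbf{S}_n=\mathbf 0)=p_j$, and, for $r\ge1$, $\mathbf{P}(\mathbf{S}_{n+1}=v(r+1,j)\mid \mathbf{S}_n=v(r,j))=\mathbf{P}(\mathbf{S}_{n+1}=v(r-1,j)\mid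 \mathbf{S}_n=v(r,j))=\tfrac12$. Brownian spider with leg probabilities $p_1,\dots,p_N$: let $B$ be a standard one-dimensional Brownian motion, let $J_1,J_2,\dots$ be a fixed enumeration of the excursion intervals of $|B|$ away from zero, and let $\kappa_1,\kappa_2,\dots$ be i.i.d., independent of $B$, with $P(\kappa_m=j)=p_j$. Then $\mathbf{B}(t)=v(|B(t)|,\kappa_m)$ if $B(t)\neq 0$ and $t\in J_m$, and $\mathbf{B}(t)=\mathbf 0$ if $B(t)=0$. *)

theory Defs
  imports "HOL-Probability.Probability" "HOL-Library.Landau_Symbols"
begin

text \<open>The spider with \<open>N\<close> legs is realised inside the complex plane, with the body at \<open>0\<close>.\<close>

definition spider_pt :: "nat \<Rightarrow> real \<Rightarrow> nat \<Rightarrow> complex" where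
  "spider_pt N r j = of_real r * exp (2 * of_real pi * \<i> * of_nat j / of_nat N)"

definition leg :: "nat \<Rightarrow> nat \<Rightarrow> complex set" where
  "leg N j = {spider_pt N r j | r. r \<ge> 0}"

definition spider :: "nat \<Rightarrow> complex set" where
  "spider N = (\<Union>j\<in>{1..N}. leg N j)"

text \<open>Not the Euclidean distance of the plane. The two lemmas \<open>spider_dist_same_leg\<close> and
  \<open>spider_dist_other_leg\<close> below give the distance in the coordinates \<open>(r, j)\<close>.\<close>

definition spider_dist :: "nat \<Rightarrow> complex \<Rightarrow> complex \<Rightarrow> real" where
  "spider_dist N z w =
     (if \<exists>j\<in>{1..N}. z \<in> leg N j \<and> w \<in> leg N j then \<bar>cmod z - cmod w\<bar> else cmod z + cmod w)"

lemma spider_pt_cis: "spider_pt N r j = of_real r * cis (2 * pi * real j / real N)"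
  by (simp add: spider_pt_def cis_conv_exp mult_ac)

lemma spider_pt_0 [simp]: "spider_pt N 0 j = 0"
  by (simp add: spider_pt_def)

lemma norm_spider_pt [simp]: "cmod (spider_pt N r j) = \<bar>r\<bar>"
  by (simp add: spider_pt_cis norm_mult)

lemma spider_pt_inj:
  assumes "j \<in> {1..N}" "k \<in> {1..N}" "r > 0" "s \<ge> 0" "spider_pt N r j = spider_pt N s k"
  shows "r = s \<and> j = k"
proof -
  have rs: "r = s" using arg_cong[OF assms(5), of cmod] assms(3,4) unfolding norm_spider_pt by linarith
  have N: "N > 0" using assms by auto
  have "cis (2 * pi * real j / real N) = cis (2 * pi * real k / real N)"
    using assms(3,5) rs by (simp add: spider_pt_cis)
  then have "cis (2 * pi * real j / real N - 2 * pi * real k / real N) = 1"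
    by (simp flip: cis_divide)
  then have "cos (2 * pi * real j / real N - 2 * pi * real k / real N) = 1"
    by (simp add: complex_eq_iff)
  then obtain m :: int where
    m: "2 * pi * real j / real N - 2 * pi * real k / real N = of_int m * 2 * pi"
    by (auto simp: cos_one_2pi_int)
  then have "(2 * pi) * (real j - real k) = (2 * pi) * (of_int m * real N)"
    using N by (simp add: field_simps)
  then have "real j - real k = of_int m * real N" by simp
  then have e: "int j - int k = m * int N"
    by (simp flip: of_int_eq_iff[where 'a = real])
  moreover have "\<bar>int j - int k\<bar> < int N" using assms(1,2) by auto
  ultimately have "m = 0" using N
    by (simp add: abs_mult)
  then show ?thesis using e rs by simp
qed

lemma spider_dist_same_leg:
  assumes "j \<in> {1..N}" "x \<ge> 0" "y \<ge> 0"
  shows "spider_dist N (spider_pt N x j) (spider_pt N y j) = \<bar>x - y\<bar>"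
  using assms by (auto simp: spider_dist_def leg_def)

lemma spider_dist_other_leg:
  assumes "j \<in> {1..N}" "k \<in> {1..N}" "j \<noteq> k" "x \<ge> 0" "y \<ge> 0"
  shows "spider_dist N (spider_pt N x j) (spider_pt N y k) = x + y"
proof (cases "x = 0 \<or> y = 0")
  case True
  then show ?thesis using assms by (auto simp: spider_dist_def)
next
  case False
  then have "x > 0" "y > 0" using assms by auto
  then have "\<not> (\<exists>i\<in>{1..N}. spider_pt N x j \<in> leg N i \<and> spider_pt N y k \<in> leg N i)"
    using assms spider_pt_inj unfolding leg_def by blast
  then show ?thesis using assms(4,5) unfolding spider_dist_def norm_spider_pt by (simp only: if_False abs_of_nonneg)
qed

text \<open>Conditioning on the whole history up to time \<open>n\<close> expresses the Markov property and the
  transition probabilities at once.\<close>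

definition spider_walk ::
  "nat \<Rightarrow> (nat \<Rightarrow> real) \<Rightarrow> 'a measure \<Rightarrow> (nat \<Rightarrow> 'a \<Rightarrow> complex) \<Rightarrow> bool" where
  "spider_walk N p M S \<longleftrightarrow>
     prob_space M \<and>
     (\<forall>n. S n \<in> borel_measurable M) \<and>
     (\<forall>n. \<forall>\<omega>\<in>space M. S n \<omega> \<in> {spider_pt N (real r) j | r j. j \<in> {1..N}}) \<and>
     (\<forall>\<omega>\<in>space M. S 0 \<omega> = 0) \<and>
     (\<forall>n x. \<P>(\<omega> in M. \<forall>i\<le>n. S i \<omega> = x i) > 0 \<longrightarrow>
        (x n = 0 \<longrightarrow> (\<forall>j\<in>{1..N}.
           \<P>(\<omega> in M. S (Suc n) \<omega> = spider_pt N 1 j \<bar> \<forall>i\<le>n. S i \<omega> = x i) = p j)) \<and>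
        (\<forall>r\<ge>1. \<forall>j\<in>{1..N}. x n = spider_pt N (real r) j \<longrightarrow>
           \<P>(\<omega> in M. S (Suc n) \<omega> = spider_pt N (real (r + 1)) j \<bar> \<forall>i\<le>n. S i \<omega> = x i) = 1 / 2 \<and>
           \<P>(\<omega> in M. S (Suc n) \<omega> = spider_pt N (real (r - 1)) j \<bar> \<forall>i\<le>n. S i \<omega> = x i) = 1 / 2))"

text \<open>Time is the half-line \<open>t \<ge> 0\<close>; values at negative times are irrelevant.\<close>

definition brownian_motion :: "'a measure \<Rightarrow> (real \<Rightarrow> 'a \<Rightarrow> real) \<Rightarrow> bool" where
  "brownian_motion M B \<longleftrightarrow>
     prob_space M \<and>
     (\<forall>t\<ge>0. B t \<in> borel_measurable M) \<and>
     (\<forall>\<omega>\<in>space M. B 0 \<omega> = 0 \<and> continuous_on {0..} (\<lambda>t. B t \<omega>)) \<and>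
     (\<forall>s t. 0 \<le> s \<and> s < t \<longrightarrow>
        distributed M lborel (\<lambda>\<omega>. B t \<omega> - B s \<omega>) (\<lambda>x. ennreal (normal_density 0 (sqrt (t - s)) x))) \<and>
     (\<forall>n (\<tau> :: nat \<Rightarrow> real). 0 \<le> \<tau> 0 \<and> (\<forall>i<n. \<tau> i < \<tau> (Suc i)) \<longrightarrow>
        prob_space.indep_vars M (\<lambda>_. borel) (\<lambda>i \<omega>. B (\<tau> (Suc i)) \<omega> - B (\<tau> i) \<omega>) {..<n})"

definition path_algebra :: "'a measure \<Rightarrow> (real \<Rightarrow> 'a \<Rightarrow> real) \<Rightarrow> 'a measure" where
  "path_algebra M B =
     vimage_algebra (space M) (\<lambda>\<omega>. \<lambda>t\<in>{0..}. B t \<omega>) (PiM {0..} (\<lambda>_. borel))"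

definition excursions :: "(real \<Rightarrow> 'a \<Rightarrow> real) \<Rightarrow> 'a \<Rightarrow> real set set" where
  "excursions B \<omega> = components {t. t \<ge> 0 \<and> \<bar>B t \<omega>\<bar> \<noteq> 0}"

text \<open>An enumeration (indexed from \<open>0\<close>) of the almost surely infinitely many excursion intervals.
  It is determined, measurably, by the path of \<open>B\<close>: an enumeration that could look at the leg
  labels would destroy their independence of \<open>B\<close>. For open intervals, measurability of the events
  \<open>t \<in> J m\<close> is the same as measurability of the end points.\<close>

definition excursion_enum ::
  "'a measure \<Rightarrow> (real \<Rightarrow> 'a \<Rightarrow> real) \<Rightarrow> (nat \<Rightarrow> 'a \<Rightarrow> real set) \<Rightarrow> bool" where
  "excursion_enum M B J \<longleftrightarrow>
     (AE \<omega> in M. bij_betw (\<lambda>m. J m \<omega>) UNIV (excursions B \<omega>)) \<and>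
     (\<forall>m. \<forall>t\<ge>0. {\<omega>\<in>space M. t \<in> J m \<omega>} \<in> sets (path_algebra M B))"

definition leg_labels ::
  "nat \<Rightarrow> (nat \<Rightarrow> real) \<Rightarrow> 'a measure \<Rightarrow> (real \<Rightarrow> 'a \<Rightarrow> real) \<Rightarrow> (nat \<Rightarrow> 'a \<Rightarrow> nat) \<Rightarrow> bool" where
  "leg_labels N p M B \<kappa> \<longleftrightarrow>
     (\<forall>m. \<forall>\<omega>\<in>space M. \<kappa> m \<omega> \<in> {1..N}) \<and>
     prob_space.indep_vars M (\<lambda>_. count_space UNIV) \<kappa> UNIV \<and>
     (\<forall>m. \<forall>j\<in>{1..N}. \<P>(\<omega> in M. \<kappa> m \<omega> = j) = p j) \<and>
     prob_space.indep_set M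
       (sets (path_algebra M B))
       (sets (vimage_algebra (space M) (\<lambda>\<omega> m. \<kappa> m \<omega>) (PiM UNIV (\<lambda>_. count_space UNIV))))"

definition brownian_spider ::
  "nat \<Rightarrow> (nat \<Rightarrow> real) \<Rightarrow> 'a measure \<Rightarrow> (real \<Rightarrow> 'a \<Rightarrow> complex) \<Rightarrow> bool" where
  "brownian_spider N p M X \<longleftrightarrow>
     (\<forall>t\<ge>0. X t \<in> borel_measurable M) \<and>
     (\<forall>t\<ge>0. \<forall>\<omega>\<in>space M. X t \<omega> \<in> spider N) \<and>
     (\<exists>B J \<kappa>. brownian_motion M B \<and> excursion_enum M B J \<and> leg_labels N p M B \<kappa> \<and>
        (\<forall>\<omega>\<in>space M. \<forall>t\<ge>0.
           (B t \<omega> = 0 \<longrightarrow> X t \<omega> = 0) \<and>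
           (\<forall>m. B t \<omega> \<noteq> 0 \<and> t \<in> J m \<omega> \<longrightarrow> X t \<omega> = spider_pt N \<bar>B t \<omega>\<bar> (\<kappa> m \<omega>))))"

end

theory Submission
  imports Defs "HOL-Real_Asymp.Real_Asymp"
begin

text \<open>Both processes live on one Brownian motion. Stop \<open>B\<close> at the successive times \<open>\<tau> n\<close> at which it has moved by
  \<open>1\<close>, and let the walk be the Brownian spider \<open>X\<close> at these times. The path of \<open>B\<close> alone decides the
  heights of the walk; the labels met up to time \<open>n\<close> are those of distinct excursions, selected by
  the path, hence independent with law \<open>p\<close> given the path, which gives the transition probabilities.
  The durations \<open>\<tau> (n + 1) - \<tau> n\<close> are i.i.d. with mean \<open>1\<close> and exponential moments, so
  \<open>\<bar>\<tau> n - n\<bar> = O(sqrt (n log log n))\<close> almost surely, and over a window of that length \<open>B\<close> oscillates by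
  at most \<open>O((n log log n)^(1/4) (log n)^(1/2))\<close>. If \<open>B\<close> has no zero between \<open>\<tau> n\<close> and \<open>n\<close>, then the
  walk and \<open>X n\<close> are on the same leg; otherwise both are as close to the body as \<open>B\<close> oscillates.\<close>


section \<open>Characteristic functions and independence\<close>

text \<open>The difficulty is to restart the path at the random times \<open>\<tau> n\<close>. The
  past enters through an arbitrary event \<open>A\<close> of \<open>pre_sigma (\<tau> n)\<close>,
  and one identity for a complex exponential martingale, integrated over \<open>A\<close> between
  two consecutive hits, plays the role of the strong Markov property. Its imaginary part makes the
  next sign fair, its real part gives the exponential moments of the duration. Bounds valid on every
  such \<open>A\<close> act like conditional expectations and feed Doob's maximal inequality.
  Optional stopping is proved on dyadic grids, so the filtration, the hitting times and the
  excursions are all arranged to be decided by the path at dyadic times. The factor (log n)^(1/2) is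
  the price of Borel-Cantelli over all n for the Gaussian tail of the oscillation. Brownian motion
  is built from independent normals on a product space whose remaining coordinates carry the labels,
  so labels and path are independent by construction. Bad paths are replaced, which makes all
  hitting times finite everywhere and not just almost surely.\<close>

lemma (in prob_space) expectation_char_weight:
  fixes X w :: "'a \<Rightarrow> real"
  assumes [measurable]: "X \<in> borel_measurable M" "w \<in> borel_measurable M"
    and w: "\<And>\<omega>. \<bar>w \<omega>\<bar> \<le> 1"
    and H: "\<And>u. (\<integral>\<omega>. of_real (w \<omega>) * iexp (u * X \<omega>) \<partial>M) = of_real (\<integral>\<omega>. w \<omega> \<partial>M) * char (distr M borel X) u"
    and C [measurable]: "C \<in> sets borel"
  shows "(\<integral>\<omega>. w \<omega> * indicator C (X \<omega>) \<partial>M) = (\<integral>\<omega>. w \<omega> \<partial>M) * measure (distr M borel X) C"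
proof -
  have iw: "integrable M w" by (rule integrable_const_bound[of _ 1]) (use w in auto)
  \<comment> \<open>The weight may change sign, but \<open>2 + w \<omega>\<close> is at least 1;
    divided by its mean \<open>e\<close> it is a probability density. Hypothesis \<open>H\<close>
    says that \<open>X\<close> has the same characteristic function under the tilted measure as
    under \<open>M\<close>, so Levy's uniqueness theorem identifies the two laws.\<close>
  define e where "e = 2 + (\<integral>\<omega>. w \<omega> \<partial>M)"
  have "\<bar>\<integral>\<omega>. w \<omega> \<partial>M\<bar> \<le> 1"
    using order_trans[OF integral_norm_bound[of M w], of 1] integral_mono[of M "\<lambda>\<omega>. \<bar>w \<omega>\<bar>" "\<lambda>_. 1"] w iw
    by (auto simp: prob_space)
  then have e: "e \<ge> 1" by (auto simp: e_def)
  define v where "v = (\<lambda>\<omega>. (2 + w \<omega>) / e)"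
  have v0: "v \<omega> \<ge> 0" for \<omega> using e w[of \<omega>] by (auto simp: v_def)
  have [measurable]: "v \<in> borel_measurable M" by (simp add: v_def)
  have iv: "integrable M v" unfolding v_def using iw by auto
  have v1: "(\<integral>\<omega>. v \<omega> \<partial>M) = 1"
    using iw e by (simp add: v_def e_def prob_space)
  define N where "N = density M (\<lambda>\<omega>. ennreal (v \<omega>))"
  have sN[measurable_cong]: "sets N = sets M" by (simp add: N_def)
  have "emeasure N (space N) = 1"
    unfolding N_def
    by (subst emeasure_density) (auto simp: nn_integral_eq_integral iv v0 v1 cong: nn_integral_cong)
  then interpret N: prob_space N by (rule prob_spaceI)
  have spN: "space N = space M" by (simp add: N_def)
  have ie: "integrable M (\<lambda>\<omega>. complex_of_real (w \<omega>) * iexp (u * X \<omega>))" for u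
    by (rule integrable_const_bound[of _ 1]) (use w in \<open>auto simp: norm_mult\<close>)
  have ie': "integrable M (\<lambda>\<omega>. iexp (u * X \<omega>))" for u
    by (rule integrable_const_bound[of _ 1]) auto
  have "char (distr N borel X) u = char (distr M borel X) u" for u
  proof -
    have "char (distr N borel X) u = (\<integral>\<omega>. iexp (u * X \<omega>) \<partial>N)"
      unfolding char_def by (subst integral_distr) auto
    also have "\<dots> = (\<integral>\<omega>. v \<omega> *\<^sub>R iexp (u * X \<omega>) \<partial>M)"
      unfolding N_def by (subst integral_density) (auto simp: v0)
    also have "\<dots> = (\<integral>\<omega>. (2 * iexp (u * X \<omega>) + of_real (w \<omega>) * iexp (u * X \<omega>)) / of_real e \<partial>M)"
      by (intro Bochner_Integration.integral_cong) (auto simp: v_def scaleR_conv_of_real algebra_simps)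
    also have "\<dots> = (2 * (\<integral>\<omega>. iexp (u * X \<omega>) \<partial>M) + (\<integral>\<omega>. of_real (w \<omega>) * iexp (u * X \<omega>) \<partial>M)) / of_real e"
      using ie[of u] ie'[of u] by simp
    also have "(\<integral>\<omega>. iexp (u * X \<omega>) \<partial>M) = char (distr M borel X) u"
      unfolding char_def by (subst integral_distr) auto
    also have "(2 * char (distr M borel X) u + (\<integral>\<omega>. of_real (w \<omega>) * iexp (u * X \<omega>) \<partial>M)) / of_real e
      = char (distr M borel X) u"
    proof -
      have "2 * char (distr M borel X) u + of_real (\<integral>\<omega>. w \<omega> \<partial>M) * char (distr M borel X) u
        = of_real e * char (distr M borel X) u" by (simp add: e_def distrib_right)
      then show ?thesis unfolding H using e by simp
    qed
    finally show ?thesis .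
  qed
  then have eq: "distr N borel X = distr M borel X"
    by (intro Levy_uniqueness ext) auto
  have "measure (distr N borel X) C = (\<integral>\<omega>. indicator C (X \<omega>) \<partial>N)"
    by (subst integral_distr[of X N borel "indicator C :: real \<Rightarrow> real", symmetric]) auto
  also have "\<dots> = (\<integral>\<omega>. v \<omega> *\<^sub>R indicator C (X \<omega>) \<partial>M)"
    unfolding N_def by (subst integral_density) (auto simp: v0)
  also have "\<dots> = (\<integral>\<omega>. (2 * indicator C (X \<omega>) + w \<omega> * indicator C (X \<omega>)) / e \<partial>M)"
    by (intro Bochner_Integration.integral_cong) (auto simp: v_def algebra_simps)
  also have "\<dots> = (2 * (\<integral>\<omega>. indicator C (X \<omega>) \<partial>M) + (\<integral>\<omega>. w \<omega> * indicator C (X \<omega>) \<partial>M)) / e"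
  proof -
    have 1: "integrable M (\<lambda>\<omega>. indicator C (X \<omega>) :: real)"
      by (rule integrable_const_bound[of _ 1]) auto
    have 2: "integrable M (\<lambda>\<omega>. w \<omega> * indicator C (X \<omega>) :: real)"
      by (rule integrable_const_bound[of _ 1]) (use w in \<open>auto simp: indicator_def\<close>)
    show ?thesis using 1 2 by simp
  qed
  also have "(\<integral>\<omega>. indicator C (X \<omega>) \<partial>M) = measure (distr M borel X) C"
    by (subst integral_distr[of X M borel "indicator C :: real \<Rightarrow> real", symmetric]) auto
  finally show ?thesis
    unfolding eq using e by (simp add: e_def field_simps)
qed

text \<open>Kac's criterion. Exponentials are exchanged for indicators one coordinate at a time:
  \<open>claim\<close>, with \<open>m\<close> indicators and the remaining exponentials,
  interpolates between the hypothesis at \<open>m = 0\<close> and the product formula at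
  \<open>m = n\<close>.\<close>

theorem (in prob_space) indep_vars_char:
  fixes X :: "nat \<Rightarrow> 'a \<Rightarrow> real"
  assumes X: "\<And>k. k < n \<Longrightarrow> X k \<in> borel_measurable M"
    and H: "\<And>u. (\<integral>\<omega>. iexp (\<Sum>k<n. u k * X k \<omega>) \<partial>M) = (\<Prod>k<n. char (distr M borel (X k)) (u k))"
  shows "indep_vars (\<lambda>_. borel) X {..<n}"
proof -
  define \<phi> where "\<phi> k = char (distr M borel (X k))" for k
  have claim: "(\<integral>\<omega>. of_real (\<Prod>k<m. indicator (C k) (X k \<omega>)) * iexp (\<Sum>k\<in>{m..<n}. u k * X k \<omega>) \<partial>M)
      = of_real (\<Prod>k<m. measure (distr M borel (X k)) (C k)) * (\<Prod>k\<in>{m..<n}. \<phi> k (u k))"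
    if "m \<le> n" "\<And>k. C k \<in> sets borel" for m u C
    using that
  proof (induction m arbitrary: u)
    case 0
    then show ?case using H[of u] by (simp add: \<phi>_def atLeast0LessThan)
  next
    case (Suc m)
    note C = \<open>\<And>k. C k \<in> sets borel\<close>
    then have [measurable]: "\<And>k. C k \<in> sets borel" by auto
    have m: "m < n" using Suc.prems by simp
    have [measurable]: "X k \<in> borel_measurable M" if "k < n" for k using X that by auto
    define Y where "Y \<omega> = (\<Prod>k<m. indicator (C k) (X k \<omega>) :: real)" for \<omega>
    define V where "V u \<omega> = (\<Sum>k\<in>{Suc m..<n}. u k * X k \<omega>)" for u \<omega>
    define y where "y = (\<Prod>k<m. measure (distr M borel (X k)) (C k))"
    define P where "P u = (\<Prod>k\<in>{Suc m..<n}. \<phi> k (u k))" for u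
    have [measurable]: "Y \<in> borel_measurable M" unfolding Y_def using m
        by (intro borel_measurable_prod borel_measurable_indicator') auto
    have Xm [measurable]: "X m \<in> borel_measurable M" using m by simp
    have V_meas [measurable]: "V u \<in> borel_measurable M" for u
      unfolding V_def by (intro borel_measurable_sum borel_measurable_times) auto
    have Y01: "\<bar>Y \<omega>\<bar> \<le> 1" for \<omega>
      unfolding Y_def abs_prod by (intro prod_le_1) (auto simp: indicator_def)
    have IH: "(\<integral>\<omega>. of_real (Y \<omega>) * iexp (s * X m \<omega> + V u \<omega>) \<partial>M) = of_real y * (\<phi> m s * P u)" for s u
    proof -
      have eq: "{m..<n} = insert m {Suc m..<n}" using m by auto
      have 1: "(\<Sum>k\<in>{m..<n}. (u(m := s)) k * X k \<omega>) = s * X m \<omega> + V u \<omega>" for \<omega>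
        unfolding eq V_def by (subst sum.insert) (auto intro!: sum.cong)
      have 2: "(\<Prod>k\<in>{m..<n}. \<phi> k ((u(m := s)) k)) = \<phi> m s * P u"
        unfolding eq P_def by (subst prod.insert) (auto intro!: prod.cong)
      show ?thesis
        using Suc.IH[of "u(m := s)", unfolded 1 2] Suc.prems by (simp only: Y_def y_def)
    qed
    have Vm: "V (\<lambda>k. - u k) \<omega> = - V u \<omega>" for u \<omega>
      by (simp add: V_def sum_negf)
    have \<phi>0: "\<phi> m 0 = 1" unfolding \<phi>_def
      by (rule real_distribution.char_zero) simp
    have int: "integrable M (\<lambda>\<omega>. complex_of_real (Y \<omega>) * iexp (f \<omega>))" if [measurable]: "f \<in> borel_measurable M" for f
      by (rule integrable_const_bound[of _ 1]) (use Y01 in \<open>auto simp: norm_mult\<close>)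
    have w: "(\<integral>\<omega>. of_real (w \<omega>) * indicator (C m) (X m \<omega>) \<partial>M) =
        (\<integral>\<omega>. of_real (w \<omega>) \<partial>M) * complex_of_real (measure (distr M borel (X m)) (C m))"
      if [measurable]: "w \<in> borel_measurable M" and w1: "\<And>\<omega>. \<bar>w \<omega>\<bar> \<le> 1"
        and weq: "\<And>s. (\<integral>\<omega>. of_real (w \<omega>) * iexp (s * X m \<omega>) \<partial>M) = c * \<phi> m s" for w c
    proof -
      have c: "(\<integral>\<omega>. of_real (w \<omega>) \<partial>M) = c" using weq[of 0] by (simp add: \<phi>0)
      have "(\<integral>\<omega>. w \<omega> * indicator (C m) (X m \<omega>) \<partial>M) = (\<integral>\<omega>. w \<omega> \<partial>M) * measure (distr M borel (X m)) (C m)"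
        by (rule expectation_char_weight) (use weq w1 c in \<open>auto simp: \<phi>_def
            integral_complex_of_real[symmetric] simp del: integral_complex_of_real\<close>)
      from arg_cong[OF this, of complex_of_real] show ?thesis
        by (simp add: integral_complex_of_real[symmetric] of_real_indicator del: integral_complex_of_real)
    qed
    have iexp_add: "iexp (x + z) = iexp x * iexp z" for x z by (simp add: distrib_left exp_add)
    have of_real_cos: "complex_of_real (cos z) = (iexp z + iexp (- z)) / 2" for z
      by (simp add: cos_of_real[symmetric] cos_exp_eq del: cos_of_real)
    have of_real_sin: "complex_of_real (sin z) = (iexp z - iexp (- z)) / (2 * \<i>)" for z
      by (simp add: sin_of_real[symmetric] sin_exp_eq del: sin_of_real)
    \<comment> \<open>Weights have to be real, so the remaining exponential is split into cosine and
      sine. Each is a combination of the induction hypothesis at \<open>u\<close> and at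
      \<open>- u\<close>.\<close>
    have cosV: "(\<integral>\<omega>. of_real (Y \<omega> * cos (V u \<omega>)) * iexp (s * X m \<omega>) \<partial>M) = (of_real y * (P u + P (\<lambda>k. - u k)) /
        2) * \<phi> m s" for s
    proof -
      have "(\<integral>\<omega>. of_real (Y \<omega> * cos (V u \<omega>)) * iexp (s * X m \<omega>) \<partial>M) =
        (\<integral>\<omega>. (of_real (Y \<omega>) * iexp (s * X m \<omega> + V u \<omega>) + of_real (Y \<omega>) * iexp (s * X m \<omega> + V (\<lambda>k. - u k) \<omega>)) / 2 \<partial>M)"
        by (intro Bochner_Integration.integral_cong refl)
           (simp only: Vm iexp_add of_real_mult of_real_cos, simp add: field_simps)
      also have "\<dots> = (of_real y * (\<phi> m s * P u) + of_real y * (\<phi> m s * P (\<lambda>k. - u k))) / 2"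
        unfolding IH[symmetric] using int[of "\<lambda>\<omega>. s * X m \<omega> + V u \<omega>"] int[of "\<lambda>\<omega>. s * X m \<omega> + V (\<lambda>k. - u k) \<omega>"]
        by (simp del: of_real_add of_real_mult)
      finally show ?thesis by (simp add: field_simps)
    qed
    have sinV: "(\<integral>\<omega>. of_real (Y \<omega> * sin (V u \<omega>)) * iexp (s * X m \<omega>) \<partial>M) = (of_real y * (P u - P (\<lambda>k. - u k)) /
        (2 * \<i>)) * \<phi> m s" for s
    proof -
      have "(\<integral>\<omega>. of_real (Y \<omega> * sin (V u \<omega>)) * iexp (s * X m \<omega>) \<partial>M) =
        (\<integral>\<omega>. (of_real (Y \<omega>) * iexp (s * X m \<omega> + V u \<omega>) - of_real (Y \<omega>) * iexp (s * X m \<omega> + V (\<lambda>k. - u k) \<omega>)) /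
            (2 * \<i>) \<partial>M)"
        by (intro Bochner_Integration.integral_cong refl)
           (simp only: Vm iexp_add of_real_mult of_real_sin, simp add: field_simps)
      also have "\<dots> = (of_real y * (\<phi> m s * P u) - of_real y * (\<phi> m s * P (\<lambda>k. - u k))) / (2 * \<i>)"
        unfolding IH[symmetric] using int[of "\<lambda>\<omega>. s * X m \<omega> + V u \<omega>"] int[of "\<lambda>\<omega>. s * X m \<omega> + V (\<lambda>k. - u k) \<omega>"]
        by (simp del: of_real_add of_real_mult)
      finally show ?thesis by (simp add: field_simps)
    qed
    have le: "\<bar>Y \<omega> * cos z\<bar> \<le> 1" "\<bar>Y \<omega> * sin z\<bar> \<le> 1" for \<omega> z
      using mult_mono[OF Y01[of \<omega>] abs_cos_le_one[of z]] mult_mono[OF Y01[of \<omega>] abs_sin_le_one[of z]]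
      by (auto simp: abs_mult)
    define q where "q = measure (distr M borel (X m)) (C m)"
    have 1: "(\<integral>\<omega>. of_real (Y \<omega> * cos (V u \<omega>)) * indicator (C m) (X m \<omega>) \<partial>M) = of_real y * (P u + P (\<lambda>k. - u k))
        / 2 * complex_of_real q"
      using w[OF _ _ cosV] cosV[of 0] le by (simp add: \<phi>0 q_def)
    have 2: "(\<integral>\<omega>. of_real (Y \<omega> * sin (V u \<omega>)) * indicator (C m) (X m \<omega>) \<partial>M) = of_real y * (P u - P (\<lambda>k. - u k))
        / (2 * \<i>) * complex_of_real q"
      using w[OF _ _ sinV] sinV[of 0] le by (simp add: \<phi>0 q_def)
    have i1: "integrable M (\<lambda>\<omega>. complex_of_real (Y \<omega> * cos (V u \<omega>)) * indicator (C m) (X m \<omega>))"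
      by (rule integrable_const_bound[of _ 1]) (use le in \<open>auto simp: norm_mult indicator_def
          abs_mult[symmetric] simp flip: of_real_mult\<close>)
    have i2: "integrable M (\<lambda>\<omega>. complex_of_real (Y \<omega> * sin (V u \<omega>)) * indicator (C m) (X m \<omega>))"
      by (rule integrable_const_bound[of _ 1]) (use le in \<open>auto simp: norm_mult indicator_def
          abs_mult[symmetric] simp flip: of_real_mult\<close>)
    have "(\<integral>\<omega>. of_real (\<Prod>k<Suc m. indicator (C k) (X k \<omega>)) * iexp (\<Sum>k\<in>{Suc m..<n}. u k * X k \<omega>) \<partial>M)
      = (\<integral>\<omega>. of_real (Y \<omega> * cos (V u \<omega>)) * indicator (C m) (X m \<omega>) + \<i> * (of_real (Y \<omega> * sin (V u \<omega>)) *
          indicator (C m) (X m \<omega>)) \<partial>M)"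
    proof (intro Bochner_Integration.integral_cong refl)
      fix \<omega>
      have "(\<Prod>k<Suc m. indicator (C k) (X k \<omega>)) = Y \<omega> * indicator (C m) (X m \<omega>)" by (simp add: Y_def)
      then show "of_real (\<Prod>k<Suc m. indicator (C k) (X k \<omega>)) * iexp (\<Sum>k\<in>{Suc m..<n}. u k * X k \<omega>)
        = of_real (Y \<omega> * cos (V u \<omega>)) * indicator (C m) (X m \<omega>) + \<i> * (of_real (Y \<omega> * sin (V u \<omega>)) * indicator
            (C m) (X m \<omega>))"
        unfolding V_def[symmetric]
        by (simp only: exp_Euler) (auto simp: cos_of_real sin_of_real algebra_simps indicator_def)
    qed
    also have "\<dots> = of_real y * (P u + P (\<lambda>k. - u k)) / 2 * complex_of_real q + \<i> * (of_real y * (P u - P (\<lambda>k. -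
        u k)) / (2 * \<i>) * complex_of_real q)"
      using i1 i2 1 2 by (simp del: of_real_mult)
    also have "\<dots> = of_real (y * q) * P u"
      by (simp add: field_simps)
    finally show ?case by (simp add: y_def q_def P_def)
  qed
  have prodeq: "prob (\<Inter>j\<in>J. X j -` C j \<inter> space M) = (\<Prod>j\<in>J. prob (X j -` C j \<inter> space M))"
    if J: "J \<noteq> {}" "J \<subseteq> {..<n}" and C: "\<And>j. j \<in> J \<Longrightarrow> C j \<in> sets borel" for J C
  proof -
    \<comment> \<open>Indices outside \<open>J\<close> receive the trivial set, so that one product
      over all \<open>k < n\<close> serves every \<open>J\<close>.\<close>
    define C' where "C' j = (if j \<in> J then C j else UNIV)" for j
    have C': "C' k \<in> sets borel" for k using C by (auto simp: C'_def)
    have "(\<integral>\<omega>. of_real (\<Prod>k<n. indicator (C' k) (X k \<omega>)) \<partial>M) = complex_of_real (\<Prod>k<n. measure (distr M borel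
        (X k)) (C' k))"
      using claim[of n C'] C' by simp
    then have 1: "(\<integral>\<omega>. (\<Prod>k<n. indicator (C' k) (X k \<omega>)) \<partial>M) = (\<Prod>k<n. measure (distr M borel (X k)) (C' k))"
      by (simp only: integral_complex_of_real of_real_eq_iff)
    have "(\<integral>\<omega>. (\<Prod>k<n. indicator (C' k) (X k \<omega>) :: real) \<partial>M) = (\<integral>\<omega>. indicator (\<Inter>j\<in>J. X j -` C j \<inter> space M) \<omega> \<partial>M)"
    proof (intro Bochner_Integration.integral_cong refl)
      fix \<omega> assume w: "\<omega> \<in> space M"
      have "(\<Prod>k<n. indicator (C' k) (X k \<omega>) :: real) = (if \<forall>k<n. X k \<omega> \<in> C' k then 1 else 0)"
      proof (cases "\<forall>k<n. X k \<omega> \<in> C' k")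
        case False
        then obtain k where "k < n" "X k \<omega> \<notin> C' k" by auto
        then have "(\<Prod>k<n. indicator (C' k) (X k \<omega>) :: real) = 0" by (intro prod_zero) (auto intro!: bexI[of _ k])
        then show ?thesis using False by (simp only: if_False)
      qed auto
      also have "\<dots> = indicator (\<Inter>j\<in>J. X j -` C j \<inter> space M) \<omega>"
        using J w by (auto simp: C'_def indicator_def split: if_splits)
      finally show "(\<Prod>k<n. indicator (C' k) (X k \<omega>) :: real) = indicator (\<Inter>j\<in>J. X j -` C j \<inter> space M) \<omega>" .
    qed
    also have "\<dots> = prob (\<Inter>j\<in>J. X j -` C j \<inter> space M)"
    proof -
      have "(\<Inter>j\<in>J. X j -` C j \<inter> space M) \<inter> space M = (\<Inter>j\<in>J. X j -` C j \<inter> space M)"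
        using J by auto
      then show ?thesis by (metis Bochner_Integration.integral_indicator)
    qed
    finally have 2: "prob (\<Inter>j\<in>J. X j -` C j \<inter> space M) = (\<Prod>k<n. measure (distr M borel (X k)) (C' k))"
      using 1 by simp
    also have "\<dots> = (\<Prod>k\<in>J. measure (distr M borel (X k)) (C' k))"
    proof (rule prod.mono_neutral_right)
      show "\<forall>i\<in>{..<n} - J. measure (distr M borel (X i)) (C' i) = 1"
        using X by (auto simp: C'_def measure_distr prob_space)
    qed (use J in auto)
    also have "\<dots> = (\<Prod>j\<in>J. prob (X j -` C j \<inter> space M))"
      using J X C by (intro prod.cong refl) (auto simp: C'_def measure_distr subset_eq)
    finally show ?thesis .
  qed
  show ?thesis
    unfolding indep_vars_def2
  proof (intro conjI ballI indep_setsI)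
    fix A J assume J: "J \<noteq> {}" "J \<subseteq> {..<n}" "\<forall>j\<in>J. A j \<in> {X j -` C \<inter> space M |C. C \<in> sets borel}"
    then have "\<forall>j\<in>J. \<exists>C. C \<in> sets borel \<and> A j = X j -` C \<inter> space M" by auto
    then obtain C where C: "\<And>j. j \<in> J \<Longrightarrow> C j \<in> sets borel \<and> A j = X j -` C j \<inter> space M"
      by metis
    have "(\<Inter>j\<in>J. A j) = (\<Inter>j\<in>J. X j -` C j \<inter> space M)" using C by auto
    moreover have "(\<Prod>j\<in>J. prob (A j)) = (\<Prod>j\<in>J. prob (X j -` C j \<inter> space M))"
      using C by (intro prod.cong) auto
    ultimately show "prob (\<Inter>j\<in>J. A j) = (\<Prod>j\<in>J. prob (A j))"
      using prodeq[of J C] J C by presburger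
  next
    fix i assume i: "i \<in> {..<n}"
    then show 1: "X i \<in> borel_measurable M" using X by simp
    show "{X i -` C \<inter> space M |C. C \<in> sets borel} \<subseteq> events"
      using measurable_sets[OF 1] by blast
  qed
qed

text \<open>For \<open>\<sigma> = 0\<close> the density \<open>normal_density \<mu> \<sigma>\<close> is a junk value, so positivity is needed.\<close>

lemma (in prob_space) distributed_normal_iff_char:
  assumes X [measurable]: "X \<in> borel_measurable M" and \<sigma>: "\<sigma> > 0"
  shows "distributed M lborel X (\<lambda>x. ennreal (normal_density 0 \<sigma> x)) \<longleftrightarrow>
    (\<forall>u. char (distr M borel X) u = of_real (exp (- (\<sigma>\<^sup>2 * u\<^sup>2 / 2))))"
proof -
  have *: "char (density lborel (\<lambda>x. ennreal (normal_density 0 \<sigma> x))) u = of_real (exp (- (\<sigma>\<^sup>2 * u\<^sup>2 / 2)))" for u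
  proof -
    interpret N: prob_space std_normal_distribution by (rule prob_space_normal_density) simp
    \<comment> \<open>The identity on the standard normal space is a standard normal variable;
      scaling it by \<open>\<sigma>\<close> produces the required density together with its
      characteristic function.\<close>
    have "distributed std_normal_distribution lborel (\<lambda>x. x) std_normal_density"
      unfolding distributed_def by (auto simp: distr_id2 intro!: measure_eqI)
    from N.normal_density_affine[OF this, of \<sigma> 0] \<sigma>
    have "distributed std_normal_distribution lborel (\<lambda>x. \<sigma> * x) (normal_density 0 \<sigma>)" by simp
    then have d: "distr std_normal_distribution lborel (\<lambda>x. \<sigma> * x) = density lborel (\<lambda>x. ennreal
        (normal_density 0 \<sigma> x))"
      by (simp add: distributed_def)
    have "char (density lborel (\<lambda>x. ennreal (normal_density 0 \<sigma> x))) u = char std_normal_distribution (\<sigma> * u)"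
      unfolding d[symmetric] char_def by (subst integral_distr) (auto simp: mult_ac)
    then show ?thesis by (simp add: char_std_normal_distribution power_mult_distrib)
  qed
  have "distributed M lborel X (\<lambda>x. ennreal (normal_density 0 \<sigma> x)) \<longleftrightarrow>
    distr M borel X = density lborel (\<lambda>x. ennreal (normal_density 0 \<sigma> x))"
    unfolding distributed_def by (auto cong: distr_cong)
  also have "\<dots> \<longleftrightarrow> char (distr M borel X) = char (density lborel (\<lambda>x. ennreal (normal_density 0 \<sigma> x)))"
  proof
    assume "char (distr M borel X) = char (density lborel (\<lambda>x. ennreal (normal_density 0 \<sigma> x)))"
    then show "distr M borel X = density lborel (\<lambda>x. ennreal (normal_density 0 \<sigma> x))"
      using \<sigma> by (intro Levy_uniqueness real_distribution_distr X)
        (auto simp: real_distribution_def real_distribution_axioms_def prob_space_normal_density)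
  qed simp
  finally show ?thesis by (simp add: fun_eq_iff *)
qed

section \<open>Levy's construction of Brownian motion\<close>

text \<open>The increment over the interval from \<open>k / 2 ^ n\<close> to
  \<open>(k + 1) / 2 ^ n\<close>. Halving an interval splits its increment into half of itself plus
  or minus half of a fresh normal. The factor \<open>(1 / sqrt 2) ^ n\<close> is the standard
  deviation of a level \<open>n\<close> increment; with it both halves have variance
  \<open>(1/2) ^ (n + 1)\<close> and covariance 0.\<close>

fun dyadic_incr :: "(nat \<Rightarrow> nat \<Rightarrow> real) \<Rightarrow> nat \<Rightarrow> nat \<Rightarrow> real" where
  "dyadic_incr x 0 k = x 0 k"
| "dyadic_incr x (Suc n) k =
     (dyadic_incr x n (k div 2) + (if even k then 1 else - 1) * (1 / sqrt 2) ^ n * x (Suc n) (k div 2)) / 2"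

text \<open>A step function in place of the usual piecewise linear interpolation: its value is a
  plain sum of increments, and continuity is recovered in the uniform limit.\<close>

definition levy_step :: "(nat \<Rightarrow> nat \<Rightarrow> real) \<Rightarrow> nat \<Rightarrow> real \<Rightarrow> real" where
  "levy_step x n t = (\<Sum>j<nat \<lfloor>2 ^ n * t\<rfloor>. dyadic_incr x n j)"

text \<open>The rate \<open>9/10\<close> is below 1, so the corrections are summable, and above
  \<open>2 powr (- 1/4)\<close>, so that a fourth moment bound survives a union over
  \<open>K * 2 ^ n\<close> intervals.\<close>

definition levy_regular :: "(nat \<Rightarrow> nat \<Rightarrow> real) \<Rightarrow> bool" where
  "levy_regular x \<longleftrightarrow> (\<forall>K. \<exists>n0. \<forall>n\<ge>n0. \<forall>k<K * 2 ^ n. \<bar>dyadic_incr x n k\<bar> \<le> (9/10) ^ n)"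

text \<open>The default 0 on irregular sequences makes every path continuous and 0 at time 0, as
  \<open>brownian_motion\<close> demands at all sample points.\<close>

definition levy_path :: "(nat \<Rightarrow> nat \<Rightarrow> real) \<Rightarrow> real \<Rightarrow> real" where
  "levy_path x t = (if levy_regular x then lim (\<lambda>n. levy_step x n t) else 0)"

declare dyadic_incr.simps(2) [simp del]

lemma sum_lessThan_double:
  fixes f :: "nat \<Rightarrow> 'a::comm_monoid_add"
  shows "(\<Sum>k<2 * L. f k) = (\<Sum>k<L. f (2 * k) + f (2 * k + 1))"
  by (induction L) (auto simp: add_ac)

lemma dyadic_incr_refine: "dyadic_incr x (Suc n) (2 * k) + dyadic_incr x (Suc n) (2 * k + 1) = dyadic_incr x n k"
  by (simp add: dyadic_incr.simps field_simps)

lemma nat_floor_double: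
  assumes "0 \<le> (s::real)"
  shows "nat \<lfloor>2 * s\<rfloor> = 2 * nat \<lfloor>s\<rfloor> \<or> nat \<lfloor>2 * s\<rfloor> = 2 * nat \<lfloor>s\<rfloor> + 1"
proof -
  have "\<lfloor>2 * s\<rfloor> = 2 * \<lfloor>s\<rfloor> \<or> \<lfloor>2 * s\<rfloor> = 2 * \<lfloor>s\<rfloor> + 1" by linarith
  then show ?thesis using assms by (auto simp: nat_mult_distrib nat_add_distrib)
qed

text \<open>Refinement preserves the sums over whole coarse intervals, and
  \<open>\<lfloor>2 * s\<rfloor>\<close> exceeds \<open>2 * \<lfloor>s\<rfloor>\<close> by at most
  1; so the two levels differ by at most one fine increment.\<close>

lemma levy_step_Suc:
  assumes "\<forall>k<K * 2 ^ Suc n. \<bar>dyadic_incr x (Suc n) k\<bar> \<le> (9/10) ^ Suc n" and t: "0 \<le> t" "t < real K"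
  shows "\<bar>levy_step x (Suc n) t - levy_step x n t\<bar> \<le> (9/10) ^ Suc n"
proof -
  define j where "j = nat \<lfloor>2 ^ n * t\<rfloor>"
  have e: "(\<Sum>l<2 * j. dyadic_incr x (Suc n) l) = levy_step x n t"
    unfolding sum_lessThan_double dyadic_incr_refine levy_step_def j_def ..
  have "real j \<le> 2 ^ n * t" using t by (simp add: j_def)
  also have "\<dots> < 2 ^ n * real K" using t by simp
  finally have "real (2 * j) < real (K * 2 ^ Suc n)" by (simp add: mult.commute)
  then have j: "2 * j < K * 2 ^ Suc n" by (simp only: of_nat_less_iff)
  consider "nat \<lfloor>2 ^ Suc n * t\<rfloor> = 2 * j" | "nat \<lfloor>2 ^ Suc n * t\<rfloor> = Suc (2 * j)"
    using nat_floor_double[of "2 ^ n * t"] t by (auto simp: j_def mult.assoc)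
  then show ?thesis
  proof cases
    case 1 then show ?thesis using e by (simp add: levy_step_def)
  next
    case 2
    then have "levy_step x (Suc n) t = levy_step x n t + dyadic_incr x (Suc n) (2 * j)"
      using e unfolding levy_step_def[of x "Suc n"] by (simp only: sum.lessThan_Suc)
    then show ?thesis using assms(1)[rule_format, OF j] by (simp only: add_diff_cancel_left')
  qed
qed

text \<open>A geometric series: the sum of \<open>(9/10) ^ k\<close> from \<open>k = n\<close> on is
  \<open>10 * (9/10) ^ n\<close>. The level \<open>n0\<close> depends on \<open>K\<close> alone,
  which makes the approximation uniform on the interval from 0 to \<open>K\<close>.\<close>

lemma levy_path_approx:
  assumes x: "levy_regular x"
  obtains n0 where "\<And>n t. n0 \<le> n \<Longrightarrow> 0 \<le> t \<Longrightarrow> t < real K \<Longrightarrow> \<bar>levy_path x t - levy_step x n t\<bar> \<le> 10 * (9/10) ^ n"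
    and "\<And>t. 0 \<le> t \<Longrightarrow> t < real K \<Longrightarrow> (\<lambda>n. levy_step x n t) \<longlonglongrightarrow> levy_path x t"
    and "\<And>n k. n0 \<le> n \<Longrightarrow> k < K * 2 ^ n \<Longrightarrow> \<bar>dyadic_incr x n k\<bar> \<le> (9/10) ^ n"
proof -
  obtain n0 where n0: "\<And>n k. n0 \<le> n \<Longrightarrow> k < K * 2 ^ n \<Longrightarrow> \<bar>dyadic_incr x n k\<bar> \<le> (9/10) ^ n"
    using x unfolding levy_regular_def by blast
  have bd: "\<bar>levy_step x (n + d) t - levy_step x n t\<bar> \<le> 10 * (9/10) ^ n - 10 * (9/10) ^ (n + d)"
    if "n0 \<le> n" "0 \<le> t" "t < real K" for n d t
  proof (induction d)
    case (Suc d)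
    have "\<bar>levy_step x (Suc (n + d)) t - levy_step x (n + d) t\<bar> \<le> (9/10) ^ Suc (n + d)"
      using that by (intro levy_step_Suc[of K] allI impI n0) auto
    also have "\<dots> \<le> (9/10) ^ (n + d)" by simp
    finally have "\<bar>levy_step x (Suc (n + d)) t - levy_step x n t\<bar> \<le> (9/10) ^ (n + d) + (10 * (9/10) ^ n - 10 *
        (9/10) ^ (n + d))"
      using Suc.IH by linarith
    then show ?case by (simp add: field_simps)
  qed simp
  have conv: "(\<lambda>n. levy_step x n t) \<longlonglongrightarrow> levy_path x t" if t: "0 \<le> t" "t < real K" for t
  proof -
    have "Cauchy (\<lambda>n. levy_step x n t)"
    proof (rule metric_CauchyI)
      fix e :: real assume "e > 0"
      have "(\<lambda>n. 20 * (9/10::real) ^ n) \<longlonglongrightarrow> 20 * 0" by (intro tendsto_intros LIMSEQ_power_zero) auto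
      from order_tendstoD(2)[OF this, of e] \<open>e > 0\<close> obtain n1 where n1: "20 * (9/10::real) ^ n < e" if "n1 \<le> n" for n
        by (auto simp: eventually_sequentially)
      define n2 where "n2 = max n0 n1"
      have "\<bar>levy_step x m t - levy_step x n2 t\<bar> \<le> 10 * (9/10) ^ n2" if "m \<ge> n2" for m
      proof -
        from bd[of n2 t "m - n2"] that t
        have "\<bar>levy_step x m t - levy_step x n2 t\<bar> \<le> 10 * (9/10) ^ n2 - 10 * (9/10) ^ m" by (auto simp: n2_def)
        also have "\<dots> \<le> 10 * (9/10) ^ n2" by simp
        finally show ?thesis .
      qed note * = this
      show "\<exists>M. \<forall>m\<ge>M. \<forall>n\<ge>M. dist (levy_step x m t) (levy_step x n t) < e"
      proof (intro exI[of _ n2] allI impI)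
        fix m n assume "n2 \<le> m" "n2 \<le> n"
        with *[of m] *[of n] n1[of n2] show "dist (levy_step x m t) (levy_step x n t) < e"
          by (auto simp: dist_real_def n2_def)
      qed
    qed
    then show ?thesis
      using x by (auto simp: levy_path_def Cauchy_convergent_iff convergent_LIMSEQ_iff)
  qed
  have "\<bar>levy_path x t - levy_step x n t\<bar> \<le> 10 * (9/10) ^ n" if "n0 \<le> n" "0 \<le> t" "t < real K" for n t
  proof (rule LIMSEQ_le_const2)
    show "(\<lambda>d. \<bar>levy_step x (d + n) t - levy_step x n t\<bar>) \<longlonglongrightarrow> \<bar>levy_path x t - levy_step x n t\<bar>"
      by (intro tendsto_intros LIMSEQ_ignore_initial_segment conv that)
    show "\<exists>N. \<forall>d\<ge>N. \<bar>levy_step x (d + n) t - levy_step x n t\<bar> \<le> 10 * (9/10) ^ n"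
    proof (intro exI[of _ 0] allI impI)
      fix d
      have "\<bar>levy_step x (d + n) t - levy_step x n t\<bar> \<le> 10 * (9/10) ^ n - 10 * (9/10) ^ (n + d)"
        using bd[OF that, of d] by (simp add: add.commute)
      also have "\<dots> \<le> 10 * (9/10) ^ n" by simp
      finally show "\<bar>levy_step x (d + n) t - levy_step x n t\<bar> \<le> 10 * (9/10) ^ n" .
    qed
  qed
  from that[OF this conv n0] show ?thesis .
qed

lemma levy_path_LIMSEQ:
  assumes "levy_regular x" "0 \<le> t"
  shows "(\<lambda>n. levy_step x n t) \<longlonglongrightarrow> levy_path x t"
proof -
  obtain K :: nat where "t < real K" using reals_Archimedean2 by auto
  then show ?thesis using levy_path_approx[OF assms(1), of K] assms(2) by metis
qed

lemma levy_path_0: "levy_path x 0 = 0"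
  by (simp add: levy_path_def levy_step_def)

lemma continuous_levy_path: "continuous_on {0..} (levy_path x)"
proof (cases "levy_regular x")
  case False
  then have "levy_path x = (\<lambda>t. 0)" by (simp add: levy_path_def fun_eq_iff)
  then show ?thesis by simp
next
  case True
  show ?thesis
    unfolding continuous_on_iff
  proof (intro ballI allI impI)
    fix t e :: real assume t: "t \<in> {0..}" and e: "e > 0"
    obtain K :: nat where K: "t + 1 < real K" using reals_Archimedean2 by auto
    obtain n0 where n0: "\<And>n t. n0 \<le> n \<Longrightarrow> 0 \<le> t \<Longrightarrow> t < real K \<Longrightarrow> \<bar>levy_path x t - levy_step x n t\<bar> \<le> 10 * (9/10) ^ n"
      "\<And>n k. n0 \<le> n \<Longrightarrow> k < K * 2 ^ n \<Longrightarrow> \<bar>dyadic_incr x n k\<bar> \<le> (9/10) ^ n"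
      using levy_path_approx[OF True, of K] by metis
    \<comment> \<open>21 = 10 + 10 + 1: the approximation errors at \<open>s\<close> and
      \<open>t\<close>, and one jump of the level \<open>n\<close> step function, since times closer
      than \<open>(1/2) ^ n\<close> have floors that differ by at most 1.\<close>
    have "(\<lambda>n. 21 * (9/10::real) ^ n) \<longlonglongrightarrow> 21 * 0" by (intro tendsto_intros LIMSEQ_power_zero) auto
    from order_tendstoD(2)[OF this, of e] e obtain n1 where n1: "21 * (9/10::real) ^ n < e" if "n1 \<le> n" for n
      by (auto simp: eventually_sequentially)
    define n where "n = max n0 n1"
    have step: "\<bar>levy_step x n r - levy_step x n s\<bar> \<le> (9/10) ^ n"
      if "0 \<le> s" "s \<le> r" "r < s + (1/2) ^ n" "r < real K" for r s
    proof -
      have "2 ^ n * r < 2 ^ n * s + 1" using that(3) by (simp add: field_simps)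
      moreover have "2 ^ n * s \<le> 2 ^ n * r" using that by simp
      ultimately have "\<lfloor>2 ^ n * r\<rfloor> = \<lfloor>2 ^ n * s\<rfloor> \<or> \<lfloor>2 ^ n * r\<rfloor> = \<lfloor>2 ^ n * s\<rfloor> + 1" by linarith
      moreover have "\<lfloor>2 ^ n * s\<rfloor> \<ge> 0" using that by simp
      ultimately consider "nat \<lfloor>2 ^ n * r\<rfloor> = nat \<lfloor>2 ^ n * s\<rfloor>" | "nat \<lfloor>2 ^ n * r\<rfloor> = Suc (nat \<lfloor>2 ^ n * s\<rfloor>)"
        by (auto simp: nat_add_distrib)
      then show ?thesis
      proof cases
        case 2
        have "real (nat \<lfloor>2 ^ n * s\<rfloor>) \<le> 2 ^ n * s" using that by simp
        also have "\<dots> < 2 ^ n * real K" using that by simp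
        finally have "real (nat \<lfloor>2 ^ n * s\<rfloor>) < real (K * 2 ^ n)" by (simp add: mult.commute)
        then have "nat \<lfloor>2 ^ n * s\<rfloor> < K * 2 ^ n" by (simp only: of_nat_less_iff)
        then show ?thesis using n0(2)[of n "nat \<lfloor>2 ^ n * s\<rfloor>"]
          unfolding levy_step_def 2 sum.lessThan_Suc by (simp add: n_def)
      qed (simp add: levy_step_def)
    qed
    show "\<exists>d>0. \<forall>s\<in>{0..}. dist s t < d \<longrightarrow> dist (levy_path x s) (levy_path x t) < e"
    proof (intro exI[of _ "min 1 ((1/2) ^ n)"] conjI ballI impI)
      fix s :: real assume s: "s \<in> {0..}" "dist s t < min 1 ((1/2) ^ n)"
      then have sK: "s < real K" "t < real K" using K by (auto simp: dist_real_def)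
      have "\<bar>levy_step x n s - levy_step x n t\<bar> \<le> (9/10) ^ n"
      proof -
        have "\<bar>s - t\<bar> < (1/2) ^ n" using s by (simp add: dist_real_def)
        then have "t < s + (1/2) ^ n" "s < t + (1/2) ^ n" by linarith+
        then show ?thesis using step[of s t] step[of t s] s t sK by (cases "s \<le> t") auto
      qed
      moreover have "\<bar>levy_path x s - levy_step x n s\<bar> \<le> 10 * (9/10) ^ n" "\<bar>levy_path x t - levy_step x n t\<bar>
          \<le> 10 * (9/10) ^ n"
        using n0(1)[of n] s t sK by (auto simp: n_def)
      moreover have "21 * (9/10::real) ^ n < e" by (rule n1) (simp add: n_def)
      ultimately show "dist (levy_path x s) (levy_path x t) < e" by (auto simp: dist_real_def)
    qed auto
  qed
qed

lemma measurable_dyadic_incr [measurable (raw)]: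
  assumes "\<And>n k. (\<lambda>\<omega>. X \<omega> n k) \<in> borel_measurable M"
  shows "(\<lambda>\<omega>. dyadic_incr (X \<omega>) n k) \<in> borel_measurable M"
  by (induction n arbitrary: k)
     (auto simp: dyadic_incr.simps intro!: borel_measurable_divide borel_measurable_add borel_measurable_diff
         borel_measurable_times assms)

lemma measurable_levy_regular [measurable (raw)]:
  assumes [measurable]: "\<And>n k. (\<lambda>\<omega>. X \<omega> n k) \<in> borel_measurable M"
  shows "Measurable.pred M (\<lambda>\<omega>. levy_regular (X \<omega>))"
  unfolding levy_regular_def by measurable

lemma measurable_levy_path [measurable (raw)]:
  assumes [measurable]: "\<And>n k. (\<lambda>\<omega>. X \<omega> n k) \<in> borel_measurable M"
  shows "(\<lambda>\<omega>. levy_path (X \<omega>) t) \<in> borel_measurable M"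
  unfolding levy_path_def levy_step_def by measurable

text \<open>The coefficient \<open>u k\<close> is spread over all indices of block \<open>k\<close>.
  This turns a linear combination of increments over long intervals into one of single dyadic
  increments, with coefficients that are the same for every \<open>d\<close>, and records the
  variance.\<close>

lemma sum_increments_regroup:
  fixes N :: "nat \<Rightarrow> nat" and u :: "nat \<Rightarrow> real"
  assumes "\<And>k. k < n \<Longrightarrow> N k \<le> N (Suc k)"
  obtains v where "\<And>d :: nat \<Rightarrow> real. (\<Sum>k<n. u k * ((\<Sum>j<N (Suc k). d j) - (\<Sum>j<N k. d j))) = (\<Sum>j<N n. v j * d j)"
    and "(\<Sum>j<N n. (v j)\<^sup>2) = (\<Sum>k<n. (u k)\<^sup>2 * (real (N (Suc k)) - real (N k)))"
proof -
  have "\<exists>v. (\<forall>d :: nat \<Rightarrow> real. (\<Sum>k<n. u k * ((\<Sum>j<N (Suc k). d j) - (\<Sum>j<N k. d j))) = (\<Sum>j<N n. v j * d j))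
    \<and> (\<Sum>j<N n. (v j)\<^sup>2) = (\<Sum>k<n. (u k)\<^sup>2 * (real (N (Suc k)) - real (N k)))"
    using assms
  proof (induction n)
    case 0
    show ?case by (intro exI[of _ "\<lambda>_. 0"]) simp
  next
    case (Suc n)
    then obtain v where v: "\<And>d :: nat \<Rightarrow> real. (\<Sum>k<n. u k * ((\<Sum>j<N (Suc k). d j) - (\<Sum>j<N k. d j)))
        = (\<Sum>j<N n. v j * d j)"
      "(\<Sum>j<N n. (v j)\<^sup>2) = (\<Sum>k<n. (u k)\<^sup>2 * (real (N (Suc k)) - real (N k)))"
      by force
    have le: "N n \<le> N (Suc n)" using Suc.prems by simp
    have split: "(\<Sum>j<N (Suc n). f j) = (\<Sum>j<N n. f j) + (\<Sum>j=N n..<N (Suc n). f j)" for f :: "nat \<Rightarrow> real"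
      using le by (metis atLeast0LessThan sum.atLeastLessThan_concat zero_le)
    define v' where "v' j = (if j < N n then v j else u n)" for j
    have 1: "(\<Sum>k<Suc n. u k * ((\<Sum>j<N (Suc k). d j) - (\<Sum>j<N k. d j))) = (\<Sum>j<N (Suc n). v' j * d j)"
        for d :: "nat \<Rightarrow> real"
      unfolding sum.lessThan_Suc v(1) unfolding split by (simp add: v'_def sum_distrib_left)
    have 2: "(\<Sum>j<N (Suc n). (v' j)\<^sup>2) = (\<Sum>k<Suc n. (u k)\<^sup>2 * (real (N (Suc k)) - real (N k)))"
      unfolding split using le by (simp add: v'_def v(2) of_nat_diff)
    show ?case using 1 2 by blast
  qed
  then show ?thesis using that by blast
qed

section \<open>Finite-dimensional laws of the Levy path\<close>

locale gauss_family = prob_space M for M :: "'a measure" +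
  fixes \<xi> :: "nat \<Rightarrow> nat \<Rightarrow> 'a \<Rightarrow> real"
  assumes indep: "indep_vars (\<lambda>_. borel) (\<lambda>i. \<xi> (fst i) (snd i)) UNIV"
    and normal: "\<And>n k. distributed M lborel (\<xi> n k) std_normal_density"
begin

lemma measurable_\<xi> [measurable]: "\<xi> n k \<in> borel_measurable M"
  using normal[of n k] by (simp add: distributed_def)

abbreviation incr :: "nat \<Rightarrow> nat \<Rightarrow> 'a \<Rightarrow> real" where
  "incr n k \<omega> \<equiv> dyadic_incr (\<lambda>n k. \<xi> n k \<omega>) n k"

lemma char_gauss_sum:
  assumes "finite I"
  shows "(\<integral>\<omega>. iexp (\<Sum>i\<in>I. v i * \<xi> (fst i) (snd i) \<omega>) \<partial>M) = of_real (exp (- (\<Sum>i\<in>I. (v i)\<^sup>2) / 2))"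
proof -
  have ind: "indep_vars (\<lambda>_. borel) (\<lambda>i \<omega>. v i * \<xi> (fst i) (snd i) \<omega>) I"
    by (rule indep_vars_compose2[OF indep_vars_subset[OF indep]]) auto
  have "char (distr M borel (\<lambda>\<omega>. v i * \<xi> (fst i) (snd i) \<omega>)) 1 = of_real (exp (- (v i)\<^sup>2 / 2))" for i
  proof -
    have "char (distr M borel (\<lambda>\<omega>. v i * \<xi> (fst i) (snd i) \<omega>)) 1 = char (distr M borel (\<xi> (fst i) (snd i))) (v i)"
      unfolding char_def by (subst (1 2) integral_distr) auto
    also have "\<dots> = of_real (exp (- (v i)\<^sup>2 / 2))"
      using distributed_normal_iff_char[of "\<xi> (fst i) (snd i)" 1] normal by simp
    finally show ?thesis .
  qed
  then have "char (distr M borel (\<lambda>\<omega>. \<Sum>i\<in>I. v i * \<xi> (fst i) (snd i) \<omega>)) 1 = (\<Prod>i\<in>I. of_real (exp (- (v i)\<^sup>2 / 2)))"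
    using char_distr_sum[OF ind, of 1] by simp
  also have "\<dots> = of_real (exp (\<Sum>i\<in>I. - (v i)\<^sup>2 / 2))"
    unfolding exp_sum[OF assms] by simp
  also have "(\<Sum>i\<in>I. - (v i)\<^sup>2 / 2) = - (\<Sum>i\<in>I. (v i)\<^sup>2) / 2"
    by (simp add: sum_negf sum_divide_distrib)
  finally show ?thesis
    unfolding char_def by (subst (asm) integral_distr) auto
qed

text \<open>The formula says that the level \<open>n\<close> increments are independent normals of
  variance \<open>(1/2) ^ n\<close>, independent of the normals of later levels. The extra family
  \<open>I\<close> is what the induction needs: expressing level \<open>n + 1\<close> through level
  \<open>n\<close> releases the normals \<open>\<xi> (Suc n) k\<close>, which join
  \<open>I\<close>.\<close>

lemma char_incr_sum_gen:
  assumes "finite I" "\<And>i. i \<in> I \<Longrightarrow> fst i > n"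
  shows "(\<integral>\<omega>. iexp ((\<Sum>k<L. u k * incr n k \<omega>) + (\<Sum>i\<in>I. v i * \<xi> (fst i) (snd i) \<omega>)) \<partial>M)
    = of_real (exp (- ((1/2) ^ n * (\<Sum>k<L. (u k)\<^sup>2) + (\<Sum>i\<in>I. (v i)\<^sup>2)) / 2))"
  using assms
proof (induction n arbitrary: I L u v)
  have union: "(\<Sum>i\<in>Pair n ` {..<L} \<union> I. f i (if fst i = n then u (snd i) else v i)) =
      (\<Sum>k<L. f (n, k) (u k)) + (\<Sum>i\<in>I. f i (v i))"
    if "finite I" "\<And>i. i \<in> I \<Longrightarrow> fst i > n" for n L I u v and f :: "nat \<times> nat \<Rightarrow> real \<Rightarrow> real"
  proof (subst sum.union_disjoint)
    show "Pair n ` {..<L} \<inter> I = {}" using that(2) by force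
    have "(\<Sum>i\<in>Pair n ` {..<L}. f i (if fst i = n then u (snd i) else v i)) = (\<Sum>k<L. f (n, k) (u k))"
      by (subst sum.reindex) (auto simp: inj_on_def)
    moreover have "(\<Sum>i\<in>I. f i (if fst i = n then u (snd i) else v i)) = (\<Sum>i\<in>I. f i (v i))"
      using that(2) by (intro sum.cong) auto
    ultimately show "(\<Sum>i\<in>Pair n ` {..<L}. f i (if fst i = n then u (snd i) else v i)) +
      (\<Sum>i\<in>I. f i (if fst i = n then u (snd i) else v i)) = (\<Sum>k<L. f (n, k) (u k)) + (\<Sum>i\<in>I. f i (v i))" by simp
  qed (use that in auto)
  {
    case 0
    then show ?case
      using char_gauss_sum[of "Pair 0 ` {..<L} \<union> I" "\<lambda>i. if fst i = 0 then u (snd i) else v i"]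
        union[of I 0 "\<lambda>i y. y * \<xi> (fst i) (snd i) _" u v L]
        union[of I 0 "\<lambda>i y. y\<^sup>2" u v L]
      by simp
  next
    case (Suc n)
    \<comment> \<open>Padding with zeros lets the pairs \<open>2 * k\<close>,
      \<open>2 * k + 1\<close> with \<open>k < L\<close> run past \<open>L\<close>, whatever its
      parity.\<close>
    define u' where "u' k = (if k < L then u k else 0)" for k
    have ext: "(\<Sum>k<L. f k (u k)) = (\<Sum>k<L. f (2 * k) (u' (2 * k)) + f (2 * k + 1) (u' (2 * k + 1)))"
      if "\<And>k. f k 0 = 0" for f :: "nat \<Rightarrow> real \<Rightarrow> real"
    proof -
      have "(\<Sum>k<L. f k (u k)) = (\<Sum>k<2 * L. f k (u' k))"
        using that by (intro sum.mono_neutral_cong_left) (auto simp: u'_def)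
      then show ?thesis by (simp only: sum_lessThan_double)
    qed
    \<comment> \<open>Half-sums of the coefficients go to the coarse increments, half-differences to
      the fresh normals. By the parallelogram law the squares of half-sum and half-difference add up
      to half the sum of squares, which is the factor that lowers the variance from level
      \<open>n\<close> to level \<open>n + 1\<close>.\<close>
    define a where "a k = (u' (2 * k) + u' (2 * k + 1)) / 2" for k
    define b where "b k = (1 / sqrt 2) ^ n * (u' (2 * k) - u' (2 * k + 1)) / 2" for k
    have I: "finite I" "\<And>i. i \<in> I \<Longrightarrow> fst i > Suc n" using Suc.prems by auto
    have 1: "(\<Sum>k<L. u k * incr (Suc n) k \<omega>) = (\<Sum>k<L. a k * incr n k \<omega>) + (\<Sum>k<L. b k * \<xi> (Suc n) k \<omega>)" for \<omega>
    proof -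
      have "u' (2 * k) * incr (Suc n) (2 * k) \<omega> + u' (2 * k + 1) * incr (Suc n) (2 * k + 1) \<omega>
          = a k * incr n k \<omega> + b k * \<xi> (Suc n) k \<omega>" for k
        by (simp add: a_def b_def dyadic_incr.simps field_simps)
      then show ?thesis
        using ext[of "\<lambda>k y. y * incr (Suc n) k \<omega>"] by (simp add: sum.distrib)
    qed
    have sq: "((1 / sqrt 2) ^ n)\<^sup>2 = (1/2 :: real) ^ n"
      by (simp add: power_mult[symmetric] mult.commute[of n] power_divide) (simp add: power_mult)
    have 2: "(1/2) ^ Suc n * (\<Sum>k<L. (u k)\<^sup>2) = (1/2) ^ n * (\<Sum>k<L. (a k)\<^sup>2) + (\<Sum>k<L. (b k)\<^sup>2)"
    proof -
      have "(b k)\<^sup>2 = (1/2) ^ n * ((u' (2 * k) - u' (2 * k + 1)) / 2)\<^sup>2" for k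
        unfolding sq[symmetric] by (simp add: b_def power_mult_distrib[symmetric])
      then have "(1/2) ^ n * (\<Sum>k<L. (a k)\<^sup>2) + (\<Sum>k<L. (b k)\<^sup>2) =
        (1/2) ^ n * (\<Sum>k<L. (a k)\<^sup>2 + ((u' (2 * k) - u' (2 * k + 1)) / 2)\<^sup>2)"
        by (simp only: sum_distrib_left[symmetric] sum.distrib distrib_left)
      also have "(\<Sum>k<L. (a k)\<^sup>2 + ((u' (2 * k) - u' (2 * k + 1)) / 2)\<^sup>2) = (\<Sum>k<L. ((u' (2 * k))\<^sup>2 +
          (u' (2 * k + 1))\<^sup>2) / 2)"
        by (intro sum.cong) (auto simp: a_def power2_eq_square field_simps)
      also have "\<dots> = (\<Sum>k<L. (u k)\<^sup>2) / 2"
        using ext[of "\<lambda>k y. y\<^sup>2"] by (simp add: sum_divide_distrib)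
      finally show ?thesis by simp
    qed
    let ?I = "Pair (Suc n) ` {..<L} \<union> I" and ?v = "\<lambda>i. if fst i = Suc n then b (snd i) else v i"
    have 3: "(\<Sum>i\<in>?I. ?v i * \<xi> (fst i) (snd i) \<omega>) = (\<Sum>k<L. b k * \<xi> (Suc n) k \<omega>) + (\<Sum>i\<in>I. v i * \<xi> (fst i) (snd i)
        \<omega>)" for \<omega>
      using union[OF I, of "\<lambda>i y. y * \<xi> (fst i) (snd i) \<omega>" b v L] by simp
    have 4: "(\<Sum>i\<in>?I. (?v i)\<^sup>2) = (\<Sum>k<L. (b k)\<^sup>2) + (\<Sum>i\<in>I. (v i)\<^sup>2)"
      using union[OF I, of "\<lambda>i y. y\<^sup>2" b v L] by simp
    have "(\<integral>\<omega>. iexp ((\<Sum>k<L. a k * incr n k \<omega>) + (\<Sum>i\<in>?I. ?v i * \<xi> (fst i) (snd i) \<omega>)) \<partial>M)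
      = of_real (exp (- ((1/2) ^ n * (\<Sum>k<L. (a k)\<^sup>2) + (\<Sum>i\<in>?I. (?v i)\<^sup>2)) / 2))"
      using I by (intro Suc.IH) (auto dest: Suc_lessD)
    then show ?case unfolding 1 2 3 4 by (simp only: add.assoc)
  }
qed

lemma char_incr_sum:
  "(\<integral>\<omega>. iexp (\<Sum>k<L. u k * incr n k \<omega>) \<partial>M) = of_real (exp (- ((1/2) ^ n * (\<Sum>k<L. (u k)\<^sup>2)) / 2))"
  using char_incr_sum_gen[of "{}" n u L] by simp

lemma distributed_incr: "distributed M lborel (incr n k) (\<lambda>x. ennreal (normal_density 0 ((1 / sqrt 2) ^ n) x))"
proof (subst distributed_normal_iff_char)
  have sq: "((1 / sqrt 2) ^ n)\<^sup>2 = (1/2 :: real) ^ n"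
    by (simp add: power_mult[symmetric] mult.commute[of n] power_divide) (simp add: power_mult)
  show "\<forall>u. char (distr M borel (incr n k)) u = of_real (exp (- (((1 / sqrt 2) ^ n)\<^sup>2 * u\<^sup>2 / 2)))"
  proof
    fix u
    have "(\<Sum>l<Suc k. (if l = k then u else 0) * d l) = u * d k" for d :: "nat \<Rightarrow> real"
      by (simp add: if_distrib sum.If_cases cong: if_cong)
    moreover have "(\<Sum>l<Suc k. (if l = k then u else 0)\<^sup>2) = u\<^sup>2"
      by (simp add: if_distrib sum.If_cases cong: if_cong)
    ultimately show "char (distr M borel (incr n k)) u = of_real (exp (- (((1 / sqrt 2) ^ n)\<^sup>2 * u\<^sup>2 / 2)))"
      using char_incr_sum[of "\<lambda>l. if l = k then u else 0" n "Suc k"]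
      unfolding char_def sq by (subst integral_distr) (auto simp del: sum.lessThan_Suc)
  qed
qed auto

text \<open>Markov's inequality for the fourth moment, which is three times the squared variance,
  \<open>3 * (1/4) ^ n\<close>; and \<open>(1/4) / (9/10) ^ 4 = 2500/6561\<close>. Twice this ratio
  is still below 1, as the union over a level requires; with second moments that union would not be
  summable.\<close>

lemma prob_incr_gt: "prob {\<omega>\<in>space M. \<bar>incr n k \<omega>\<bar> > (9/10) ^ n} \<le> 3 * (2500/6561) ^ n"
proof -
  have "(\<integral>\<omega>. incr n k \<omega> ^ 4 \<partial>M) = (\<integral>x. normal_density 0 ((1 / sqrt 2) ^ n) x * x ^ 4 \<partial>lborel)"
    using distributed_integral[OF distributed_incr, of "\<lambda>x. x ^ 4" n k] by simp
  also have "\<dots> = 3 * (1/4) ^ n"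
  proof -
    have "sqrt 2 ^ 4 = (4::real)" using power_mult[of "sqrt 2" 2 2] by simp
    then have "sqrt 2 ^ (4 * n) = (4::real) ^ n" by (simp add: power_mult)
    then show ?thesis
      using integral_normal_moment_even[of "(1 / sqrt 2) ^ n" 0 2]
      by (simp add: fact_numeral power_divide power_mult[symmetric] mult.commute[of n] divide_simps)
  qed
  finally have E: "(\<integral>\<omega>. incr n k \<omega> ^ 4 \<partial>M) = 3 * (1/4) ^ n" .
  have int: "integrable M (\<lambda>\<omega>. incr n k \<omega> ^ 4)"
    using distributed_integrable[OF distributed_incr, of "\<lambda>x. x ^ 4" n k]
      integrable_normal_moment[of "(1 / sqrt 2) ^ n" 0 4] by simp
  have "{\<omega>\<in>space M. \<bar>incr n k \<omega>\<bar> > (9/10) ^ n} \<subseteq> {\<omega>\<in>space M. incr n k \<omega> ^ 4 \<ge> ((9/10) ^ n) ^ 4}"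
  proof safe
    fix \<omega> assume "\<bar>incr n k \<omega>\<bar> > (9/10) ^ n"
    then have "((9/10) ^ n) ^ 4 \<le> \<bar>incr n k \<omega>\<bar> ^ 4" by (intro power_mono) auto
    then show "((9/10) ^ n) ^ 4 \<le> incr n k \<omega> ^ 4" by (simp add: power_even_abs)
  qed
  then have "prob {\<omega>\<in>space M. \<bar>incr n k \<omega>\<bar> > (9/10) ^ n} \<le> prob {\<omega>\<in>space M. incr n k \<omega> ^ 4 \<ge> ((9/10) ^ n) ^ 4}"
    by (intro finite_measure_mono) auto
  also have "\<dots> \<le> (\<integral>\<omega>. incr n k \<omega> ^ 4 \<partial>M) / ((9/10) ^ n) ^ 4"
    by (intro integral_Markov_inequality_measure[where A="{}"] int) auto
  also have "\<dots> = 3 * ((1/4) ^ n / ((9/10) ^ 4) ^ n)"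
    unfolding E by (simp add: power_mult[symmetric] mult.commute)
  also have "\<dots> = 3 * (2500/6561) ^ n"
    unfolding power_divide[symmetric] by (simp add: eval_nat_numeral)
  finally show ?thesis .
qed

lemma AE_levy_regular: "AE \<omega> in M. levy_regular (\<lambda>n k. \<xi> n k \<omega>)"
proof -
  have "AE \<omega> in M. \<exists>n0. \<forall>n\<ge>n0. \<forall>k<K * 2 ^ n. \<bar>incr n k \<omega>\<bar> \<le> (9/10) ^ n" for K
  proof -
    define A where "A n = (\<Union>k<K * 2 ^ n. {\<omega>\<in>space M. \<bar>incr n k \<omega>\<bar> > (9/10) ^ n})" for n
    have [measurable]: "A n \<in> sets M" for n unfolding A_def by measurable
    have bound: "prob (A n) \<le> 3 * real K * (5000/6561) ^ n" for n
    proof -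
      have "prob (A n) \<le> (\<Sum>k<K * 2 ^ n. prob {\<omega>\<in>space M. \<bar>incr n k \<omega>\<bar> > (9/10) ^ n})"
        unfolding A_def by (intro finite_measure_subadditive_finite) auto
      also have "\<dots> \<le> (\<Sum>k<K * 2 ^ n. 3 * (2500/6561) ^ n)"
        by (intro sum_mono prob_incr_gt)
      also have "\<dots> = 3 * real K * (2 ^ n * (2500/6561) ^ n)" by simp
      also have "\<dots> = 3 * real K * (5000/6561) ^ n" by (simp add: power_mult_distrib[symmetric])
      finally show ?thesis .
    qed
    have "summable (\<lambda>n. prob (A n))"
      by (rule summable_comparison_test'[where N=0 and g="\<lambda>n. 3 * real K * (5000/6561) ^ n"])
         (use bound in \<open>auto intro!: summable_mult summable_geometric\<close>)
    from borel_cantelli_AE1[OF _ _ this]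
    have "AE \<omega> in M. \<forall>\<^sub>F n in sequentially. \<omega> \<in> space M - A n" by (simp add: less_top[symmetric])
    then show ?thesis
      by eventually_elim (auto simp: A_def eventually_sequentially not_less; metis)
  qed
  then show ?thesis unfolding levy_regular_def AE_all_countable by blast
qed

text \<open>At level \<open>m\<close> the increments over the rounded times regroup into dyadic
  ones, whose joint characteristic function is known. Then \<open>m\<close> tends to infinity: the
  integrands have modulus 1, so dominated convergence applies, and the rounded times
  \<open>(1/2) ^ m * N m k\<close> tend to \<open>\<tau> k\<close>.\<close>

lemma char_levy_increments:
  assumes \<tau>: "0 \<le> \<tau> 0" "\<And>i. i < n \<Longrightarrow> \<tau> i \<le> \<tau> (Suc i)"
  shows "(\<integral>\<omega>. iexp (\<Sum>k<n. u k * (levy_path (\<lambda>n k. \<xi> n k \<omega>) (\<tau> (Suc k)) - levy_path (\<lambda>n k. \<xi> n k \<omega>) (\<tau> k))) \<partial>M)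
    = of_real (exp (- (\<Sum>k<n. (u k)\<^sup>2 * (\<tau> (Suc k) - \<tau> k)) / 2))"
proof -
  have pos: "0 \<le> \<tau> k" if "k \<le> n" for k
    using that by (induction k) (use \<tau> in \<open>auto intro: order_trans\<close>)
  let ?x = "\<lambda>\<omega> n k. \<xi> n k \<omega>"
  define f where "f m \<omega> = iexp (\<Sum>k<n. u k * (levy_step (?x \<omega>) m (\<tau> (Suc k)) - levy_step (?x \<omega>) m (\<tau> k)))" for m \<omega>
  have [measurable]: "(\<lambda>\<omega>. levy_step (?x \<omega>) m t) \<in> borel_measurable M" for m t
    unfolding levy_step_def by measurable
  have lim: "(\<lambda>m. \<integral>\<omega>. f m \<omega> \<partial>M) \<longlonglongrightarrow> (\<integral>\<omega>. iexp (\<Sum>k<n. u k * (levy_path (?x \<omega>) (\<tau> (Suc k)) - levy_path (?x \<omega>) (\<tau> k))) \<partial>M)"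
  proof (rule integral_dominated_convergence[where w="\<lambda>_. 1"])
    show "AE \<omega> in M. (\<lambda>m. f m \<omega>) \<longlonglongrightarrow> iexp (\<Sum>k<n. u k * (levy_path (?x \<omega>) (\<tau> (Suc k)) - levy_path (?x \<omega>) (\<tau> k)))"
      using AE_levy_regular
    proof eventually_elim
      case (elim \<omega>)
      show ?case unfolding f_def
        by (intro tendsto_intros levy_path_LIMSEQ elim) (use pos in auto)
    qed
  qed (auto simp: f_def)
  define N where "N m k = nat \<lfloor>2 ^ m * \<tau> k\<rfloor>" for m k
  have f: "(\<integral>\<omega>. f m \<omega> \<partial>M) = of_real (exp (- (\<Sum>k<n. (u k)\<^sup>2 * ((1/2) ^ m * real (N m (Suc k)) - (1/2) ^ m * real
      (N m k))) / 2))" for m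
  proof -
    have mono: "N m k \<le> N m (Suc k)" if "k < n" for k
      unfolding N_def using \<tau>(2)[OF that] by (intro nat_mono floor_mono) auto
    obtain v where v: "\<And>d :: nat \<Rightarrow> real. (\<Sum>k<n. u k * ((\<Sum>j<N m (Suc k). d j) - (\<Sum>j<N m k. d j)))
        = (\<Sum>j<N m n. v j * d j)"
      "(\<Sum>j<N m n. (v j)\<^sup>2) = (\<Sum>k<n. (u k)\<^sup>2 * (real (N m (Suc k)) - real (N m k)))"
      by (rule sum_increments_regroup[of n "N m" u, OF mono]) (assumption, blast)
    have "(\<integral>\<omega>. f m \<omega> \<partial>M) = of_real (exp (- ((1/2) ^ m * (\<Sum>j<N m n. (v j)\<^sup>2)) / 2))"
      unfolding f_def levy_step_def N_def[symmetric] v(1) by (rule char_incr_sum)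
    also have "(1/2) ^ m * (\<Sum>j<N m n. (v j)\<^sup>2) = (\<Sum>k<n. (u k)\<^sup>2 * ((1/2) ^ m * real (N m (Suc k)) - (1/2) ^ m *
        real (N m k)))"
      unfolding v(2) sum_distrib_left by (intro sum.cong) (auto simp: algebra_simps)
    finally show ?thesis .
  qed
  have N: "(\<lambda>m. (1/2) ^ m * real (N m k)) \<longlonglongrightarrow> \<tau> k" if "k \<le> n" for k
  proof (rule tendsto_sandwich)
    have *: "real (N m k) \<le> 2 ^ m * \<tau> k \<and> 2 ^ m * \<tau> k - 1 \<le> real (N m k)" for m
    proof -
      have "0 \<le> 2 ^ m * \<tau> k" using pos[OF that] by simp
      then show ?thesis unfolding N_def by linarith
    qed
    show "\<forall>\<^sub>F m in sequentially. (1/2) ^ m * real (N m k) \<le> \<tau> k"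
      using * by (intro always_eventually) (simp add: field_simps)
    show "\<forall>\<^sub>F m in sequentially. \<tau> k - (1/2) ^ m \<le> (1/2) ^ m * real (N m k)"
    proof (intro always_eventually allI)
      fix m
      have "(1/2) ^ m * (2 ^ m * \<tau> k - 1) \<le> (1/2) ^ m * real (N m k)" using * by (intro mult_left_mono) auto
      moreover have "(1/2) ^ m * 2 ^ m = (1::real)" by (simp add: power_mult_distrib[symmetric])
      ultimately show "\<tau> k - (1/2) ^ m \<le> (1/2) ^ m * real (N m k)"
        by (simp add: right_diff_distrib mult.assoc[symmetric])
    qed
    have "(\<lambda>m. \<tau> k - (1/2) ^ m) \<longlonglongrightarrow> \<tau> k - 0" by (intro tendsto_intros LIMSEQ_power_zero) auto
    then show "(\<lambda>m. \<tau> k - (1/2) ^ m) \<longlonglongrightarrow> \<tau> k" by simp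
  qed auto
  have "(\<lambda>m. \<integral>\<omega>. f m \<omega> \<partial>M) \<longlonglongrightarrow> of_real (exp (- (\<Sum>k<n. (u k)\<^sup>2 * (\<tau> (Suc k) - \<tau> k)) / 2))"
    unfolding f by (intro tendsto_intros N) auto
  from LIMSEQ_unique[OF lim this] show ?thesis .
qed

theorem brownian_motion_levy: "brownian_motion M (\<lambda>t \<omega>. levy_path (\<lambda>n k. \<xi> n k \<omega>) t)"
proof -
  define B where "B = (\<lambda>t \<omega>. levy_path (\<lambda>n k. \<xi> n k \<omega>) t)"
  have [measurable]: "B t \<in> borel_measurable M" for t unfolding B_def by measurable
  have char: "char (distr M borel (\<lambda>\<omega>. B t \<omega> - B s \<omega>)) u = of_real (exp (- (u\<^sup>2 * (t - s)) / 2))"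
    if "0 \<le> s" "s \<le> t" for s t u
    using char_levy_increments[of "\<lambda>i. if i = 0 then s else t" 1 "\<lambda>_. u"] that
    unfolding char_def by (subst integral_distr) (auto simp: B_def)
  have "distributed M lborel (\<lambda>\<omega>. B t \<omega> - B s \<omega>) (\<lambda>x. ennreal (normal_density 0 (sqrt (t - s)) x))"
    if "0 \<le> s" "s < t" for s t
    using that char[of s t] by (subst distributed_normal_iff_char) (auto simp: mult.commute)
  moreover have "indep_vars (\<lambda>_. borel) (\<lambda>i \<omega>. B (\<tau> (Suc i)) \<omega> - B (\<tau> i) \<omega>) {..<n}"
    if \<tau>: "0 \<le> \<tau> 0" "\<forall>i<n. \<tau> i < \<tau> (Suc i)" for \<tau> n
  proof (rule indep_vars_char)
    have pos: "0 \<le> \<tau> k" if "k \<le> n" for k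
      using that
    proof (induction k)
      case (Suc k)
      then show ?case using \<tau>(2)[rule_format, of k] by simp
    qed (use \<tau> in simp)
    fix u
    have "(\<integral>\<omega>. iexp (\<Sum>k<n. u k * (B (\<tau> (Suc k)) \<omega> - B (\<tau> k) \<omega>)) \<partial>M)
      = of_real (exp (\<Sum>k<n. - ((u k)\<^sup>2 * (\<tau> (Suc k) - \<tau> k)) / 2))"
      unfolding B_def using \<tau> by (subst char_levy_increments) (auto simp: sum_negf sum_divide_distrib less_imp_le)
    also have "\<dots> = (\<Prod>k<n. char (distr M borel (\<lambda>\<omega>. B (\<tau> (Suc k)) \<omega> - B (\<tau> k) \<omega>)) (u k))"
      unfolding exp_sum[OF finite_lessThan] of_real_prod using \<tau> pos
          by (intro prod.cong refl) (auto simp: char less_imp_le)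
    finally show "(\<integral>\<omega>. iexp (\<Sum>k<n. u k * (B (\<tau> (Suc k)) \<omega> - B (\<tau> k) \<omega>)) \<partial>M) = \<dots>" .
  qed measurable
  ultimately show ?thesis
    unfolding brownian_motion_def B_def[symmetric]
    by (auto simp: prob_space_axioms B_def levy_path_0 continuous_levy_path)
qed

end

section \<open>Growth and oscillation of Brownian paths\<close>

locale brownian = prob_space M for M :: "'a measure" +
  fixes B :: "real \<Rightarrow> 'a \<Rightarrow> real"
  assumes bm: "brownian_motion M B"
begin

lemma measurable_B [measurable]: "0 \<le> t \<Longrightarrow> B t \<in> borel_measurable M"
  using bm by (simp add: brownian_motion_def)

lemma B_0: "\<omega> \<in> space M \<Longrightarrow> B 0 \<omega> = 0"
  and continuous_B: "\<omega> \<in> space M \<Longrightarrow> continuous_on {0..} (\<lambda>t. B t \<omega>)"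
  using bm by (simp_all add: brownian_motion_def)

lemma distributed_increment:
  "0 \<le> s \<Longrightarrow> s < t \<Longrightarrow> distributed M lborel (\<lambda>\<omega>. B t \<omega> - B s \<omega>) (\<lambda>x. ennreal (normal_density 0 (sqrt (t - s)) x))"
  using bm by (simp add: brownian_motion_def)

lemma indep_increments:
  "0 \<le> \<tau> 0 \<Longrightarrow> (\<And>i. i < n \<Longrightarrow> \<tau> i < \<tau> (Suc i)) \<Longrightarrow>
    indep_vars (\<lambda>_. borel) (\<lambda>i \<omega>. B (\<tau> (Suc i)) \<omega> - B (\<tau> i) \<omega>) {..<n}"
  using bm by (simp add: brownian_motion_def)

lemma char_increment:
  assumes "0 \<le> s" "s < t"
  shows "(\<integral>\<omega>. iexp (\<theta> * (B t \<omega> - B s \<omega>)) \<partial>M) = of_real (exp (- (\<theta>\<^sup>2 * (t - s) / 2)))"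
proof -
  have [measurable]: "B s \<in> borel_measurable M" "B t \<in> borel_measurable M" using assms by auto
  have "char (distr M borel (\<lambda>\<omega>. B t \<omega> - B s \<omega>)) \<theta> = of_real (exp (- ((sqrt (t - s))\<^sup>2 * \<theta>\<^sup>2 / 2)))"
    using distributed_normal_iff_char[of "\<lambda>\<omega>. B t \<omega> - B s \<omega>" "sqrt (t - s)"] distributed_increment[OF assms] assms
    by simp
  then show ?thesis
    unfolding char_def using assms by (subst (asm) integral_distr) (auto simp: mult.commute)
qed

text \<open>Completing the square: tilting a centred normal density by
  \<open>exp (\<theta> * x)\<close> shifts its mean to \<open>\<theta> * \<sigma>\<^sup>2\<close>
  and leaves the factor on the right.\<close>

lemma mgf_increment:
  assumes "0 \<le> s" "s < t"
  shows "(\<integral>\<^sup>+\<omega>. ennreal (exp (\<theta> * (B t \<omega> - B s \<omega>))) \<partial>M) = ennreal (exp (\<theta>\<^sup>2 * (t - s) / 2))"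
proof -
  define \<sigma> where "\<sigma> = sqrt (t - s)"
  have \<sigma>: "\<sigma> > 0" "t - s = \<sigma>\<^sup>2" using assms by (auto simp: \<sigma>_def)
  have *: "normal_density 0 \<sigma> x * exp (\<theta> * x) = exp (\<theta>\<^sup>2 * \<sigma>\<^sup>2 / 2) * normal_density (\<theta> * \<sigma>\<^sup>2) \<sigma> x" for x
  proof -
    have "- (x\<^sup>2 / (2 * \<sigma>\<^sup>2)) + \<theta> * x = \<theta>\<^sup>2 * \<sigma>\<^sup>2 / 2 + - ((x - \<theta> * \<sigma>\<^sup>2)\<^sup>2 / (2 * \<sigma>\<^sup>2))"
      using \<sigma>(1) by (simp add: field_simps power2_eq_square)
    then have "exp (- (x\<^sup>2 / (2 * \<sigma>\<^sup>2))) * exp (\<theta> * x) = exp (\<theta>\<^sup>2 * \<sigma>\<^sup>2 / 2) * exp (- ((x - \<theta> * \<sigma>\<^sup>2)\<^sup>2 / (2 * \<sigma>\<^sup>2)))"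
      by (metis exp_add)
    then show ?thesis by (simp add: normal_density_def)
  qed
  have "(\<integral>\<^sup>+\<omega>. ennreal (exp (\<theta> * (B t \<omega> - B s \<omega>))) \<partial>M) = (\<integral>\<^sup>+x. ennreal (normal_density 0 \<sigma> x) * ennreal (exp
      (\<theta> * x)) \<partial>lborel)"
    using distributed_nn_integral[OF distributed_increment[OF assms], of "\<lambda>x. ennreal (exp (\<theta> * x))"]
        by (simp add: \<sigma>_def)
  also have "\<dots> = (\<integral>\<^sup>+x. ennreal (exp (\<theta>\<^sup>2 * \<sigma>\<^sup>2 / 2)) * ennreal (normal_density (\<theta> * \<sigma>\<^sup>2) \<sigma> x) \<partial>lborel)"
    by (simp add: ennreal_mult'[symmetric] *)
  also have "\<dots> = ennreal (exp (\<theta>\<^sup>2 * \<sigma>\<^sup>2 / 2)) * (\<integral>\<^sup>+x. ennreal (normal_density (\<theta> * \<sigma>\<^sup>2) \<sigma> x) \<partial>lborel)"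
    by (rule nn_integral_cmult) simp
  also have "(\<integral>\<^sup>+x. ennreal (normal_density (\<theta> * \<sigma>\<^sup>2) \<sigma> x) \<partial>lborel) = 1"
    using \<sigma>(1) by (subst nn_integral_eq_integral) auto
  finally show ?thesis by (simp add: \<sigma>(2))
qed

lemma second_moment_increment:
  assumes "0 \<le> s" "s < t"
  shows "integrable M (\<lambda>\<omega>. (B t \<omega> - B s \<omega>)\<^sup>2)" "(\<integral>\<omega>. (B t \<omega> - B s \<omega>)\<^sup>2 \<partial>M) = t - s"
proof -
  have p: "sqrt (t - s) > 0" using assms by simp
  show "integrable M (\<lambda>\<omega>. (B t \<omega> - B s \<omega>)\<^sup>2)"
    using distributed_integrable[OF distributed_increment[OF assms], of "\<lambda>x. x\<^sup>2"]
      integrable_normal_moment[OF p, of 0 2] by simp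
  show "(\<integral>\<omega>. (B t \<omega> - B s \<omega>)\<^sup>2 \<partial>M) = t - s"
    using distributed_integral[OF distributed_increment[OF assms], of "\<lambda>x. x\<^sup>2"]
      integral_normal_moment_even[OF p, of 0 1] assms by simp
qed

end

text \<open>By the zero-one law the alternative is that almost surely only finitely many events
  occur. Then the indicators tend to 0 and, by dominated convergence, so do their means, which are
  constantly \<open>c > 0\<close>.\<close>

lemma (in prob_space) AE_infinitely_often_const:
  assumes ind: "indep_events (\<lambda>m. {x\<in>space M. P m x}) UNIV"
    and c: "\<And>m. prob {x\<in>space M. P m x} = c" "c > 0"
  shows "AE x in M. infinite {m::nat. P m x}"
proof -
  have [measurable]: "\<And>m. {x\<in>space M. P m x} \<in> sets M"
    using ind by (auto simp: indep_events_def)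
  have False if fin: "AE x in M. finite {m. P m x}"
  proof -
    have "(\<lambda>m. \<integral>x. indicator {x\<in>space M. P m x} x \<partial>M) \<longlonglongrightarrow> (\<integral>x. (0::real) \<partial>M)"
    proof (rule integral_dominated_convergence[where w="\<lambda>_. 1"])
      show "AE x in M. (\<lambda>m. indicator {x\<in>space M. P m x} x) \<longlonglongrightarrow> (0::real)"
        using fin
      proof eventually_elim
        case (elim x)
        then have "\<forall>\<^sub>F m in sequentially. \<not> P m x"
          by (simp add: eventually_cofinite cofinite_eq_sequentially[symmetric])
        then show ?case by (intro tendsto_eventually) (auto elim!: eventually_mono simp: indicator_def)
      qed
    qed auto
    moreover have "(\<integral>x. indicator {x\<in>space M. P m x} x \<partial>M) = c" for m
    proof -
      have "{x\<in>space M. P m x} \<inter> space M = {x\<in>space M. P m x}" by auto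
      then show ?thesis using c(1)[of m] by (simp only: Bochner_Integration.integral_indicator)
    qed
    ultimately have "(\<lambda>m::nat. c) \<longlonglongrightarrow> 0" by simp
    then have "c = 0" by (simp add: LIMSEQ_const_iff)
    then show False using c by simp
  qed
  then show ?thesis using borel_0_1_law_AE[OF ind] by blast
qed

lemma std_normal_gt_1_pos:
  "measure (density lborel (\<lambda>x. ennreal (std_normal_density x))) {1<..} > 0"
proof -
  interpret N: prob_space std_normal_distribution by (rule prob_space_normal_density) simp
  have "ennreal (std_normal_density 2) = (\<integral>\<^sup>+x. ennreal (std_normal_density 2) * indicator {1<..2::real} x \<partial>lborel)"
    by (simp add: nn_integral_cmult_indicator)
  also have "\<dots> \<le> (\<integral>\<^sup>+x. ennreal (std_normal_density x) * indicator {1<..} x \<partial>lborel)"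
  proof (intro nn_integral_mono)
    fix x :: real
    have "std_normal_density 2 \<le> std_normal_density x" if "1 < x" "x \<le> 2"
    proof -
      have "x\<^sup>2 \<le> 2\<^sup>2" using that by (intro power_mono) auto
      then show ?thesis by (simp add: std_normal_density_def divide_right_mono)
    qed
    then show "ennreal (std_normal_density 2) * indicator {1<..2} x \<le> ennreal (std_normal_density x) *
        indicator {1<..} x"
      by (auto simp: indicator_def intro!: ennreal_leI)
  qed
  also have "\<dots> = emeasure std_normal_distribution {1<..}"
    by (simp add: emeasure_density)
  finally have "ennreal (std_normal_density 2) \<le> ennreal (measure std_normal_distribution {1<..})"
    by (simp add: N.emeasure_eq_measure)
  then show ?thesis using normal_density_pos[of 1 0 2]
    by (metis ennreal_le_iff less_le_trans measure_nonneg zero_less_one)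
qed

text \<open>Only integer times are inspected, so that this is visibly a measurable condition.\<close>

definition unbounded_path :: "(real \<Rightarrow> real) \<Rightarrow> bool" where
  "unbounded_path b \<longleftrightarrow> (\<forall>c::nat. (\<exists>k::nat. b (real k) > real c) \<and> (\<exists>k::nat. b (real k) < - real c))"

context brownian
begin

text \<open>Along the times \<open>2 ^ k\<^sup>2\<close> each increment dominates the whole past of the path.\<close>

lemma AE_one_sided_unbounded:
  assumes s: "s = 1 \<or> s = (- 1 :: real)"
  shows "AE \<omega> in M. \<forall>c::nat. \<exists>k::nat. s * B (real k) \<omega> > real c"
proof -
  \<comment> \<open>The quadratic exponent makes the ratio of consecutive times,
    \<open>2 * 4 ^ k\<close>, grow: the standard deviation \<open>\<sigma> k\<close> of the next
    increment is at least \<open>2 ^ k\<close> times that of the whole past.\<close>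
  define t where "t k = (2::real) ^ (k\<^sup>2)" for k :: nat
  define \<sigma> where "\<sigma> k = sqrt (t (Suc k) - t k)" for k
  have t1: "t k \<ge> 1" for k by (simp add: t_def)
  have tS: "t (Suc k) = t k * (2 * 4 ^ k)" for k
  proof -
    have "(Suc k)\<^sup>2 = k\<^sup>2 + (1 + 2 * k)" by (simp add: power2_eq_square)
    then show ?thesis by (simp add: t_def power_add power_mult)
  qed
  have diff: "t (Suc k) - t k \<ge> 4 ^ k * t k" for k
  proof -
    have "t k * 1 \<le> t k * 4 ^ k" using t1[of k] by (intro mult_left_mono) auto
    then show ?thesis by (simp add: tS algebra_simps)
  qed
  have pos: "4 ^ k * t k > 0" for k using t1[of k] by simp
  have lt: "t k < t (Suc k)" for k using diff[of k] pos[of k] by linarith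
  have \<sigma>: "\<sigma> k > 0" for k using lt by (simp add: \<sigma>_def)
  have \<sigma>ge: "\<sigma> k \<ge> 2 ^ k" for k
  proof -
    have "(2 ^ k)\<^sup>2 = (4::real) ^ k" by (simp add: power2_eq_square power_mult_distrib[symmetric])
    also have "\<dots> \<le> 4 ^ k * t k" using t1[of k] by simp
    also have "\<dots> \<le> t (Suc k) - t k" by (rule diff)
    finally show ?thesis unfolding \<sigma>_def by (rule real_le_rsqrt)
  qed
  have [measurable]: "B (t k) \<in> borel_measurable M" for k using t1[of k] by (intro measurable_B) simp
  let ?P = "\<lambda>k \<omega>. s * (B (t (Suc k)) \<omega> - B (t k) \<omega>) / \<sigma> k \<in> {1<..}"
  have prob: "prob {\<omega>\<in>space M. ?P k \<omega>} = measure std_normal_distribution {1<..}" for k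
  proof -
    have "distributed M lborel (\<lambda>\<omega>. 0 + (s / \<sigma> k) * (B (t (Suc k)) \<omega> - B (t k) \<omega>)) (normal_density (0 +
        (s / \<sigma> k) * 0) (\<bar>s / \<sigma> k\<bar> * \<sigma> k))"
      unfolding \<sigma>_def[of k, symmetric]
      by (rule normal_density_affine) (use distributed_increment[OF _ lt[of k]] t1[of k] \<sigma>[of k] s in \<open>auto
          simp: \<sigma>_def\<close>)
    moreover have "\<bar>s / \<sigma> k\<bar> * \<sigma> k = 1" using s \<sigma>[of k] by auto
    ultimately have d: "distributed M lborel (\<lambda>\<omega>. s * (B (t (Suc k)) \<omega> - B (t k) \<omega>) / \<sigma> k) std_normal_density"
      by (simp only: mult_zero_right add_0 times_divide_eq_left)
    have "prob {\<omega>\<in>space M. ?P k \<omega>} = measure (distr M lborel (\<lambda>\<omega>. s * (B (t (Suc k)) \<omega> - B (t k) \<omega>) / \<sigma> k)) {1<..}"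
      by (subst measure_distr) (auto simp: vimage_def Int_def conj_commute)
    then show ?thesis using d by (simp add: distributed_def)
  qed
  have "indep_events (\<lambda>k. {\<omega>\<in>space M. ?P k \<omega>}) UNIV"
  proof (rule indep_eventsI)
    fix J :: "nat set" assume J: "finite J" "J \<noteq> {}"
    then obtain n where n: "J \<subseteq> {..<n}" by (meson finite_nat_iff_bounded)
    have "indep_vars (\<lambda>_. borel) (\<lambda>i \<omega>. B (t (Suc i)) \<omega> - B (t i) \<omega>) {..<n}"
      using t1[of 0] lt by (intro indep_increments) auto
    then have "indep_vars (\<lambda>_. borel) (\<lambda>i \<omega>. s * (B (t (Suc i)) \<omega> - B (t i) \<omega>) / \<sigma> i) {..<n}"
      by (rule indep_vars_compose2) auto
    from indep_varsD[OF this J(2,1) n, of "\<lambda>_. {1<..}"]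
    show "prob (\<Inter>i\<in>J. {\<omega>\<in>space M. ?P i \<omega>}) = (\<Prod>i\<in>J. prob {\<omega>\<in>space M. ?P i \<omega>})"
      by (simp add: vimage_def Int_def conj_commute)
  qed measurable
  from AE_infinitely_often_const[OF this prob std_normal_gt_1_pos]
  have io: "AE \<omega> in M. infinite {k. ?P k \<omega>}" .
  \<comment> \<open>The past is too large to be dominated. Chebyshev bounds this by
    \<open>4 * t k\<close> over the square of \<open>\<sigma> k\<close>, hence by
    \<open>4 * (1/4) ^ k\<close>, which is summable.\<close>
  define A where "A k = {\<omega>\<in>space M. \<bar>B (t k) \<omega>\<bar> \<ge> \<sigma> k / 2}" for k
  have [measurable]: "A k \<in> sets M" for k unfolding A_def by measurable
  have PA: "prob (A k) \<le> 4 * (1/4) ^ k" for k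
  proof -
    have "t k > 0" using t1[of k] by simp
    note m = second_moment_increment[of 0 "t k", OF _ this, simplified]
    have "A k \<subseteq> {\<omega>\<in>space M. (B (t k) \<omega> - B 0 \<omega>)\<^sup>2 \<ge> (\<sigma> k / 2)\<^sup>2}"
      unfolding A_def using B_0 \<sigma>[of k] by (auto simp: abs_le_square_iff[symmetric])
    then have "prob (A k) \<le> prob {\<omega>\<in>space M. (B (t k) \<omega> - B 0 \<omega>)\<^sup>2 \<ge> (\<sigma> k / 2)\<^sup>2}"
      by (intro finite_measure_mono) auto
    also have "\<dots> \<le> (\<integral>\<omega>. (B (t k) \<omega> - B 0 \<omega>)\<^sup>2 \<partial>M) / (\<sigma> k / 2)\<^sup>2"
      using \<sigma>[of k] by (intro integral_Markov_inequality_measure[where A="{}"] m) auto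
    also have "\<dots> = 4 * t k / (t (Suc k) - t k)"
      unfolding m(2) using lt[of k] by (simp add: \<sigma>_def power_divide)
    also have "\<dots> \<le> 4 * t k / (4 ^ k * t k)"
      using diff[of k] pos[of k] t1[of k] lt[of k] by (intro divide_left_mono) (auto intro!: mult_pos_pos)
    also have "\<dots> = 4 * (1/4) ^ k" using t1[of k] by (simp add: power_divide)
    finally show ?thesis .
  qed
  have "summable (\<lambda>k. prob (A k))"
    by (rule summable_comparison_test'[where N=0 and g="\<lambda>n. 4 * (1/4) ^ n"])
       (use PA in \<open>auto intro!: summable_mult summable_geometric\<close>)
  from borel_cantelli_AE1[OF _ _ this]
  have "AE \<omega> in M. \<forall>\<^sub>F k in sequentially. \<omega> \<in> space M - A k" by (simp add: less_top[symmetric])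
  with io show ?thesis
  proof eventually_elim
    case (elim \<omega>)
    show ?case
    proof
      fix c :: nat
      obtain k0 where k0: "\<And>k. k \<ge> k0 \<Longrightarrow> \<omega> \<in> space M - A k"
        using elim(2) by (auto simp: eventually_sequentially)
      obtain k where k: "k \<ge> max k0 (2 * c + 1)" "?P k \<omega>"
        using elim(1)[unfolded infinite_nat_iff_unbounded_le, rule_format, of "max k0 (2 * c + 1)"] by auto
      \<comment> \<open>An increment above \<open>\<sigma> k\<close> against a past below
        \<open>\<sigma> k / 2\<close> leaves more than \<open>\<sigma> k / 2\<close>, and
        \<open>\<sigma> k \<ge> 2 ^ k > k \<ge> 2 * c + 1\<close>.\<close>
      have 1: "s * (B (t (Suc k)) \<omega> - B (t k) \<omega>) > \<sigma> k" using k(2) \<sigma>[of k] by (simp add: field_simps)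
      have 2: "\<bar>B (t k) \<omega>\<bar> < \<sigma> k / 2" using k0[of k] k(1) by (auto simp: A_def)
      have 3: "\<bar>s * B (t k) \<omega>\<bar> < \<sigma> k / 2" using 2 s by (auto simp: abs_mult)
      have "s * B (t (Suc k)) \<omega> > \<sigma> k / 2" using 1 3 by (simp add: algebra_simps)
      moreover have "2 * real c + 1 \<le> real k" using k(1) by linarith
      moreover have "real k < 2 ^ k" by (rule of_nat_less_two_power)
      ultimately have "s * B (t (Suc k)) \<omega> > real c" using \<sigma>ge[of k] by linarith
      moreover have "t (Suc k) = real (2 ^ ((Suc k)\<^sup>2))" by (simp add: t_def)
      ultimately show "\<exists>k::nat. s * B (real k) \<omega> > real c" by metis
    qed
  qed
qed

lemma AE_unbounded_path: "AE \<omega> in M. unbounded_path (\<lambda>t. B t \<omega>)"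
  using AE_one_sided_unbounded[of 1, simplified] AE_one_sided_unbounded[of "- 1", simplified]
proof eventually_elim
  case (elim \<omega>)
  then show ?case unfolding unbounded_path_def by (simp add: less_minus_iff[of "real _"])
qed

end

text \<open>Independence means that the joint law is the product of the marginals. Neither side
  changes under almost sure equality; countability of \<open>I\<close> makes the exceptional set
  common to all indices.\<close>

lemma (in prob_space) indep_vars_cong_AE:
  assumes X: "indep_vars N X I" and eq: "\<And>i. i \<in> I \<Longrightarrow> AE \<omega> in M. X i \<omega> = Y i \<omega>"
    and I: "countable I" and Y: "\<And>i. i \<in> I \<Longrightarrow> Y i \<in> measurable M (N i)"
  shows "indep_vars N Y I"
proof (cases "I = {}")
  case True
  then show ?thesis by (simp add: indep_vars_def2 indep_sets_def)
next
  case False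
  have rvX: "\<And>i. i \<in> I \<Longrightarrow> X i \<in> measurable M (N i)" using X by (simp add: indep_vars_def)
  have "distr M (\<Pi>\<^sub>M i\<in>I. N i) (\<lambda>x. \<lambda>i\<in>I. Y i x) = distr M (\<Pi>\<^sub>M i\<in>I. N i) (\<lambda>x. \<lambda>i\<in>I. X i x)"
  proof (rule distr_cong_AE)
    have "AE \<omega> in M. \<forall>i\<in>I. X i \<omega> = Y i \<omega>" using eq I by (simp add: AE_ball_countable)
    then show "AE \<omega> in M. (\<lambda>i\<in>I. Y i \<omega>) = (\<lambda>i\<in>I. X i \<omega>)" by eventually_elim (auto simp: restrict_def)
  qed (auto intro!: measurable_restrict rvX Y)
  also have "\<dots> = (\<Pi>\<^sub>M i\<in>I. distr M (N i) (X i))"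
    using X indep_vars_iff_distr_eq_PiM'[OF False rvX] by simp
  also have "\<dots> = (\<Pi>\<^sub>M i\<in>I. distr M (N i) (Y i))"
  proof (rule PiM_cong)
    fix i assume "i \<in> I"
    then show "distr M (N i) (X i) = distr M (N i) (Y i)"
      by (intro distr_cong_AE refl eq rvX Y)
  qed simp
  finally have *: "distr M (\<Pi>\<^sub>M i\<in>I. N i) (\<lambda>x. \<lambda>i\<in>I. Y i x) = (\<Pi>\<^sub>M i\<in>I. distr M (N i) (Y i))" .
  show ?thesis
    by (rule iffD2[OF indep_vars_iff_distr_eq_PiM' *, OF False Y])
qed

text \<open>The conditions on increments concern laws and survive an almost sure change of the
  paths; continuity and the starting value are demanded at every sample point and so have to be
  assumed for the new process.\<close>

lemma brownian_motion_modification: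
  assumes B: "brownian_motion M B" and meas: "\<And>t. 0 \<le> t \<Longrightarrow> B' t \<in> borel_measurable M"
    and path: "\<And>\<omega>. \<omega> \<in> space M \<Longrightarrow> B' 0 \<omega> = 0 \<and> continuous_on {0..} (\<lambda>t. B' t \<omega>)"
    and eq: "AE \<omega> in M. \<forall>t\<ge>0. B' t \<omega> = B t \<omega>"
  shows "brownian_motion M B'"
proof -
  interpret prob_space M using B by (simp add: brownian_motion_def)
  interpret brownian M B by unfold_locales (rule B)
  have incr: "AE \<omega> in M. B t \<omega> - B s \<omega> = B' t \<omega> - B' s \<omega>" if "0 \<le> s" "0 \<le> t" for s t
    using eq by eventually_elim (use that in auto)
  have "distributed M lborel (\<lambda>\<omega>. B' t \<omega> - B' s \<omega>) (\<lambda>x. ennreal (normal_density 0 (sqrt (t - s)) x))"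
    if "0 \<le> s" "s < t" for s t
  proof -
    have [measurable]: "B' t \<in> borel_measurable M" "B' s \<in> borel_measurable M" "B t \<in> borel_measurable M" "B s
        \<in> borel_measurable M"
      using that by (auto intro: meas)
    have "distr M lborel (\<lambda>\<omega>. B' t \<omega> - B' s \<omega>) = distr M lborel (\<lambda>\<omega>. B t \<omega> - B s \<omega>)"
      using incr[of s t] that by (intro distr_cong_AE) auto
    then show ?thesis using distributed_increment[OF that] by (simp add: distributed_def)
  qed
  moreover have "indep_vars (\<lambda>_. borel) (\<lambda>i \<omega>. B' (\<tau> (Suc i)) \<omega> - B' (\<tau> i) \<omega>) {..<n}"
    if \<tau>: "0 \<le> \<tau> 0" "\<forall>i<n. \<tau> i < \<tau> (Suc i)" for \<tau> n
  proof -
    have pos: "0 \<le> \<tau> k" if "k \<le> n" for k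
      using that
    proof (induction k)
      case (Suc k)
      then show ?case using \<tau>(2)[rule_format, of k] by simp
    qed (use \<tau> in simp)
    show ?thesis
      by (rule indep_vars_cong_AE[OF indep_increments[of \<tau> n]])
         (use \<tau> pos in \<open>auto intro!: incr borel_measurable_diff meas\<close>)
  qed
  ultimately show ?thesis
    unfolding brownian_motion_def using path meas by (auto simp: prob_space_axioms)
qed

text \<open>Exceptional paths are replaced by the fixed unbounded path \<open>t * cos (pi * t)\<close>, so that every
  path has all the almost sure properties that are needed.\<close>

definition fix_path :: "(real \<Rightarrow> real) \<Rightarrow> real \<Rightarrow> real" where
  "fix_path b t = (if unbounded_path b then b t else t * cos (pi * t))"

lemma unbounded_fix_path: "unbounded_path (fix_path b)"
proof (cases "unbounded_path b")
  case True
  then show ?thesis by (simp add: fix_path_def[abs_def])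
next
  case False
  \<comment> \<open>At an integer \<open>k\<close> the path has the value \<open>k\<close> or
    \<open>- k\<close> according to parity, so an even witness serves the upper bound and an odd one
    the lower.\<close>
  have "\<exists>k::nat. real k * cos (pi * real k) > real c" for c
    unfolding cos_npi2 by (rule exI[of _ "2 * (c + 1)"]) simp
  moreover have "\<exists>k::nat. real k * cos (pi * real k) < - real c" for c
    unfolding cos_npi2 by (rule exI[of _ "2 * c + 1"]) simp
  moreover have "fix_path b = (\<lambda>t. t * cos (pi * t))" using False by (simp add: fix_path_def fun_eq_iff)
  ultimately show ?thesis unfolding unbounded_path_def by simp
qed

lemma (in brownian) brownian_motion_fix_path:
  "brownian_motion M (\<lambda>t \<omega>. fix_path (\<lambda>t. B t \<omega>) t)"
proof (rule brownian_motion_modification[OF bm])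
  have [measurable]: "Measurable.pred M (\<lambda>\<omega>. unbounded_path (\<lambda>t. B t \<omega>))"
    unfolding unbounded_path_def by measurable
  show "(\<lambda>\<omega>. fix_path (\<lambda>t. B t \<omega>) t) \<in> borel_measurable M" if "0 \<le> t" for t
    unfolding fix_path_def using that by measurable
  show "fix_path (\<lambda>t. B t \<omega>) 0 = 0 \<and> continuous_on {0..} (fix_path (\<lambda>t. B t \<omega>))" if "\<omega> \<in> space M" for \<omega>
    using that B_0 continuous_B
    by (cases "unbounded_path (\<lambda>t. B t \<omega>)") (auto simp: fix_path_def[abs_def] intro!: continuous_intros)
  show "AE \<omega> in M. \<forall>t\<ge>0. fix_path (\<lambda>t. B t \<omega>) t = B t \<omega>"
    using AE_unbounded_path by eventually_elim (simp add: fix_path_def)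
qed

section \<open>Unit steps of the path and stopping times\<close>

definition next_hit :: "(real \<Rightarrow> real) \<Rightarrow> real \<Rightarrow> real" where
  "next_hit b s = Inf {t. s \<le> t \<and> 1 \<le> \<bar>b t - b s\<bar>}"

fun hit_time :: "(real \<Rightarrow> real) \<Rightarrow> nat \<Rightarrow> real" where
  "hit_time b 0 = 0"
| "hit_time b (Suc n) = next_hit b (hit_time b n)"

lemma dyadic_between:
  assumes "0 \<le> a" "a < (c::real)"
  obtains n i :: nat where "a < real i / 2 ^ n" "real i / 2 ^ n < c"
proof -
  obtain n where n: "(1/2) ^ n < c - a" using real_arch_pow_inv[of "c - a" "1/2"] assms by auto
  define i where "i = nat \<lfloor>2 ^ n * a\<rfloor> + 1"
  have "2 ^ n * a \<ge> 0" using assms by simp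
  then have "2 ^ n * a < real i" "real i \<le> 2 ^ n * a + 1" unfolding i_def by linarith+
  moreover have "2 ^ n * a + 1 < 2 ^ n * c" using n by (simp add: field_simps)
  ultimately have "a < real i / 2 ^ n" "real i / 2 ^ n < c" by (simp_all add: field_simps)
  then show ?thesis by (rule that)
qed

locale unbounded_continuous_path =
  fixes b :: "real \<Rightarrow> real"
  assumes cont: "continuous_on {0..} b" and unb: "unbounded_path b" and b_0: "b 0 = 0"
begin

lemma bounded_on_initial: "\<exists>c. \<forall>u\<in>{0..s}. \<bar>b u\<bar> \<le> c"
proof -
  have "compact (b ` {0..s})"
    by (intro compact_continuous_image continuous_on_subset[OF cont]) auto
  then have "bounded (b ` {0..s})" by (rule compact_imp_bounded)
  then show ?thesis by (auto simp: bounded_iff)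
qed

text \<open>The path is bounded on the compact interval up to \<open>s\<close>, so values beyond
  that bound, which exist by unboundedness, can only be taken later.\<close>

lemma large_after: "\<exists>t\<ge>s. b t > c" and small_after: "\<exists>t\<ge>s. b t < c"
proof -
  obtain m where m: "\<And>u. 0 \<le> u \<Longrightarrow> u \<le> s \<Longrightarrow> \<bar>b u\<bar> \<le> m" using bounded_on_initial[of s] by (meson atLeastAtMost_iff)
  obtain k :: nat where k: "real k > max m \<bar>c\<bar>" using reals_Archimedean2 by blast
  obtain i j :: nat where ij: "b (real i) > real k" "b (real j) < - real k" using unb
      unfolding unbounded_path_def by blast
  have "s < real i" using m[of "real i"] ij k by (cases "s < real i") auto
  then show "\<exists>t\<ge>s. b t > c" using ij k by (intro exI[of _ "real i"]) auto
  have "s < real j" using m[of "real j"] ij k by (cases "s < real j") auto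
  then show "\<exists>t\<ge>s. b t < c" using ij k by (intro exI[of _ "real j"]) auto
qed

text \<open>The set of hits is closed, hence contains its infimum, and the intermediate value
  theorem turns "at least 1" into "exactly 1" at that time.\<close>

lemma next_hit_props:
  assumes s: "0 \<le> s"
  shows "s < next_hit b s" "\<bar>b (next_hit b s) - b s\<bar> = 1"
    and "\<And>u. s \<le> u \<Longrightarrow> u < next_hit b s \<Longrightarrow> \<bar>b u - b s\<bar> < 1"
    and "next_hit b s \<le> t \<longleftrightarrow> (\<exists>u. s \<le> u \<and> u \<le> t \<and> 1 \<le> \<bar>b u - b s\<bar>)"
proof -
  define H where "H = {t. s \<le> t \<and> 1 \<le> \<bar>b t - b s\<bar>}"
  define \<tau> where "\<tau> = next_hit b s"
  have \<tau>: "\<tau> = Inf H" by (simp add: \<tau>_def next_hit_def H_def)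
  have conts: "continuous_on {s..} (\<lambda>t. \<bar>b t - b s\<bar>)"
    by (intro continuous_intros continuous_on_subset[OF cont]) (use s in auto)
  have "closed ({s..} \<inter> (\<lambda>t. \<bar>b t - b s\<bar>) -` {1..})"
    by (rule continuous_closed_preimage[OF conts]) auto
  moreover have "{s..} \<inter> (\<lambda>t. \<bar>b t - b s\<bar>) -` {1..} = H" by (auto simp: H_def)
  ultimately have "closed H" by simp
  moreover have "H \<noteq> {}" using large_after[where s=s and c="b s + 1"] by (force simp: H_def)
  moreover have bdd: "bdd_below H" by (auto simp: H_def bdd_below_def)
  ultimately have "\<tau> \<in> H" unfolding \<tau> by (intro closed_contains_Inf)
  then have \<tau>H: "s \<le> \<tau>" "1 \<le> \<bar>b \<tau> - b s\<bar>" by (auto simp: H_def)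
  have least: "\<bar>b u - b s\<bar> < 1" if "s \<le> u" "u < \<tau>" for u
  proof (rule ccontr)
    assume "\<not> \<bar>b u - b s\<bar> < 1"
    then have "u \<in> H" using that by (simp add: H_def)
    from cInf_lower[OF this bdd] show False using that \<tau> by simp
  qed
  then show "\<bar>b u - b s\<bar> < 1" if "s \<le> u" "u < next_hit b s" for u using that by (simp add: \<tau>_def)
  have "s \<noteq> \<tau>" using \<tau>H by auto
  then show "s < next_hit b s" using \<tau>H by (simp add: \<tau>_def)
  have "\<exists>u. s \<le> u \<and> u \<le> \<tau> \<and> \<bar>b u - b s\<bar> = 1"
    by (rule IVT') (use \<tau>H in \<open>auto intro!: continuous_on_subset[OF conts]\<close>)
  then obtain u where u: "s \<le> u" "u \<le> \<tau>" "\<bar>b u - b s\<bar> = 1" by auto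
  then have "u = \<tau>" using least[of u] by (cases "u < \<tau>") auto
  then show "\<bar>b (next_hit b s) - b s\<bar> = 1" using u by (simp add: \<tau>_def)
  show "next_hit b s \<le> t \<longleftrightarrow> (\<exists>u. s \<le> u \<and> u \<le> t \<and> 1 \<le> \<bar>b u - b s\<bar>)"
  proof
    assume "next_hit b s \<le> t"
    then show "\<exists>u. s \<le> u \<and> u \<le> t \<and> 1 \<le> \<bar>b u - b s\<bar>" using \<tau>H by (intro exI[of _ \<tau>]) (auto simp: \<tau>_def)
  next
    assume "\<exists>u. s \<le> u \<and> u \<le> t \<and> 1 \<le> \<bar>b u - b s\<bar>"
    then obtain u where "s \<le> u" "u \<le> t" "1 \<le> \<bar>b u - b s\<bar>" by auto
    then have "\<tau> \<le> u" using least[of u] by (cases "u < \<tau>") auto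
    then show "next_hit b s \<le> t" using \<open>u \<le> t\<close> by (simp add: \<tau>_def)
  qed
qed

text \<open>A countable form of the event, from which its measurability is read off. The hit itself
  may happen at a time that is not dyadic, hence the levels \<open>1 - 1 / real (Suc k)\<close>. For
  the converse the maximum of the displacement over the compact interval exceeds all these levels
  and so is at least 1.\<close>

lemma next_hit_le_iff_dyadic:
  assumes s: "0 \<le> s"
  shows "next_hit b s \<le> t \<longleftrightarrow>
    s \<le> t \<and> (\<forall>k. \<exists>n i. s \<le> real i / 2 ^ n \<and> real i / 2 ^ n \<le> t \<and> 1 - 1 / real (Suc k) < \<bar>b (real i / 2 ^ n) - b s\<bar>)"
  unfolding next_hit_props(4)[OF s]
proof safe
  fix u assume u: "s \<le> u" "u \<le> t" "1 \<le> \<bar>b u - b s\<bar>"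
  then show "s \<le> t" by simp
  fix k :: nat
  have su: "s < u" using u by (cases "s = u") auto
  have "0 < 1 / real (Suc k)" by simp
  then obtain d where d: "d > 0" "\<And>x. 0 \<le> x \<Longrightarrow> \<bar>x - u\<bar> < d \<Longrightarrow> \<bar>b x - b u\<bar> < 1 / real (Suc k)"
    using cont[unfolded continuous_on_iff, rule_format, of u "1 / real (Suc k)"] s u
    by (auto simp: dist_real_def)
  \<comment> \<open>The dyadic time is chosen to the left of \<open>u\<close>, which keeps it below
    \<open>t\<close> even if \<open>u = t\<close>; there is room because
    \<open>s < u\<close>.\<close>
  have "0 \<le> max s (u - d)" "max s (u - d) < u" using s su d(1) by auto
  then obtain n i :: nat where ni: "max s (u - d) < real i / 2 ^ n" "real i / 2 ^ n < u"
    by (rule dyadic_between)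
  have "\<bar>b (real i / 2 ^ n) - b u\<bar> < 1 / real (Suc k)" using ni s d(1) by (intro d(2)) auto
  then have "1 - 1 / real (Suc k) < \<bar>b (real i / 2 ^ n) - b s\<bar>" using u(3) by linarith
  then show "\<exists>n i. s \<le> real i / 2 ^ n \<and> real i / 2 ^ n \<le> t \<and> 1 - 1 / real (Suc k) < \<bar>b (real i / 2 ^ n) - b s\<bar>"
    using ni u by (intro exI[of _ n] exI[of _ i]) auto
next
  assume st: "s \<le> t"
    and *: "\<forall>k. \<exists>n i. s \<le> real i / 2 ^ n \<and> real i / 2 ^ n \<le> t \<and> 1 - 1 / real (Suc k) < \<bar>b (real i / 2 ^ n) - b s\<bar>"
  have "\<exists>u\<in>{s..t}. \<forall>x\<in>{s..t}. \<bar>b x - b s\<bar> \<le> \<bar>b u - b s\<bar>"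
    by (rule continuous_attains_sup) (use s st in \<open>auto intro!: continuous_intros continuous_on_subset[OF cont]\<close>)
  then obtain u where u: "s \<le> u" "u \<le> t" "\<And>x. s \<le> x \<Longrightarrow> x \<le> t \<Longrightarrow> \<bar>b x - b s\<bar> \<le> \<bar>b u - b s\<bar>" by auto
  have "1 \<le> \<bar>b u - b s\<bar>"
  proof (rule ccontr)
    assume "\<not> 1 \<le> \<bar>b u - b s\<bar>"
    then have "0 < 1 - \<bar>b u - b s\<bar>" by simp
    then obtain k :: nat where k: "1 / real (Suc k) < 1 - \<bar>b u - b s\<bar>"
      using reals_Archimedean[of "1 - \<bar>b u - b s\<bar>"] by (auto simp: inverse_eq_divide)
    obtain n i :: nat where "s \<le> real i / 2 ^ n" "real i / 2 ^ n \<le> t" "1 - 1 / real (Suc k) < \<bar>b (real i / 2 ^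
        n) - b s\<bar>"
      using * by blast
    with u(3)[of "real i / 2 ^ n"] k show False by linarith
  qed
  with u show "\<exists>u. s \<le> u \<and> u \<le> t \<and> 1 \<le> \<bar>b u - b s\<bar>" by blast
qed

lemma hit_time_nonneg: "0 \<le> hit_time b n"
  by (induction n) (auto intro: order_trans less_imp_le next_hit_props(1))

lemma hit_time_less: "hit_time b n < hit_time b (Suc n)"
  using next_hit_props(1)[OF hit_time_nonneg] by simp

lemma abs_hit_step: "\<bar>b (hit_time b (Suc n)) - b (hit_time b n)\<bar> = 1"
  using next_hit_props(2)[OF hit_time_nonneg] by simp

lemma hit_before: "hit_time b n \<le> u \<Longrightarrow> u < hit_time b (Suc n) \<Longrightarrow> \<bar>b u - b (hit_time b n)\<bar> < 1"
  using next_hit_props(3)[OF hit_time_nonneg] by simp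

lemma b_hit_time_Ints: "b (hit_time b n) \<in> \<int>"
proof (induction n)
  case (Suc n)
  have "b (hit_time b (Suc n)) = b (hit_time b n) + 1 \<or> b (hit_time b (Suc n)) = b (hit_time b n) - 1"
    using abs_hit_step[of n] by linarith
  then show ?case using Suc by (elim disjE) (simp_all only: Ints_add Ints_diff Ints_1)
qed (simp add: b_0)

end

section \<open>The dyadic filtration and its independence of later increments\<close>

locale brownian_unbounded = brownian +
  assumes unb: "\<And>\<omega>. \<omega> \<in> space M \<Longrightarrow> unbounded_path (\<lambda>t. B t \<omega>)"
begin

lemma path: "\<omega> \<in> space M \<Longrightarrow> unbounded_continuous_path (\<lambda>t. B t \<omega>)"
  by unfold_locales (auto intro: continuous_B unb B_0)

text \<open>Generated by the values at dyadic times only, which is enough by continuity of the paths.\<close>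

definition F :: "real \<Rightarrow> 'a measure" where
  "F t = sigma (space M) {B (real i / 2 ^ n) -` A \<inter> space M | n i A. real i / 2 ^ n \<le> t \<and> A \<in> sets borel}"

lemma space_F: "space (F t) = space M"
  unfolding F_def by (rule space_measure_of) auto

lemma sets_F: "sets (F t) = sigma_sets (space M) {B (real i / 2 ^ n) -` A \<inter> space M | n i A. real i / 2 ^ n
    \<le> t \<and> A \<in> sets borel}"
  unfolding F_def by (rule sets_measure_of) auto

lemma sets_F_subset: "sets (F t) \<subseteq> sets M"
  unfolding sets_F by (rule sets.sigma_sets_subset) auto

lemma sets_F_mono': "s \<le> t \<Longrightarrow> sets (F s) \<subseteq> sets (F t)"
  unfolding sets_F by (rule sigma_sets_mono') (auto intro: order_trans)

sublocale filtration "space M" F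
proof
  show "space (F t) = space M" for t by (rule space_F)
  show "sets (F s) \<subseteq> sets (F t)" if "s \<le> t" for s t using that by (rule sets_F_mono')
qed

lemma measurable_F_B: "real i / 2 ^ n \<le> t \<Longrightarrow> B (real i / 2 ^ n) \<in> borel_measurable (F t)"
  unfolding measurable_def space_F sets_F by (auto intro!: sigma_sets.Basic)

lemma measurable_F_imp: "f \<in> measurable (F t) N \<Longrightarrow> f \<in> measurable M N"
  using sets_F_subset[of t] space_F[of t] by (auto simp: measurable_def)

text \<open>The events decided by the path on the grid of mesh \<open>1 / 2 ^ k\<close> up to time
  \<open>L / 2 ^ k\<close>. For a fixed end point these families increase with \<open>k\<close>, so
  their union is stable under intersections.\<close>

definition incr_algebra :: "nat \<Rightarrow> nat \<Rightarrow> 'a set set" where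
  "incr_algebra k L = {(\<lambda>\<omega>. \<lambda>i\<in>{..<L}. B (real (Suc i) / 2 ^ k) \<omega> - B (real i / 2 ^ k) \<omega>) -` A \<inter> space M | A.
     A \<in> sets (Pi\<^sub>M {..<L} (\<lambda>_. borel))}"

lemma incr_algebra_Suc: "incr_algebra k L \<subseteq> incr_algebra (Suc k) (2 * L)"
proof
  fix E assume "E \<in> incr_algebra k L"
  then obtain A where A: "A \<in> sets (Pi\<^sub>M {..<L} (\<lambda>_. borel))"
    "E = (\<lambda>\<omega>. \<lambda>i\<in>{..<L}. B (real (Suc i) / 2 ^ k) \<omega> - B (real i / 2 ^ k) \<omega>) -` A \<inter> space M"
    by (auto simp: incr_algebra_def)
  define \<phi> where "\<phi> f = (\<lambda>i\<in>{..<L}. f (2 * i) + f (2 * i + 1))" for f :: "nat \<Rightarrow> real"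
  have \<phi>: "\<phi> \<in> measurable (Pi\<^sub>M {..<2 * L} (\<lambda>_. borel)) (Pi\<^sub>M {..<L} (\<lambda>_. borel))"
    unfolding \<phi>_def by (intro measurable_restrict borel_measurable_add measurable_component_singleton) auto
  have eq: "(\<lambda>i\<in>{..<L}. B (real (Suc i) / 2 ^ k) \<omega> - B (real i / 2 ^ k) \<omega>) =
      \<phi> (\<lambda>i\<in>{..<2 * L}. B (real (Suc i) / 2 ^ Suc k) \<omega> - B (real i / 2 ^ Suc k) \<omega>)" for \<omega>
  proof
    fix i
    have e: "real (2 * j) / 2 ^ Suc k = real j / 2 ^ k" for j by simp
    have "Suc (2 * i + 1) = 2 * Suc i" by simp
    then show "(\<lambda>i\<in>{..<L}. B (real (Suc i) / 2 ^ k) \<omega> - B (real i / 2 ^ k) \<omega>) i =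
      \<phi> (\<lambda>i\<in>{..<2 * L}. B (real (Suc i) / 2 ^ Suc k) \<omega> - B (real i / 2 ^ Suc k) \<omega>) i"
      unfolding \<phi>_def restrict_def e[symmetric] by auto
  qed
  have "E = (\<lambda>\<omega>. \<lambda>i\<in>{..<2 * L}. B (real (Suc i) / 2 ^ Suc k) \<omega> - B (real i / 2 ^ Suc k) \<omega>) -`
      (\<phi> -` A \<inter> space (Pi\<^sub>M {..<2 * L} (\<lambda>_. borel))) \<inter> space M"
    unfolding A(2) eq by (auto simp: space_PiM)
  then show "E \<in> incr_algebra (Suc k) (2 * L)"
    using measurable_sets[OF \<phi> A(1)] unfolding incr_algebra_def by blast
qed

lemma incr_algebra_mono: "incr_algebra k L \<subseteq> incr_algebra (k + d) (2 ^ d * L)"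
proof (induction d)
  case (Suc d)
  then show ?case using incr_algebra_Suc[of "k + d" "2 ^ d * L"] by (simp add: mult.assoc)
qed simp

lemma incr_algebra_generator:
  assumes le: "i \<le> L" and A: "A \<in> sets borel"
  shows "B (real i / 2 ^ k) -` A \<inter> space M \<in> incr_algebra k L"
proof -
  define \<psi> where "\<psi> f = (\<Sum>l<i. f l)" for f :: "nat \<Rightarrow> real"
  have \<psi>: "\<psi> \<in> borel_measurable (Pi\<^sub>M {..<L} (\<lambda>_. borel))"
    unfolding \<psi>_def using le by (intro borel_measurable_sum measurable_component_singleton) auto
  have tel: "(\<Sum>l<i. B (real (Suc l) / 2 ^ k) \<omega> - B (real l / 2 ^ k) \<omega>) = B (real i / 2 ^ k) \<omega>" if "\<omega> \<in> space M" for \<omega>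
    using sum_lessThan_telescope[of "\<lambda>l. B (real l / 2 ^ k) \<omega>" i] B_0[OF that] by simp
  have "\<psi> (\<lambda>l\<in>{..<L}. B (real (Suc l) / 2 ^ k) \<omega> - B (real l / 2 ^ k) \<omega>) = B (real i / 2 ^ k) \<omega>"
      if "\<omega> \<in> space M" for \<omega>
    unfolding tel[OF that, symmetric] \<psi>_def using le by (intro sum.cong) auto
  then have "B (real i / 2 ^ k) -` A \<inter> space M = (\<lambda>\<omega>. \<lambda>l\<in>{..<L}. B (real (Suc l) / 2 ^ k) \<omega> - B (real l / 2 ^ k) \<omega>) -`
      (\<psi> -` A \<inter> space (Pi\<^sub>M {..<L} (\<lambda>_. borel))) \<inter> space M"
    by (auto simp: space_PiM)
  then show ?thesis using measurable_sets[OF \<psi> A] unfolding incr_algebra_def by blast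
qed

text \<open>For a single grid this is independence of finitely many increments. The union
  \<open>G\<close> over all refinements of the grid is stable under intersections and generates the
  past, so independence extends to the generated sigma-algebras. The time
  \<open>real j / 2 ^ m\<close> is itself dyadic and therefore the end point of each of these
  grids.\<close>

lemma indep_set_F_increment:
  assumes t': "real j / 2 ^ m < t'"
  shows "indep_set (sets (F (real j / 2 ^ m)))
    {(\<lambda>\<omega>. B t' \<omega> - B (real j / 2 ^ m) \<omega>) -` C \<inter> space M | C. C \<in> sets borel}"
proof -
  define \<Delta> where "\<Delta> \<omega> = B t' \<omega> - B (real j / 2 ^ m) \<omega>" for \<omega>
  have t'0: "0 \<le> t'" using t' by (meson divide_nonneg_nonneg less_imp_le of_nat_0_le_iff order_trans
      zero_le_numeral zero_le_power)
  have [measurable]: "\<Delta> \<in> borel_measurable M" using t'0 unfolding \<Delta>_def by auto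
  define D where "D = {\<Delta> -` C \<inter> space M | C. C \<in> sets borel}"
  define G where "G = (\<Union>n. incr_algebra (m + n) (2 ^ n * j))"
  have ind: "prob (a \<inter> d) = prob a * prob d" if a: "a \<in> G" and d: "d \<in> D" for a d
  proof -
    obtain n where "a \<in> incr_algebra (m + n) (2 ^ n * j)" using a by (auto simp: G_def)
    define k where "k = m + n"
    define L where "L = 2 ^ n * j"
    have Lk: "real L / 2 ^ k = real j / 2 ^ m" by (simp add: L_def k_def power_add)
    obtain A where A: "A \<in> sets (Pi\<^sub>M {..<L} (\<lambda>_. borel))"
      "a = (\<lambda>\<omega>. \<lambda>i\<in>{..<L}. B (real (Suc i) / 2 ^ k) \<omega> - B (real i / 2 ^ k) \<omega>) -` A \<inter> space M"
      using \<open>a \<in> incr_algebra (m + n) (2 ^ n * j)\<close> by (auto simp: incr_algebra_def k_def L_def)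
    obtain C where C: "C \<in> sets borel" "d = \<Delta> -` C \<inter> space M" using d by (auto simp: D_def)
    \<comment> \<open>The grid up to the present time, followed by the single point
      \<open>t'\<close>: increment number \<open>L\<close> is the future one.\<close>
    define \<tau> where "\<tau> i = (if i \<le> L then real i / 2 ^ k else t')" for i
    define X where "X i \<omega> = B (\<tau> (Suc i)) \<omega> - B (\<tau> i) \<omega>" for i \<omega>
    have "indep_vars (\<lambda>_. borel) X {..<Suc L}"
      unfolding X_def
    proof (rule indep_increments)
      fix i assume "i < Suc L"
      then consider "i < L" | "i = L" by linarith
      then show "\<tau> i < \<tau> (Suc i)"
        by cases (use t' Lk in \<open>auto simp: \<tau>_def divide_strict_right_mono\<close>)
    qed (simp add: \<tau>_def)
    from indep_var_restrict[OF this, of "{..<L}" "{L}"]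
    have "indep_var (Pi\<^sub>M {..<L} (\<lambda>_. borel)) (\<lambda>\<omega>. \<lambda>i\<in>{..<L}. X i \<omega>) (Pi\<^sub>M {L} (\<lambda>_. borel)) (\<lambda>\<omega>. \<lambda>i\<in>{L}. X i \<omega>)"
      by auto
    moreover have "(\<lambda>f. f L) -` C \<inter> space (Pi\<^sub>M {L} (\<lambda>_. borel)) \<in> sets (Pi\<^sub>M {L} (\<lambda>_. borel))" (is "?C \<in> _")
      using C(1) by (intro measurable_sets[OF measurable_component_singleton]) auto
    ultimately have "prob ((\<lambda>\<omega>. (\<lambda>i\<in>{..<L}. X i \<omega>, \<lambda>i\<in>{L}. X i \<omega>)) -` (A \<times> ?C) \<inter> space M) =
      prob ((\<lambda>\<omega>. \<lambda>i\<in>{..<L}. X i \<omega>) -` A \<inter> space M) * prob ((\<lambda>\<omega>. \<lambda>i\<in>{L}. X i \<omega>) -` ?C \<inter> space M)"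
      using A(1) by (intro indep_varD)
    moreover have 1: "(\<lambda>i\<in>{..<L}. X i \<omega>) = (\<lambda>i\<in>{..<L}. B (real (Suc i) / 2 ^ k) \<omega> - B (real i / 2 ^ k) \<omega>)" for \<omega>
      by (auto simp: X_def \<tau>_def restrict_def)
    moreover have 2: "X L = \<Delta>" by (auto simp: X_def \<tau>_def \<Delta>_def Lk)
    moreover have "(\<lambda>\<omega>. \<lambda>i\<in>{L}. X i \<omega>) -` ?C \<inter> space M = d"
      unfolding C(2) 2[symmetric] by (auto simp: space_PiM)
    moreover have "(\<lambda>\<omega>. (\<lambda>i\<in>{..<L}. X i \<omega>, \<lambda>i\<in>{L}. X i \<omega>)) -` (A \<times> ?C) \<inter> space M = a \<inter> d"
      unfolding 1 A(2) C(2) 2[symmetric] by (auto simp: space_PiM)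
    ultimately show ?thesis unfolding A(2) by simp
  qed
  have incr_meas: "incr_algebra k L \<subseteq> events" for k L
    unfolding incr_algebra_def by (auto intro!: measurable_sets measurable_restrict)
  have "indep_set G D"
    by (rule indep_setI) (use incr_meas in \<open>auto simp: G_def D_def ind[unfolded G_def D_def]\<close>)
  moreover have "Int_stable G"
  proof (rule Int_stableI)
    fix a d assume "a \<in> G" "d \<in> G"
    then obtain n1 n2 where n: "a \<in> incr_algebra (m + n1) (2 ^ n1 * j)" "d \<in> incr_algebra (m + n2) (2 ^ n2 * j)"
      by (auto simp: G_def)
    \<comment> \<open>A refinement common to both grids; the sum is a convenient upper bound of
      \<open>n1\<close> and \<open>n2\<close>.\<close>
    define n where "n = n1 + n2"
    have "a \<in> incr_algebra (m + n) (2 ^ n * j)"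
      using incr_algebra_mono[of "m + n1" "2 ^ n1 * j" n2] n(1) by (auto simp: n_def power_add add.assoc mult_ac)
    moreover have "d \<in> incr_algebra (m + n) (2 ^ n * j)"
      using incr_algebra_mono[of "m + n2" "2 ^ n2 * j" n1] n(2) by (auto simp: n_def power_add add_ac mult_ac)
    ultimately have "a \<inter> d \<in> incr_algebra (m + n) (2 ^ n * j)"
    proof -
      assume "a \<in> incr_algebra (m + n) (2 ^ n * j)" "d \<in> incr_algebra (m + n) (2 ^ n * j)"
      then obtain A1 A2 where A: "A1 \<in> sets (Pi\<^sub>M {..<2 ^ n * j} (\<lambda>_. borel))" "A2 \<in> sets (Pi\<^sub>M {..<2 ^ n * j}
          (\<lambda>_. borel))"
        "a = (\<lambda>\<omega>. \<lambda>i\<in>{..<2 ^ n * j}. B (real (Suc i) / 2 ^ (m + n)) \<omega> - B (real i / 2 ^ (m + n)) \<omega>) -` A1 \<inter> space M"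
        "d = (\<lambda>\<omega>. \<lambda>i\<in>{..<2 ^ n * j}. B (real (Suc i) / 2 ^ (m + n)) \<omega> - B (real i / 2 ^ (m + n)) \<omega>) -` A2 \<inter> space M"
        unfolding incr_algebra_def by blast
      then have "a \<inter> d = (\<lambda>\<omega>. \<lambda>i\<in>{..<2 ^ n * j}. B (real (Suc i) / 2 ^ (m + n)) \<omega> - B (real i / 2 ^ (m + n)) \<omega>)
          -` (A1 \<inter> A2) \<inter> space M"
        by auto
      moreover have "A1 \<inter> A2 \<in> sets (Pi\<^sub>M {..<2 ^ n * j} (\<lambda>_. borel))" using A by auto
      ultimately show ?thesis unfolding incr_algebra_def by blast
    qed
    then show "a \<inter> d \<in> G" by (auto simp: G_def)
  qed
  moreover have "Int_stable D"
  proof (rule Int_stableI)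
    fix a d assume "a \<in> D" "d \<in> D"
    then obtain C1 C2 where C: "C1 \<in> sets borel" "C2 \<in> sets borel" "a = \<Delta> -` C1 \<inter> space M" "d = \<Delta> -` C2 \<inter> space M"
      unfolding D_def by blast
    then have "a \<inter> d = \<Delta> -` (C1 \<inter> C2) \<inter> space M" "C1 \<inter> C2 \<in> sets borel" by auto
    then show "a \<inter> d \<in> D" unfolding D_def by blast
  qed
  ultimately have ss: "indep_set (sigma_sets (space M) G) (sigma_sets (space M) D)"
    by (rule indep_set_sigma_sets)
  have gen: "B (real i / 2 ^ n) -` A \<inter> space M \<in> G" if "real i / 2 ^ n \<le> real j / 2 ^ m" "A \<in> sets borel" for i n A
  proof -
    have "real (i * 2 ^ m) \<le> real (2 ^ n * j)" using that(1) by (simp add: field_simps)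
    then have "i * 2 ^ m \<le> 2 ^ n * j" by (simp only: of_nat_le_iff)
    from incr_algebra_generator[OF this that(2), of "m + n"]
    have "B (real i / 2 ^ n) -` A \<inter> space M \<in> incr_algebra (m + n) (2 ^ n * j)" by (simp add: power_add)
    then show ?thesis by (auto simp: G_def)
  qed
  have "sets (F (real j / 2 ^ m)) \<subseteq> sigma_sets (space M) G"
    unfolding sets_F by (rule sigma_sets_mono) (auto intro!: sigma_sets.Basic gen)
  moreover have "D \<subseteq> sigma_sets (space M) D" by auto
  ultimately show ?thesis
    using ss unfolding indep_sets2_eq D_def[symmetric] \<Delta>_def[symmetric] indep_set_def[symmetric] by blast
qed

lemma indep_var_F_increment:
  assumes Y: "Y \<in> measurable (F (real j / 2 ^ m)) N" and t': "real j / 2 ^ m < t'" and f: "f \<in> measurable borel N'"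
  shows "indep_var N Y N' (\<lambda>\<omega>. f (B t' \<omega> - B (real j / 2 ^ m) \<omega>))"
proof -
  have "0 \<le> real j / 2 ^ m" by simp
  then have t'0: "0 \<le> t'" using t' by linarith
  define \<Delta> where "\<Delta> \<omega> = B t' \<omega> - B (real j / 2 ^ m) \<omega>" for \<omega>
  have \<Delta>: "\<Delta> \<in> borel_measurable M" unfolding \<Delta>_def using t'0 by auto
  let ?D = "{\<Delta> -` C \<inter> space M | C. C \<in> sets borel}"
  have sD: "sigma_sets (space M) ?D = ?D"
    using sigma_sets_vimage_commute[of \<Delta> "space M" UNIV "sets borel"]
        by (simp add: sets.sigma_sets_eq[of borel, simplified])
  have "{Y -` A \<inter> space M |A. A \<in> sets N} \<subseteq> sets (F (real j / 2 ^ m))"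
    using measurable_sets[OF Y] by (auto simp: space_F)
  then have 1: "sigma_sets (space M) {Y -` A \<inter> space M |A. A \<in> sets N} \<subseteq> sets (F (real j / 2 ^ m))"
    using sets.sigma_sets_subset[of _ "F (real j / 2 ^ m)"] by (simp add: space_F)
  have "{(\<lambda>\<omega>. f (\<Delta> \<omega>)) -` A \<inter> space M |A. A \<in> sets N'} \<subseteq> ?D"
  proof safe
    fix A assume "A \<in> sets N'"
    then have "f -` A \<in> sets borel" using measurable_sets[OF f] by simp
    moreover have "(\<lambda>\<omega>. f (\<Delta> \<omega>)) -` A \<inter> space M = \<Delta> -` (f -` A) \<inter> space M" by auto
    ultimately show "\<exists>C. (\<lambda>\<omega>. f (\<Delta> \<omega>)) -` A \<inter> space M = \<Delta> -` C \<inter> space M \<and> C \<in> sets borel" by blast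
  qed
  then have "{(\<lambda>\<omega>. f (\<Delta> \<omega>)) -` A \<inter> space M |A. A \<in> sets N'} \<subseteq> sigma_sets (space M) ?D"
    by (simp only: sD)
  then have "sigma_sets (space M) {(\<lambda>\<omega>. f (\<Delta> \<omega>)) -` A \<inter> space M |A. A \<in> sets N'} \<subseteq> sigma_sets (space M) ?D"
    by (rule sigma_sets_mono)
  then have 2: "sigma_sets (space M) {(\<lambda>\<omega>. f (\<Delta> \<omega>)) -` A \<inter> space M |A. A \<in> sets N'} \<subseteq> ?D"
    by (simp only: sD)
  have ind: "indep_set (sets (F (real j / 2 ^ m))) ?D"
    unfolding \<Delta>_def by (rule indep_set_F_increment[OF t'])
  have *: "indep_set (sigma_sets (space M) {Y -` A \<inter> space M |A. A \<in> sets N})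
    (sigma_sets (space M) {(\<lambda>\<omega>. f (\<Delta> \<omega>)) -` A \<inter> space M |A. A \<in> sets N'})"
    by (rule indep_setI[OF order_trans[OF 1 indep_setD_ev1[OF ind]] order_trans[OF 2 indep_setD_ev2[OF ind]]
          indep_setD[OF ind subsetD[OF 1] subsetD[OF 2]]])
  show ?thesis
    unfolding indep_var_eq \<Delta>_def[symmetric]
    by (intro conjI measurable_F_imp[OF Y] measurable_compose[OF \<Delta> f] *)
qed

end

section \<open>Optional stopping\<close>

lemma dyadic_floor_LIMSEQ:
  assumes "0 \<le> x"
  shows "(\<lambda>k. real (nat \<lfloor>2 ^ k * x\<rfloor>) / 2 ^ k) \<longlonglongrightarrow> x" "real (nat \<lfloor>2 ^ k * x\<rfloor>) / 2 ^ k \<le> x"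
proof -
  have *: "real (nat \<lfloor>2 ^ k * x\<rfloor>) \<le> 2 ^ k * x \<and> 2 ^ k * x \<le> real (nat \<lfloor>2 ^ k * x\<rfloor>) + 1" for k
  proof -
    have "0 \<le> 2 ^ k * x" using assms by simp
    then show ?thesis by linarith
  qed
  show le: "real (nat \<lfloor>2 ^ k * x\<rfloor>) / 2 ^ k \<le> x" for k using *[of k] by (simp add: field_simps)
  show "(\<lambda>k. real (nat \<lfloor>2 ^ k * x\<rfloor>) / 2 ^ k) \<longlonglongrightarrow> x"
  proof (rule tendsto_sandwich)
    show "\<forall>\<^sub>F k in sequentially. x - (1/2) ^ k \<le> real (nat \<lfloor>2 ^ k * x\<rfloor>) / 2 ^ k"
    proof (intro always_eventually allI)
      fix k
      have "(2 ^ k * x - 1) / 2 ^ k \<le> real (nat \<lfloor>2 ^ k * x\<rfloor>) / 2 ^ k"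
        using *[of k] by (intro divide_right_mono) auto
      then show "x - (1/2) ^ k \<le> real (nat \<lfloor>2 ^ k * x\<rfloor>) / 2 ^ k"
        by (simp add: diff_divide_distrib power_divide)
    qed
    have "(\<lambda>k. x - (1/2) ^ k) \<longlonglongrightarrow> x - 0" by (intro tendsto_intros LIMSEQ_power_zero) auto
    then show "(\<lambda>k. x - (1/2) ^ k) \<longlonglongrightarrow> x" by simp
  qed (use le in auto)
qed

lemma dyadic_ceiling_LIMSEQ:
  assumes "0 \<le> x"
  shows "(\<lambda>k. real (nat \<lceil>2 ^ k * x\<rceil>) / 2 ^ k) \<longlonglongrightarrow> x"
proof (rule tendsto_sandwich)
  have *: "2 ^ k * x \<le> real (nat \<lceil>2 ^ k * x\<rceil>) \<and> real (nat \<lceil>2 ^ k * x\<rceil>) \<le> 2 ^ k * x + 1" for k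
  proof -
    have "0 \<le> 2 ^ k * x" using assms by simp
    then show ?thesis by linarith
  qed
  show "\<forall>\<^sub>F k in sequentially. x \<le> real (nat \<lceil>2 ^ k * x\<rceil>) / 2 ^ k"
    using * by (intro always_eventually) (simp add: field_simps)
  show "\<forall>\<^sub>F k in sequentially. real (nat \<lceil>2 ^ k * x\<rceil>) / 2 ^ k \<le> x + (1/2) ^ k"
  proof (intro always_eventually allI)
    fix k
    have "real (nat \<lceil>2 ^ k * x\<rceil>) / 2 ^ k \<le> (2 ^ k * x + 1) / 2 ^ k"
      using *[of k] by (intro divide_right_mono) auto
    then show "real (nat \<lceil>2 ^ k * x\<rceil>) / 2 ^ k \<le> x + (1/2) ^ k"
      by (simp add: add_divide_distrib power_divide)
  qed
  have "(\<lambda>k. x + (1/2) ^ k) \<longlonglongrightarrow> x + 0" by (intro tendsto_intros LIMSEQ_power_zero) auto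
  then show "(\<lambda>k. x + (1/2) ^ k) \<longlonglongrightarrow> x" by simp
qed auto

text \<open>Stopping times are rounded up, so that comparing the rounded time with a grid time is
  the same event as comparing the original one, and belongs to the filtration at that grid
  time.\<close>

lemma nat_ceiling_le_dyadic: "nat \<lceil>2 ^ m * x\<rceil> \<le> j \<longleftrightarrow> x \<le> real j / 2 ^ m"
  by (simp add: nat_le_iff ceiling_le_iff field_simps)

section \<open>Sampling the path at stopping times\<close>

context brownian_unbounded
begin

lemma measurable_min_stopping:
  assumes T: "stopping_time F T"
  shows "(\<lambda>\<omega>. min (T \<omega>) t) \<in> borel_measurable (F t)"
proof (rule borel_measurableI_le)
  fix c
  show "{\<omega> \<in> space (F t). min (T \<omega>) t \<le> c} \<in> sets (F t)"
  proof (cases "t \<le> c")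
    case True
    then have "{\<omega> \<in> space (F t). min (T \<omega>) t \<le> c} = space (F t)" by auto
    then show ?thesis by simp
  next
    case False
    then have "{\<omega> \<in> space (F t). min (T \<omega>) t \<le> c} = {\<omega> \<in> space (F t). T \<omega> \<le> c}" by auto
    then show ?thesis using stopping_time_le_const[OF T, of c t] False by (simp add: pred_def)
  qed
qed

lemma measurable_F_B_index:
  assumes g: "g \<in> measurable (F t) (count_space UNIV)"
    and le: "\<And>\<omega>. \<omega> \<in> space M \<Longrightarrow> real (g \<omega>) / 2 ^ k \<le> t"
  shows "(\<lambda>\<omega>. B (real (g \<omega> :: nat) / 2 ^ k) \<omega>) \<in> borel_measurable (F t)"
proof -
  \<comment> \<open>Values beyond time \<open>t\<close> are replaced by 0. The index never points
    there, but now every member of the countable family is measurable at time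
    \<open>t\<close>.\<close>
  define f where "f i = (if real i / 2 ^ k \<le> t then B (real i / 2 ^ k) else (\<lambda>_. 0))" for i
  have f: "f i \<in> borel_measurable (F t)" for i using measurable_F_B by (simp add: f_def)
  have "(\<lambda>\<omega>. f (g \<omega>) \<omega>) \<in> borel_measurable (F t)"
    by (rule measurable_compose_countable[OF f g])
  also have "(\<lambda>\<omega>. f (g \<omega>) \<omega>) \<in> borel_measurable (F t) \<longleftrightarrow> (\<lambda>\<omega>. B (real (g \<omega> :: nat) / 2 ^ k) \<omega>) \<in>
      borel_measurable (F t)"
    by (rule measurable_cong) (use le in \<open>auto simp: f_def space_F\<close>)
  finally show ?thesis .
qed

lemma B_tendsto:
  assumes "\<omega> \<in> space M" "x \<longlonglongrightarrow> t" "\<And>k::nat. 0 \<le> x k" "0 \<le> t"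
  shows "(\<lambda>k. B (x k) \<omega>) \<longlonglongrightarrow> B t \<omega>"
  by (rule continuous_on_tendsto_compose[OF continuous_B[OF assms(1)] assms(2)]) (use assms(3,4) in auto)

text \<open>Here the time is rounded down, which keeps the sampled dyadic times below
  \<open>t\<close>; the value of the path at the capped time is the limit of these samples by
  continuity.\<close>

lemma measurable_F_B_min_stopping:
  assumes T: "stopping_time F T" and T0: "\<And>\<omega>. \<omega> \<in> space M \<Longrightarrow> 0 \<le> T \<omega>" and t: "0 \<le> t"
  shows "(\<lambda>\<omega>. B (min (T \<omega>) t) \<omega>) \<in> borel_measurable (F t)"
proof (rule borel_measurable_LIMSEQ_real)
  fix k
  have [measurable]: "(\<lambda>\<omega>. min (T \<omega>) t) \<in> borel_measurable (F t)" by (rule measurable_min_stopping[OF T])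
  show "(\<lambda>\<omega>. B (real (nat \<lfloor>2 ^ k * min (T \<omega>) t\<rfloor>) / 2 ^ k) \<omega>) \<in> borel_measurable (F t)"
  proof (rule measurable_F_B_index)
    show "(\<lambda>\<omega>. nat \<lfloor>2 ^ k * min (T \<omega>) t\<rfloor>) \<in> measurable (F t) (count_space UNIV)" by measurable
    show "real (nat \<lfloor>2 ^ k * min (T \<omega>) t\<rfloor>) / 2 ^ k \<le> t" if "\<omega> \<in> space M" for \<omega>
      using dyadic_floor_LIMSEQ(2)[of "min (T \<omega>) t" k] T0[OF that] t by linarith
  qed
next
  fix \<omega> assume "\<omega> \<in> space (F t)"
  then have \<omega>: "\<omega> \<in> space M" by (simp add: space_F)
  show "(\<lambda>k. B (real (nat \<lfloor>2 ^ k * min (T \<omega>) t\<rfloor>) / 2 ^ k) \<omega>) \<longlonglongrightarrow> B (min (T \<omega>) t) \<omega>"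
    using T0[OF \<omega>] t by (intro B_tendsto \<omega> dyadic_floor_LIMSEQ) auto
qed

lemma measurable_B_stopping:
  assumes T: "stopping_time F T" and T0: "\<And>\<omega>. \<omega> \<in> space M \<Longrightarrow> 0 \<le> T \<omega>"
  shows "(\<lambda>\<omega>. B (T \<omega>) \<omega>) \<in> borel_measurable (pre_sigma T)"
proof (rule measurableI)
  fix A :: "real set" assume A: "A \<in> sets borel"
  show "(\<lambda>\<omega>. B (T \<omega>) \<omega>) -` A \<inter> space (pre_sigma T) \<in> sets (pre_sigma T)"
  proof (rule sets_pre_sigmaI[OF T])
    fix t
    show "{\<omega> \<in> (\<lambda>\<omega>. B (T \<omega>) \<omega>) -` A \<inter> space (pre_sigma T). T \<omega> \<le> t} \<in> sets (F t)"
    proof (cases "0 \<le> t")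
      case True
      have "{\<omega> \<in> (\<lambda>\<omega>. B (T \<omega>) \<omega>) -` A \<inter> space (pre_sigma T). T \<omega> \<le> t} =
        ((\<lambda>\<omega>. B (min (T \<omega>) t) \<omega>) -` A \<inter> space (F t)) \<inter> {\<omega> \<in> space (F t). T \<omega> \<le> t}"
        by (auto simp: space_pre_sigma space_F min_absorb1)
      then show ?thesis
        using measurable_sets[OF measurable_F_B_min_stopping[OF T T0 True] A] stopping_timeD[OF T, of t]
        by (simp add: pred_def)
    next
      case False
      then have "{\<omega> \<in> (\<lambda>\<omega>. B (T \<omega>) \<omega>) -` A \<inter> space (pre_sigma T). T \<omega> \<le> t} = {}"
        using T0 by (force simp: space_pre_sigma)
      then show ?thesis by (simp only: sets.empty_sets)
    qed
  qed
qed simp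

lemma sets_pre_sigma_subset:
  assumes T: "stopping_time F T"
  shows "sets (pre_sigma T) \<subseteq> sets M"
proof
  fix A assume A: "A \<in> sets (pre_sigma T)"
  have m: "{\<omega>\<in>A. T \<omega> \<le> real n} \<in> sets M" for n
    using sets_pre_sigmaD[OF T A] sets_F_subset by blast
  have "A = (\<Union>n::nat. {\<omega>\<in>A. T \<omega> \<le> real n})" using reals_Archimedean2 by (auto intro: less_imp_le)
  moreover have "(\<Union>n::nat. {\<omega>\<in>A. T \<omega> \<le> real n}) \<in> sets M" by (rule sets.countable_UN) (use m in auto)
  ultimately show "A \<in> sets M" by (rule ssubst)
qed

text \<open>The dyadic criterion expresses the event by countably many conditions on the past of
  \<open>t\<close>. In it \<open>B (T \<omega>) \<omega>\<close> is replaced by the value at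
  \<open>min (T \<omega>) t\<close>, which is measurable at time \<open>t\<close> and agrees with it
  wherever \<open>T \<omega> \<le> t\<close>.\<close>

lemma stopping_time_next_hit:
  assumes T: "stopping_time F T" and T0: "\<And>\<omega>. \<omega> \<in> space M \<Longrightarrow> 0 \<le> T \<omega>"
  shows "stopping_time F (\<lambda>\<omega>. next_hit (\<lambda>t. B t \<omega>) (T \<omega>))"
proof
  fix t
  show "Measurable.pred (F t) (\<lambda>\<omega>. next_hit (\<lambda>t. B t \<omega>) (T \<omega>) \<le> t)"
  proof (cases "0 \<le> t")
    case False
    have "next_hit (\<lambda>t. B t \<omega>) (T \<omega>) \<le> t \<longleftrightarrow> False" if "\<omega> \<in> space (F t)" for \<omega>
    proof -
      have \<omega>: "\<omega> \<in> space M" using that by (simp add: space_F)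
      show ?thesis
        using unbounded_continuous_path.next_hit_props(1)[OF path[OF \<omega>] T0[OF \<omega>]] T0[OF \<omega>] False by auto
    qed
    from measurable_cong[of "F t" "\<lambda>\<omega>. next_hit (\<lambda>t. B t \<omega>) (T \<omega>) \<le> t" "\<lambda>_. False" "count_space UNIV", OF this]
    show ?thesis by simp
  next
    case True
    have [measurable]: "(\<lambda>\<omega>. B (min (T \<omega>) t) \<omega>) \<in> borel_measurable (F t)"
      by (rule measurable_F_B_min_stopping[OF T T0 True])
    have [measurable]: "Measurable.pred (F t) (\<lambda>\<omega>. T \<omega> \<le> t)" by (rule stopping_timeD[OF T])
    have "Measurable.pred (F t) (\<lambda>\<omega>. T \<omega> \<le> real i / 2 ^ n \<and> real i / 2 ^ n \<le> t \<and>
        1 - 1 / real (Suc k) < \<bar>B (real i / 2 ^ n) \<omega> - B (min (T \<omega>) t) \<omega>\<bar>)" for i n k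
    proof (cases "real i / 2 ^ n \<le> t")
      case True
      have [measurable]: "B (real i / 2 ^ n) \<in> borel_measurable (F t)" by (rule measurable_F_B[OF True])
      have [measurable]: "Measurable.pred (F t) (\<lambda>\<omega>. T \<omega> \<le> real i / 2 ^ n)"
          by (rule stopping_time_le_const[OF T True])
      show ?thesis by measurable
    qed simp
    note * = this
    define Q where "Q \<omega> \<longleftrightarrow> (\<forall>k. \<exists>n i. T \<omega> \<le> real i / 2 ^ n \<and> real i / 2 ^ n \<le> t \<and>
        1 - 1 / real (Suc k) < \<bar>B (real i / 2 ^ n) \<omega> - B (min (T \<omega>) t) \<omega>\<bar>)" for \<omega>
    have [measurable]: "Measurable.pred (F t) Q"
      unfolding Q_def by (intro pred_intros_countable *)
    have "Measurable.pred (F t) (\<lambda>\<omega>. T \<omega> \<le> t \<and> Q \<omega>)" by measurable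
    moreover have "next_hit (\<lambda>t. B t \<omega>) (T \<omega>) \<le> t \<longleftrightarrow> T \<omega> \<le> t \<and> Q \<omega>" if "\<omega> \<in> space (F t)" for \<omega>
    proof -
      have \<omega>: "\<omega> \<in> space M" using that by (simp add: space_F)
      show ?thesis
        unfolding Q_def unbounded_continuous_path.next_hit_le_iff_dyadic[OF path[OF \<omega>] T0[OF \<omega>]]
        by (rule conj_cong) (auto simp: min_absorb1)
    qed
    ultimately show ?thesis
      using measurable_cong[of "F t" "\<lambda>\<omega>. next_hit (\<lambda>t. B t \<omega>) (T \<omega>) \<le> t" "\<lambda>\<omega>. T \<omega> \<le> t \<and> Q \<omega>" "count_space
          UNIV"] by blast
  qed
qed

definition \<tau> :: "nat \<Rightarrow> 'a \<Rightarrow> real" where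
  "\<tau> n \<omega> = hit_time (\<lambda>t. B t \<omega>) n"

definition R :: "nat \<Rightarrow> 'a \<Rightarrow> real" where
  "R n \<omega> = B (\<tau> n \<omega>) \<omega>"

lemma \<tau>_nonneg: "\<omega> \<in> space M \<Longrightarrow> 0 \<le> \<tau> n \<omega>"
  unfolding \<tau>_def by (rule unbounded_continuous_path.hit_time_nonneg[OF path])

lemma \<tau>_less: "\<omega> \<in> space M \<Longrightarrow> \<tau> n \<omega> < \<tau> (Suc n) \<omega>"
  unfolding \<tau>_def by (rule unbounded_continuous_path.hit_time_less[OF path])

lemma abs_R_step: "\<omega> \<in> space M \<Longrightarrow> \<bar>R (Suc n) \<omega> - R n \<omega>\<bar> = 1"
  unfolding R_def \<tau>_def by (rule unbounded_continuous_path.abs_hit_step[OF path])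

lemma stopping_time_\<tau>: "stopping_time F (\<tau> n)"
proof (induction n)
  case 0
  then show ?case by (simp add: \<tau>_def stopping_time_const)
next
  case (Suc n)
  from stopping_time_next_hit[OF this \<tau>_nonneg] show ?case by (simp add: \<tau>_def[abs_def])
qed

lemma measurable_pre_sigma_\<tau>: "\<tau> n \<in> borel_measurable (pre_sigma (\<tau> n))"
  by (rule measurable_stopping_time_pre_sigma[OF stopping_time_\<tau>])

lemma measurable_pre_sigma_R: "R n \<in> borel_measurable (pre_sigma (\<tau> n))"
  unfolding R_def by (rule measurable_B_stopping[OF stopping_time_\<tau> \<tau>_nonneg])

lemma measurable_pre_sigma_imp:
  "stopping_time F T \<Longrightarrow> f \<in> measurable (pre_sigma T) N \<Longrightarrow> f \<in> measurable M N"
  using sets_pre_sigma_subset[of T] by (auto simp: measurable_def space_pre_sigma)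

lemma measurable_\<tau> [measurable]: "\<tau> n \<in> borel_measurable M"
  by (rule measurable_pre_sigma_imp[OF stopping_time_\<tau> measurable_pre_sigma_\<tau>])

lemma measurable_R [measurable]: "R n \<in> borel_measurable M"
  by (rule measurable_pre_sigma_imp[OF stopping_time_\<tau> measurable_pre_sigma_R])

lemma sets_pre_sigma_\<tau>_mono: "m \<le> n \<Longrightarrow> sets (pre_sigma (\<tau> m)) \<subseteq> sets (pre_sigma (\<tau> n))"
proof (induction rule: dec_induct)
  case (step k)
  then show ?case
    using mono_pre_sigma[OF stopping_time_\<tau>[of k] stopping_time_\<tau>[of "Suc k"]] \<tau>_less by (force intro: less_imp_le)
qed simp

lemma measurable_pre_sigma_\<tau>_mono:
  "f \<in> measurable (pre_sigma (\<tau> m)) N \<Longrightarrow> m \<le> n \<Longrightarrow> f \<in> measurable (pre_sigma (\<tau> n)) N"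
  using sets_pre_sigma_\<tau>_mono[of m n] by (auto simp: measurable_def space_pre_sigma)

text \<open>Optional stopping for the martingale \<open>exp (\<i>\<theta>B\<^sub>t + \<theta>\<^sup>2t/2)\<close>, first for the stopping times rounded up
  to a dyadic grid. Each telescoping step is a product of an \<open>F\<close>-measurable factor and an
  independent factor of mean zero.\<close>

lemma optional_stopping_grid:
  fixes \<theta> :: real and m :: nat
  assumes S: "stopping_time F S" "\<And>\<omega>. \<omega> \<in> space M \<Longrightarrow> 0 \<le> S \<omega>"
    and T: "stopping_time F T" and ST: "\<And>\<omega>. \<omega> \<in> space M \<Longrightarrow> S \<omega> \<le> T \<omega>"
    and A: "A \<in> sets (pre_sigma S)"
  defines "Z \<equiv> \<lambda>j \<omega>. iexp (\<theta> * B (real j / 2 ^ m) \<omega>) * of_real (exp (\<theta>\<^sup>2 * (real j / 2 ^ m) / 2))"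
  defines "W \<equiv> \<lambda>J \<omega>. if \<omega> \<in> A then Z (min J (nat \<lceil>2 ^ m * T \<omega>\<rceil>)) \<omega> / Z (min J (nat \<lceil>2 ^ m * S \<omega>\<rceil>)) \<omega> else 0"
  shows "(\<integral>\<omega>. W J \<omega> \<partial>M) = of_real (prob A)" "W J \<in> borel_measurable M"
    "\<And>\<omega>. \<omega> \<in> space M \<Longrightarrow> cmod (W J \<omega>) \<le> exp (\<theta>\<^sup>2 * (real J / 2 ^ m) / 2)"
proof -
  define s t where "s \<omega> = nat \<lceil>2 ^ m * S \<omega>\<rceil>" and "t \<omega> = nat \<lceil>2 ^ m * T \<omega>\<rceil>" for \<omega>
  have AM [measurable]: "A \<in> sets M" using A sets_pre_sigma_subset[OF S(1)] by auto
  have [measurable]: "S \<in> borel_measurable M" "T \<in> borel_measurable M"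
    by (rule measurable_stopping_time[OF S(1) sets_F_subset space_F] measurable_stopping_time[OF T
        sets_F_subset space_F])+
  have [measurable]: "Z j \<in> borel_measurable M" for j unfolding Z_def by measurable
  have [measurable]: "s \<in> measurable M (count_space UNIV)" "t \<in> measurable M (count_space UNIV)"
    unfolding s_def t_def by measurable
  have Zg: "(\<lambda>\<omega>. Z (g \<omega>) \<omega>) \<in> borel_measurable M" if "g \<in> measurable M (count_space UNIV)" for g
    by (rule measurable_compose_countable[OF _ that]) simp
  have st: "s \<omega> \<le> t \<omega>" if "\<omega> \<in> space M" for \<omega>
    unfolding s_def t_def using ST[OF that] by (intro nat_mono ceiling_mono) simp
  have Z0: "Z j \<omega> \<noteq> 0" for j \<omega> by (simp add: Z_def)
  have nZ: "cmod (Z j \<omega>) = exp (\<theta>\<^sup>2 * (real j / 2 ^ m) / 2)" for j \<omega>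
    by (simp add: Z_def norm_mult)
  have W: "W J \<omega> = (if \<omega> \<in> A then Z (min J (t \<omega>)) \<omega> / Z (min J (s \<omega>)) \<omega> else 0)" for J \<omega>
    by (simp add: W_def s_def t_def)
  show Wm: "W J \<in> borel_measurable M" for J
    unfolding W by (intro measurable_If borel_measurable_divide Zg) measurable
  \<comment> \<open>The modulus of \<open>Z\<close> is at least 1, so dividing by it does not
    increase the modulus and the bound of the numerator remains.\<close>
  have quot: "cmod (Z i \<omega> / Z j \<omega>) \<le> exp (\<theta>\<^sup>2 * (real J / 2 ^ m) / 2)" if "i \<le> J" for i j J \<omega>
  proof -
    have "cmod (Z i \<omega> / Z j \<omega>) \<le> cmod (Z i \<omega>) / 1"
      unfolding norm_divide by (rule divide_left_mono) (auto simp: nZ)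
    also have "\<dots> \<le> exp (\<theta>\<^sup>2 * (real J / 2 ^ m) / 2)"
      using that by (simp add: nZ divide_right_mono mult_left_mono)
    finally show ?thesis .
  qed
  show Wb: "cmod (W J \<omega>) \<le> exp (\<theta>\<^sup>2 * (real J / 2 ^ m) / 2)" if "\<omega> \<in> space M" for J \<omega>
    unfolding W using quot[of "min J (t \<omega>)" J] by auto
  have iW: "integrable M (W J)" for J
    by (rule integrable_const_bound[OF AE_I2[OF Wb] Wm])
  \<comment> \<open>The stopped quotient moves between grid times \<open>J\<close> and
    \<open>J + 1\<close> exactly when the rounded \<open>S\<close> has passed and the rounded
    \<open>T\<close> has not. The inner minimum changes nothing on that event but makes the starting
    index measurable at grid time \<open>J\<close>.\<close>
  define Y where "Y J \<omega> = (if (\<omega> \<in> A \<and> S \<omega> \<le> real J / 2 ^ m) \<and> \<not> T \<omega> \<le> real J / 2 ^ m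
    then Z J \<omega> / Z (nat \<lceil>2 ^ m * min (S \<omega>) (real J / 2 ^ m)\<rceil>) \<omega> else 0)" for J \<omega>
  have YF: "Y J \<in> borel_measurable (F (real J / 2 ^ m))" for J
  proof -
    let ?F = "F (real J / 2 ^ m)"
    have "{\<omega> \<in> A. S \<omega> \<le> real J / 2 ^ m} \<in> sets ?F" by (rule sets_pre_sigmaD[OF S(1) A])
    moreover have "{\<omega> \<in> A. S \<omega> \<le> real J / 2 ^ m} = {\<omega> \<in> space ?F. \<omega> \<in> A \<and> S \<omega> \<le> real J / 2 ^ m}"
      using sets.sets_into_space[OF AM] by (auto simp: space_F)
    ultimately have [measurable]: "Measurable.pred ?F (\<lambda>\<omega>. \<omega> \<in> A \<and> S \<omega> \<le> real J / 2 ^ m)" by (simp add: pred_def)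
    have [measurable]: "Measurable.pred ?F (\<lambda>\<omega>. T \<omega> \<le> real J / 2 ^ m)" by (rule stopping_timeD[OF T])
    have [measurable]: "B (real J / 2 ^ m) \<in> borel_measurable ?F" by (rule measurable_F_B) simp
    have [measurable]: "(\<lambda>\<omega>. min (S \<omega>) (real J / 2 ^ m)) \<in> borel_measurable ?F"
        by (rule measurable_min_stopping[OF S(1)])
    have g: "(\<lambda>\<omega>. nat \<lceil>2 ^ m * min (S \<omega>) (real J / 2 ^ m)\<rceil>) \<in> measurable ?F (count_space UNIV)" by measurable
    have gle: "nat \<lceil>2 ^ m * min (S \<omega>) (real J / 2 ^ m)\<rceil> \<le> J" for \<omega>
      unfolding nat_ceiling_le_dyadic by simp
    have "(\<lambda>\<omega>. B (real (nat \<lceil>2 ^ m * min (S \<omega>) (real J / 2 ^ m)\<rceil>) / 2 ^ m) \<omega>) \<in> borel_measurable ?F"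
      by (rule measurable_F_B_index[OF g]) (use gle in \<open>simp add: divide_right_mono\<close>)
    then show ?thesis unfolding Y_def Z_def using g by measurable
  qed
  have Yb: "cmod (Y J \<omega>) \<le> exp (\<theta>\<^sup>2 * (real J / 2 ^ m) / 2)" for J \<omega>
    unfolding Y_def using quot[of J J] by auto
  \<comment> \<open>The ratio of \<open>Z\<close> at consecutive grid times, minus 1. The
    compensating exponential is the inverse of the characteristic function of the increment, hence
    mean 0.\<close>
  define Q where "Q J \<omega> = iexp (\<theta> * (B (real (Suc J) / 2 ^ m) \<omega> - B (real J / 2 ^ m) \<omega>)) * of_real (exp (\<theta>\<^sup>2 *
      (1 / 2 ^ m) / 2)) - 1" for J \<omega>
  have lt: "real J / 2 ^ m < real (Suc J) / 2 ^ m" for J by (simp add: divide_strict_right_mono)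
  have len: "real (Suc J) / 2 ^ m - real J / 2 ^ m = 1 / 2 ^ m" for J by (simp add: field_simps)
  have [measurable]: "Q J \<in> borel_measurable M" for J unfolding Q_def by measurable
  have i1: "integrable M (\<lambda>\<omega>. iexp (\<theta> * (B (real (Suc J) / 2 ^ m) \<omega> - B (real J / 2 ^ m) \<omega>)))" for J
    by (rule integrable_const_bound[of _ 1]) (auto simp del: of_nat_Suc)
  have iQ: "integrable M (Q J)" for J unfolding Q_def using i1[of J] by auto
  have EQ: "(\<integral>\<omega>. Q J \<omega> \<partial>M) = 0" for J
  proof -
    have "(\<integral>\<omega>. Q J \<omega> \<partial>M) = (\<integral>\<omega>. iexp (\<theta> * (B (real (Suc J) / 2 ^ m) \<omega> - B (real J / 2 ^ m) \<omega>)) \<partial>M) * of_real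
        (exp (\<theta>\<^sup>2 * (1 / 2 ^ m) / 2)) - 1"
      unfolding Q_def using i1[of J] by (simp del: of_nat_Suc add: prob_space)
    also have "(\<integral>\<omega>. iexp (\<theta> * (B (real (Suc J) / 2 ^ m) \<omega> - B (real J / 2 ^ m) \<omega>)) \<partial>M)
        = of_real (exp (- (\<theta>\<^sup>2 * (1 / 2 ^ m) / 2)))"
      by (rule char_increment[OF _ lt[of J], of \<theta>, unfolded len]) simp
    also have "of_real (exp (- (\<theta>\<^sup>2 * (1 / 2 ^ m) / 2))) * complex_of_real (exp (\<theta>\<^sup>2 * (1 / 2 ^ m) / 2)) - 1 = 0"
      unfolding of_real_mult[symmetric] exp_add[symmetric] by simp
    finally show ?thesis .
  qed
  have step: "W (Suc J) \<omega> = W J \<omega> + Y J \<omega> * Q J \<omega>" if \<omega>: "\<omega> \<in> space M" for J \<omega>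
  proof (cases "\<omega> \<in> A")
    case True
    have sJ: "S \<omega> \<le> real J / 2 ^ m \<longleftrightarrow> s \<omega> \<le> J" and tJ: "T \<omega> \<le> real J / 2 ^ m \<longleftrightarrow> t \<omega> \<le> J"
      unfolding s_def t_def nat_ceiling_le_dyadic by auto
    have ZS: "Z (Suc J) \<omega> = Z J \<omega> * (Q J \<omega> + 1)"
    proof -
      have e: "real (Suc J) / 2 ^ m = real J / 2 ^ m + 1 / 2 ^ m" by (simp add: field_simps)
      have "exp (\<theta>\<^sup>2 * (real (Suc J) / 2 ^ m) / 2) = exp (\<theta>\<^sup>2 * (real J / 2 ^ m) / 2) * exp (\<theta>\<^sup>2 * (1 / 2 ^ m) / 2)"
        unfolding e by (simp add: exp_add[symmetric] field_simps)
      moreover have "iexp (\<theta> * B (real (Suc J) / 2 ^ m) \<omega>) = iexp (\<theta> * B (real J / 2 ^ m) \<omega>) * iexp (\<theta> *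
          (B (real (Suc J) / 2 ^ m) \<omega> - B (real J / 2 ^ m) \<omega>))"
        unfolding exp_add[symmetric] by (simp add: algebra_simps del: of_nat_Suc)
      ultimately show ?thesis unfolding Z_def Q_def by (simp del: of_nat_Suc)
    qed
    consider "J < s \<omega>" | "s \<omega> \<le> J" "J < t \<omega>" | "t \<omega> \<le> J" "s \<omega> \<le> J" using st[OF \<omega>] by linarith
    then show ?thesis
    proof cases
      case 1
      then have "min J (s \<omega>) = J" "min J (t \<omega>) = J" "min (Suc J) (s \<omega>) = Suc J" "min (Suc J) (t \<omega>) = Suc J"
        using st[OF \<omega>] by auto
      then show ?thesis using True 1 Z0 by (simp add: W Y_def sJ)
    next
      case 2
      then have "min J (s \<omega>) = s \<omega>" "min J (t \<omega>) = J" "min (Suc J) (s \<omega>) = s \<omega>" "min (Suc J) (t \<omega>) = Suc J" by auto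
      moreover have "min (S \<omega>) (real J / 2 ^ m) = S \<omega>" using 2 sJ by simp
      ultimately have "W (Suc J) \<omega> = Z (Suc J) \<omega> / Z (s \<omega>) \<omega>" "W J \<omega> = Z J \<omega> / Z (s \<omega>) \<omega>"
        "Y J \<omega> = Z J \<omega> / Z (s \<omega>) \<omega>"
        using True 2 by (auto simp: W Y_def sJ tJ s_def[symmetric])
      then show ?thesis by (simp add: ZS distrib_left add_divide_distrib)
    next
      case 3
      then have "min J (s \<omega>) = s \<omega>" "min J (t \<omega>) = t \<omega>" "min (Suc J) (s \<omega>) = s \<omega>" "min (Suc J) (t \<omega>) = t \<omega>" by auto
      then show ?thesis using True 3 by (simp add: W Y_def tJ)
    qed
  qed (simp add: W Y_def)
  show "(\<integral>\<omega>. W J \<omega> \<partial>M) = of_real (prob A)"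
  proof (induction J)
    case 0
    have "(\<integral>\<omega>. W 0 \<omega> \<partial>M) = (\<integral>\<omega>. of_real (indicator A \<omega>) \<partial>M)"
      by (intro Bochner_Integration.integral_cong refl) (simp add: W Z0 indicator_def)
    also have "\<dots> = of_real (prob A)"
      unfolding integral_complex_of_real using sets.sets_into_space[OF AM] by (simp add: Int_absorb2)
    finally show ?case .
  next
    case (Suc J)
    have iY: "integrable M (Y J)"
      by (rule integrable_const_bound[OF AE_I2[OF Yb] measurable_F_imp[OF YF]])
    have ind: "indep_var borel (Y J) borel (Q J)"
      unfolding Q_def
      by (rule indep_var_F_increment[OF YF lt, where f="\<lambda>x. iexp (\<theta> * x) * of_real (exp (\<theta>\<^sup>2 * (1 / 2 ^ m) /
          2)) - 1"]) measurable
    have "(\<integral>\<omega>. W (Suc J) \<omega> \<partial>M) = (\<integral>\<omega>. W J \<omega> + Y J \<omega> * Q J \<omega> \<partial>M)"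
      by (intro Bochner_Integration.integral_cong refl step)
    also have "\<dots> = (\<integral>\<omega>. W J \<omega> \<partial>M) + (\<integral>\<omega>. Y J \<omega> \<partial>M) * (\<integral>\<omega>. Q J \<omega> \<partial>M)"
      using iW indep_var_integrable[OF ind iY iQ] indep_var_lebesgue_integral[OF ind iY iQ] by simp
    finally show ?case using Suc.IH EQ by simp
  qed
qed

text \<open>The mesh tends to 0: the rounded times converge, and the path is continuous. The
  deterministic cap \<open>K\<close> is what allows dominated convergence, with the constant
  \<open>exp (\<theta>\<^sup>2 * real K / 2)\<close> as majorant.\<close>

lemma optional_stopping:
  fixes \<theta> :: real and K :: nat
  assumes S: "stopping_time F S" "\<And>\<omega>. \<omega> \<in> space M \<Longrightarrow> 0 \<le> S \<omega>"
    and T: "stopping_time F T" and ST: "\<And>\<omega>. \<omega> \<in> space M \<Longrightarrow> S \<omega> \<le> T \<omega>"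
    and A: "A \<in> sets (pre_sigma S)"
  shows "(\<integral>\<omega>. (if \<omega> \<in> A then iexp (\<theta> * (B (min (real K) (T \<omega>)) \<omega> - B (min (real K) (S \<omega>)) \<omega>)) *
      of_real (exp (\<theta>\<^sup>2 * (min (real K) (T \<omega>) - min (real K) (S \<omega>)) / 2)) else 0) \<partial>M) = of_real (prob A)" (is
          "(\<integral>\<omega>. ?f \<omega> \<partial>M) = _")
proof -
  define Z where "Z m j \<omega> = iexp (\<theta> * B (real j / 2 ^ m) \<omega>) * of_real (exp (\<theta>\<^sup>2 * (real j / 2 ^ m) / 2))"
      for m j :: nat and \<omega>
  define W where "W m J \<omega> = (if \<omega> \<in> A then Z m (min J (nat \<lceil>2 ^ m * T \<omega>\<rceil>)) \<omega> / Z m (min J (nat \<lceil>2 ^ m * S \<omega>\<rceil>))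
      \<omega> else 0)" for m J \<omega>
  note grid = optional_stopping_grid[OF S T ST A, where \<theta>=\<theta>, folded Z_def, folded W_def]
  have AM: "A \<in> sets M" using A sets_pre_sigma_subset[OF S(1)] by auto
  define V where "V x \<omega> = iexp (\<theta> * B x \<omega>) * of_real (exp (\<theta>\<^sup>2 * x / 2))" for x \<omega>
  have conv: "(\<lambda>m. Z m (min (K * 2 ^ m) (nat \<lceil>2 ^ m * x\<rceil>)) \<omega>) \<longlonglongrightarrow> V (min (real K) x) \<omega>" if "\<omega> \<in> space M" "0 \<le> x" for x \<omega>
  proof -
    have e: "real (min (K * 2 ^ m) (nat \<lceil>2 ^ m * x\<rceil>)) / 2 ^ m = min (real K) (real (nat \<lceil>2 ^ m * x\<rceil>) / 2 ^ m)" for m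
      by (simp add: of_nat_min min_divide_distrib_right)
    define q where "q m = min (real K) (real (nat \<lceil>2 ^ m * x\<rceil>) / 2 ^ m)" for m
    have c: "q \<longlonglongrightarrow> min (real K) x"
      unfolding q_def by (intro tendsto_min tendsto_const dyadic_ceiling_LIMSEQ that)
    have q0: "0 \<le> q m" for m
      unfolding q_def by (rule min.boundedI, rule of_nat_0_le_iff, rule divide_nonneg_nonneg,
          rule of_nat_0_le_iff, simp)
    have "(\<lambda>m. B (q m) \<omega>) \<longlonglongrightarrow> B (min (real K) x) \<omega>"
      by (rule B_tendsto[OF that(1) c]) (simp_all add: q0 that(2))
    then show ?thesis
      unfolding Z_def V_def e q_def[symmetric] by (intro tendsto_intros c) simp_all
  qed
  have fV: "?f \<omega> = (if \<omega> \<in> A then V (min (real K) (T \<omega>)) \<omega> / V (min (real K) (S \<omega>)) \<omega> else 0)" for \<omega>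
    by (simp add: V_def exp_diff right_diff_distrib diff_divide_distrib)
  have lim: "(\<lambda>m. W m (K * 2 ^ m) \<omega>) \<longlonglongrightarrow> ?f \<omega>" if "\<omega> \<in> space M" for \<omega>
    unfolding fV W_def
  proof (cases "\<omega> \<in> A")
    case True
    have "V x \<omega> \<noteq> 0" for x by (simp add: V_def)
    then show "(\<lambda>m. if \<omega> \<in> A then Z m (min (K * 2 ^ m) (nat \<lceil>2 ^ m * T \<omega>\<rceil>)) \<omega> / Z m (min (K * 2 ^ m) (nat \<lceil>2 ^
        m * S \<omega>\<rceil>)) \<omega> else 0)
      \<longlonglongrightarrow> (if \<omega> \<in> A then V (min (real K) (T \<omega>)) \<omega> / V (min (real K) (S \<omega>)) \<omega> else 0)"
      using True S(2)[OF that] ST[OF that] that by (simp del: of_nat_mult of_nat_min) (intro tendsto_divide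
          conv, auto)
  qed simp
  have "(\<lambda>m. \<integral>\<omega>. W m (K * 2 ^ m) \<omega> \<partial>M) \<longlonglongrightarrow> (\<integral>\<omega>. ?f \<omega> \<partial>M)"
  proof (rule integral_dominated_convergence[where w="\<lambda>_. exp (\<theta>\<^sup>2 * real K / 2)"])
    show "AE \<omega> in M. cmod (W m (K * 2 ^ m) \<omega>) \<le> exp (\<theta>\<^sup>2 * real K / 2)" for m
      using grid(3)[of _ m "K * 2 ^ m"] by (intro AE_I2) simp
    show "?f \<in> borel_measurable M"
      by (rule borel_measurable_LIMSEQ_metric[OF grid(2) lim])
  qed (use lim grid(2) in auto)
  moreover have "(\<lambda>m. \<integral>\<omega>. W m (K * 2 ^ m) \<omega> \<partial>M) = (\<lambda>m. of_real (prob A))"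
    by (rule ext) (rule grid(1))
  ultimately have "(\<lambda>m::nat. complex_of_real (prob A)) \<longlonglongrightarrow> (\<integral>\<omega>. ?f \<omega> \<partial>M)" by (simp only:)
  then show ?thesis by (rule LIMSEQ_unique[OF _ tendsto_const])
qed

end

section \<open>Laws of the embedded steps and of their durations\<close>

text \<open>Maclaurin's formula of order 4. Since the exponential moments of a duration are of the
  form \<open>1 / cos \<theta>\<close>, these bounds are the source of its mean 1 and of a second
  order error term.\<close>

lemma cos_quadratic_bounds:
  fixes x :: real
  shows "1 - x\<^sup>2 / 2 - x ^ 4 / 24 \<le> cos x" "cos x \<le> 1 - x\<^sup>2 / 2 + x ^ 4 / 24"
proof -
  obtain t where t: "cos x = (\<Sum>m<4. cos_coeff m * x ^ m) + (cos (t + 1/2 * real 4 * pi) / fact 4) * x ^ 4"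
    using Maclaurin_cos_expansion[of x 4] by auto
  have s: "(\<Sum>m<4. cos_coeff m * x ^ m) = 1 - x\<^sup>2 / 2"
  proof -
    have "{..<4::nat} = {0, 1, 2, 3}" by auto
    then show ?thesis by (simp add: cos_coeff_def)
  qed
  have f: "fact 4 = (24::real)" by (simp add: fact_numeral)
  have "\<bar>(cos (t + 1/2 * real 4 * pi) / fact 4) * x ^ 4\<bar> \<le> 1 / 24 * x ^ 4"
    unfolding abs_mult f by (intro mult_mono) auto
  then show "1 - x\<^sup>2 / 2 - x ^ 4 / 24 \<le> cos x" "cos x \<le> 1 - x\<^sup>2 / 2 + x ^ 4 / 24"
    unfolding t s f by (simp_all only: abs_le_iff) linarith+
qed

text \<open>The martingale yields moments with positive exponents; this inequality transfers them to
  negative ones. It adds up \<open>exp (- y) \<le> 1 - y + y\<^sup>2 / 2\<close>, which holds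
  because that polynomial times \<open>1 + y + y\<^sup>2 / 2\<close> is
  \<open>1 + y ^ 4 / 4\<close>, and \<open>exp y \<le> 1 + y + y\<^sup>2 * exp y\<close>.\<close>

lemma exp_sym_bound:
  assumes "0 \<le> (y::real)"
  shows "exp (- y) \<le> 2 - exp y + 3/2 * y\<^sup>2 * exp y"
proof -
  have q: "1 + y + y\<^sup>2 / 2 \<le> exp y" by (rule exp_lower_Taylor_quadratic[OF assms])
  have p: "1 + y + y\<^sup>2 / 2 > 0" using assms by (intro add_pos_nonneg) auto
  have "exp (- y) \<le> 1 / (1 + y + y\<^sup>2 / 2)"
    unfolding exp_minus inverse_eq_divide using q p by (intro divide_left_mono) auto
  also have "\<dots> \<le> 1 - y + y\<^sup>2 / 2"
  proof -
    have "(1 - y + y\<^sup>2 / 2) * (1 + y + y\<^sup>2 / 2) = 1 + y ^ 4 / 4"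
      by (simp add: field_simps power2_eq_square power4_eq_xxxx)
    then have "1 \<le> (1 - y + y\<^sup>2 / 2) * (1 + y + y\<^sup>2 / 2)" by simp
    then show ?thesis using p by (simp only: pos_divide_le_eq)
  qed
  finally have 1: "exp (- y) \<le> 1 - y + y\<^sup>2 / 2" .
  have "(1 - y) * (1 + y) \<le> exp (- y) * (1 + y)"
    using exp_ge_add_one_self[of "- y"] assms by (intro mult_right_mono) auto
  then have "exp y * ((1 - y) * (1 + y)) \<le> exp y * (exp (- y) * (1 + y))" by simp
  also have "\<dots> = 1 + y" by (simp add: exp_minus field_simps)
  finally have 2: "exp y \<le> 1 + y + y\<^sup>2 * exp y" by (simp add: algebra_simps power2_eq_square)
  have "y\<^sup>2 / 2 \<le> 1/2 * y\<^sup>2 * exp y" using assms by (simp add: mult_le_cancel_left1)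
  then show ?thesis using 1 2 by linarith
qed

text \<open>Doob's maximal inequality. The supermartingale property is asked for on the event that
  level \<open>a\<close> has not been reached yet. The quantity kept below the initial mean is
  \<open>a\<close> times the probability of having reached the level plus the mean over those paths
  that have not.\<close>

lemma (in prob_space) doob_maximal:
  fixes N :: "nat \<Rightarrow> 'a \<Rightarrow> ennreal"
  assumes [measurable]: "\<And>n. N n \<in> borel_measurable M"
    and step: "\<And>n. (\<integral>\<^sup>+\<omega>. N (Suc n) \<omega> * indicator {\<omega>\<in>space M. \<forall>i\<le>n. N i \<omega> < a} \<omega> \<partial>M)
      \<le> (\<integral>\<^sup>+\<omega>. N n \<omega> * indicator {\<omega>\<in>space M. \<forall>i\<le>n. N i \<omega> < a} \<omega> \<partial>M)"
  shows "a * emeasure M {\<omega>\<in>space M. \<exists>i\<le>n. a \<le> N i \<omega>} \<le> (\<integral>\<^sup>+\<omega>. N 0 \<omega> \<partial>M)"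
proof -
  define E where "E n = {\<omega>\<in>space M. \<exists>i\<le>n. a \<le> N i \<omega>}" for n
  define G where "G n = {\<omega>\<in>space M. \<forall>i\<le>n. N i \<omega> < a}" for n
  have [measurable]: "E n \<in> sets M" "G n \<in> sets M" for n unfolding E_def G_def by measurable
  have "a * emeasure M (E n) + (\<integral>\<^sup>+\<omega>. N n \<omega> * indicator (G n) \<omega> \<partial>M) \<le> (\<integral>\<^sup>+\<omega>. N 0 \<omega> \<partial>M)"
  proof (induction n)
    case 0
    have "a * emeasure M (E 0) + (\<integral>\<^sup>+\<omega>. N 0 \<omega> * indicator (G 0) \<omega> \<partial>M)
      = (\<integral>\<^sup>+\<omega>. a * indicator (E 0) \<omega> + N 0 \<omega> * indicator (G 0) \<omega> \<partial>M)"
      by (simp add: nn_integral_add nn_integral_cmult_indicator)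
    also have "\<dots> \<le> (\<integral>\<^sup>+\<omega>. N 0 \<omega> \<partial>M)"
      by (intro nn_integral_mono) (auto simp: E_def G_def indicator_def)
    finally show ?case .
  next
    case (Suc n)
    have "a * emeasure M (E (Suc n)) + (\<integral>\<^sup>+\<omega>. N (Suc n) \<omega> * indicator (G (Suc n)) \<omega> \<partial>M)
      = (\<integral>\<^sup>+\<omega>. a * indicator (E (Suc n)) \<omega> + N (Suc n) \<omega> * indicator (G (Suc n)) \<omega> \<partial>M)"
      by (simp add: nn_integral_add nn_integral_cmult_indicator)
    also have "\<dots> \<le> (\<integral>\<^sup>+\<omega>. a * indicator (E n) \<omega> + N (Suc n) \<omega> * indicator (G n) \<omega> \<partial>M)"
    proof (intro nn_integral_mono)
      fix \<omega> assume \<omega>: "\<omega> \<in> space M"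
      consider "\<exists>i\<le>n. a \<le> N i \<omega>" | "\<forall>i\<le>n. N i \<omega> < a" "a \<le> N (Suc n) \<omega>" | "\<forall>i\<le>n. N i \<omega> < a" "N (Suc n) \<omega> < a"
        by (meson not_le)
      then show "a * indicator (E (Suc n)) \<omega> + N (Suc n) \<omega> * indicator (G (Suc n)) \<omega>
        \<le> a * indicator (E n) \<omega> + N (Suc n) \<omega> * indicator (G n) \<omega>"
      proof cases
        case 1
        then have "\<omega> \<in> E n" "\<omega> \<in> E (Suc n)" "\<omega> \<notin> G n" "\<omega> \<notin> G (Suc n)"
          using \<omega> by (auto simp: E_def G_def not_less intro: le_SucI)
        then show ?thesis by simp
      next
        case 2
        then have "\<omega> \<notin> E n" "\<omega> \<in> E (Suc n)" "\<omega> \<in> G n" "\<omega> \<notin> G (Suc n)"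
          using \<omega> by (auto simp: E_def G_def not_less not_le)
        then show ?thesis using 2 by simp
      next
        case 3
        then have "\<omega> \<notin> E n" "\<omega> \<notin> E (Suc n)" "\<omega> \<in> G n" "\<omega> \<in> G (Suc n)"
          using \<omega> by (auto simp: E_def G_def not_less not_le le_Suc_eq)
        then show ?thesis by simp
      qed
    qed
    also have "\<dots> = a * emeasure M (E n) + (\<integral>\<^sup>+\<omega>. N (Suc n) \<omega> * indicator (G n) \<omega> \<partial>M)"
      by (simp add: nn_integral_add nn_integral_cmult_indicator)
    also have "\<dots> \<le> a * emeasure M (E n) + (\<integral>\<^sup>+\<omega>. N n \<omega> * indicator (G n) \<omega> \<partial>M)"
      using step[of n] by (intro add_left_mono) (simp add: G_def)
    finally show ?case using Suc.IH by (rule order_trans)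
  qed
  then have "a * emeasure M (E n) \<le> (\<integral>\<^sup>+\<omega>. N 0 \<omega> \<partial>M)"
    by (rule order_trans[rotated]) simp
  then show ?thesis by (simp add: E_def)
qed

text \<open>Hypothesis \<open>A\<close> expresses that the conditional expectation of
  \<open>g\<close> given \<open>G\<close> is at most \<open>c\<close>. The monotone class argument
  lets a nonnegative \<open>G\<close>-measurable factor be pulled out.\<close>

lemma nn_integral_subalgebra_bound:
  fixes Y :: "'a \<Rightarrow> ennreal"
  assumes G: "sets G \<subseteq> sets M" "space G = space M" and g [measurable]: "g \<in> borel_measurable M"
    and A: "\<And>A. A \<in> sets G \<Longrightarrow> (\<integral>\<^sup>+\<omega>. indicator A \<omega> * g \<omega> \<partial>M) \<le> c * emeasure M A"
    and Y: "Y \<in> borel_measurable G"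
  shows "(\<integral>\<^sup>+\<omega>. Y \<omega> * g \<omega> \<partial>M) \<le> c * (\<integral>\<^sup>+\<omega>. Y \<omega> \<partial>M)"
proof -
  have sub: "f \<in> borel_measurable M" if "f \<in> borel_measurable G" for f :: "'a \<Rightarrow> ennreal"
    using that G by (auto simp: measurable_def)
  show ?thesis
    using Y
  proof (induction rule: borel_measurable_induct)
    case (cong f h)
    have "(\<integral>\<^sup>+\<omega>. f \<omega> * g \<omega> \<partial>M) = (\<integral>\<^sup>+\<omega>. h \<omega> * g \<omega> \<partial>M)" "(\<integral>\<^sup>+\<omega>. f \<omega> \<partial>M) = (\<integral>\<^sup>+\<omega>. h \<omega> \<partial>M)"
      using cong(3) G by (auto intro!: nn_integral_cong)
    then show ?case using cong(4) by simp
  next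
    case (set B)
    then have "B \<in> sets M" using G by auto
    then show ?case using A[OF set] by simp
  next
    case (mult u b)
    note [measurable] = sub[OF mult(2)]
    have "(\<integral>\<^sup>+\<omega>. b * u \<omega> * g \<omega> \<partial>M) = b * (\<integral>\<^sup>+\<omega>. u \<omega> * g \<omega> \<partial>M)"
      by (simp add: nn_integral_cmult mult.assoc)
    also have "\<dots> \<le> b * (c * (\<integral>\<^sup>+\<omega>. u \<omega> \<partial>M))" using mult by (intro mult_left_mono) auto
    also have "\<dots> = c * (\<integral>\<^sup>+\<omega>. b * u \<omega> \<partial>M)" by (simp add: nn_integral_cmult mult_ac)
    finally show ?case .
  next
    case (add u v)
    note [measurable] = sub[OF add(1)] sub[OF add(3)]
    have "(\<integral>\<^sup>+\<omega>. (v \<omega> + u \<omega>) * g \<omega> \<partial>M) = (\<integral>\<^sup>+\<omega>. v \<omega> * g \<omega> \<partial>M) + (\<integral>\<^sup>+\<omega>. u \<omega> * g \<omega> \<partial>M)"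
      by (simp add: nn_integral_add distrib_right)
    also have "\<dots> \<le> c * (\<integral>\<^sup>+\<omega>. v \<omega> \<partial>M) + c * (\<integral>\<^sup>+\<omega>. u \<omega> \<partial>M)" using add by (intro add_mono) auto
    also have "\<dots> = c * (\<integral>\<^sup>+\<omega>. v \<omega> + u \<omega> \<partial>M)" by (simp add: nn_integral_add distrib_left)
    finally show ?case .
  next
    case (seq U)
    note [measurable] = sub[OF seq(1)]
    have inc: "incseq (\<lambda>i \<omega>. U i \<omega> * g \<omega>)"
      using \<open>incseq U\<close> by (auto simp: incseq_def le_fun_def intro!: mult_right_mono)
    have "(\<integral>\<^sup>+\<omega>. (SUP i. U i) \<omega> * g \<omega> \<partial>M) = (\<integral>\<^sup>+\<omega>. (SUP i. U i \<omega> * g \<omega>) \<partial>M)"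
      by (simp add: SUP_mult_right_ennreal image_comp)
    also have "\<dots> = (SUP i. \<integral>\<^sup>+\<omega>. U i \<omega> * g \<omega> \<partial>M)"
      by (rule nn_integral_monotone_convergence_SUP[OF inc]) simp
    also have "\<dots> \<le> (SUP i. c * (\<integral>\<^sup>+\<omega>. U i \<omega> \<partial>M))"
      by (intro SUP_mono' seq.IH)
    also have "\<dots> = c * (SUP i. \<integral>\<^sup>+\<omega>. U i \<omega> \<partial>M)" by (simp add: SUP_mult_left_ennreal)
    also have "(SUP i. \<integral>\<^sup>+\<omega>. U i \<omega> \<partial>M) = (\<integral>\<^sup>+\<omega>. (SUP i. U i \<omega>) \<partial>M)"
      by (rule nn_integral_monotone_convergence_SUP[OF \<open>incseq U\<close>, symmetric]) simp
    finally show ?case by (simp add: image_comp)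
  qed
qed

section \<open>Exponential moments of the durations and the law of the steps\<close>

context brownian_unbounded
begin

definition gap :: "nat \<Rightarrow> 'a \<Rightarrow> real" where
  "gap n \<omega> = \<tau> (Suc n) \<omega> - \<tau> n \<omega>"

lemma gap_pos: "\<omega> \<in> space M \<Longrightarrow> 0 < gap n \<omega>"
  using \<tau>_less by (simp add: gap_def)

lemma measurable_gap [measurable]: "gap n \<in> borel_measurable M"
  unfolding gap_def[abs_def] by measurable

text \<open>Until the next hit the path stays within distance 1 of \<open>R n\<close>, so the real
  part of the capped martingale is at least \<open>cos \<theta>\<close> times its exponential
  weight, and \<open>cos \<theta> > 0\<close>. This bounds the moments by
  \<open>1 / cos \<theta>\<close> for every cap \<open>K\<close>; Fatou gives integrability of the
  uncapped weight, which then dominates the passage to the limit in the identity.\<close>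

lemma exp_gap_identity:
  assumes A: "A \<in> sets (pre_sigma (\<tau> n))" and \<theta>: "0 \<le> \<theta>" "\<theta> < pi / 2"
  shows "integrable M (\<lambda>\<omega>. exp (\<theta>\<^sup>2 * gap n \<omega> / 2))"
    and "(\<integral>\<omega>. (if \<omega> \<in> A then iexp (\<theta> * (R (Suc n) \<omega> - R n \<omega>)) * of_real (exp (\<theta>\<^sup>2 * gap n \<omega> / 2)) else 0) \<partial>M)
        = of_real (prob A)"
proof -
  have AM [measurable]: "A \<in> sets M" using A sets_pre_sigma_subset[OF stopping_time_\<tau>] by auto
  define d where "d K \<omega> = min (real K) (\<tau> (Suc n) \<omega>) - min (real K) (\<tau> n \<omega>)" for K :: nat and \<omega>
  define x where "x K \<omega> = B (min (real K) (\<tau> (Suc n) \<omega>)) \<omega> - B (min (real K) (\<tau> n \<omega>)) \<omega>" for K :: nat and \<omega>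
  have [measurable]: "d K \<in> borel_measurable M" for K unfolding d_def by measurable
  have "(\<lambda>\<omega>. B (min (real K) (\<tau> k \<omega>)) \<omega>) \<in> borel_measurable M" for K k
    using measurable_F_imp[OF measurable_F_B_min_stopping[OF stopping_time_\<tau> \<tau>_nonneg, of "real K" k]]
    by (simp add: min.commute)
  then have [measurable]: "x K \<in> borel_measurable M" for K unfolding x_def by (intro borel_measurable_diff)
  have ident: "(\<integral>\<omega>. (if \<omega> \<in> A' then iexp (\<theta> * x K \<omega>) * of_real (exp (\<theta>\<^sup>2 * d K \<omega> / 2)) else 0) \<partial>M)
      = of_real (prob A')"
    if "A' \<in> sets (pre_sigma (\<tau> n))" for A' K
    unfolding x_def d_def
    by (rule optional_stopping[OF stopping_time_\<tau> \<tau>_nonneg stopping_time_\<tau> less_imp_le[OF \<tau>_less] that])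
  have d0: "0 \<le> d K \<omega>" "d K \<omega> \<le> gap n \<omega>" "d K \<omega> \<le> real K" if "\<omega> \<in> space M" for K \<omega>
    using \<tau>_less[OF that, of n] \<tau>_nonneg[OF that, of n] by (auto simp: d_def gap_def min_def)
  have x1: "\<bar>x K \<omega>\<bar> \<le> 1" if \<omega>: "\<omega> \<in> space M" for K \<omega>
  proof (cases "real K \<le> \<tau> n \<omega>")
    case True
    then show ?thesis using \<tau>_less[OF \<omega>, of n] by (simp add: x_def min_def)
  next
    case False
    show ?thesis
    proof (cases "real K < \<tau> (Suc n) \<omega>")
      case True
      then show ?thesis
        using False unbounded_continuous_path.hit_before[OF path[OF \<omega>], of n "real K"]
        by (auto simp: x_def min_def \<tau>_def)
    next
      case F: False
      then show ?thesis using False abs_R_step[OF \<omega>, of n] by (auto simp: x_def min_def R_def)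
    qed
  qed
  have ev: "\<forall>\<^sub>F K in sequentially. d K \<omega> = gap n \<omega> \<and> x K \<omega> = R (Suc n) \<omega> - R n \<omega>" if "\<omega> \<in> space M" for \<omega>
  proof -
    obtain K0 :: nat where K0: "\<tau> (Suc n) \<omega> < real K0" using reals_Archimedean2 by auto
    show ?thesis
      unfolding eventually_sequentially
    proof (intro exI[of _ K0] allI impI)
      fix K assume "K0 \<le> K"
      then have "\<tau> (Suc n) \<omega> \<le> real K" "\<tau> n \<omega> \<le> real K" using K0 \<tau>_less[OF that, of n] by linarith+
      then show "d K \<omega> = gap n \<omega> \<and> x K \<omega> = R (Suc n) \<omega> - R n \<omega>"
        by (simp add: d_def x_def gap_def R_def min_absorb2)
    qed
  qed
  have c0: "cos \<theta> > 0" using \<theta> by (intro cos_gt_zero_pi) auto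
  have le: "(\<integral>\<^sup>+\<omega>. ennreal (exp (\<theta>\<^sup>2 * d K \<omega> / 2)) \<partial>M) \<le> ennreal (1 / cos \<theta>)" for K
  proof -
    have i1: "integrable M (\<lambda>\<omega>. exp (\<theta>\<^sup>2 * d K \<omega> / 2))"
      by (rule integrable_const_bound[of _ "exp (\<theta>\<^sup>2 * real K / 2)"])
         (auto intro!: AE_I2 divide_right_mono mult_left_mono d0)
    have i2: "integrable M (\<lambda>\<omega>. iexp (\<theta> * x K \<omega>) * complex_of_real (exp (\<theta>\<^sup>2 * d K \<omega> / 2)))"
      by (rule integrable_const_bound[of _ "exp (\<theta>\<^sup>2 * real K / 2)"])
         (auto simp: norm_mult intro!: AE_I2 divide_right_mono mult_left_mono d0)
    have "space M \<in> sets (pre_sigma (\<tau> n))" using sets.top[of "pre_sigma (\<tau> n)"] by (simp add: space_pre_sigma)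
    from ident[OF this, of K]
    have "(\<integral>\<omega>. iexp (\<theta> * x K \<omega>) * complex_of_real (exp (\<theta>\<^sup>2 * d K \<omega> / 2)) \<partial>M) = 1"
      by (simp add: prob_space cong: Bochner_Integration.integral_cong)
    then have "(\<integral>\<omega>. Re (iexp (\<theta> * x K \<omega>) * complex_of_real (exp (\<theta>\<^sup>2 * d K \<omega> / 2))) \<partial>M) = 1"
      using integral_Re[OF i2] by simp
    moreover have "(\<integral>\<omega>. cos \<theta> * exp (\<theta>\<^sup>2 * d K \<omega> / 2) \<partial>M) \<le> (\<integral>\<omega>. Re (iexp (\<theta> * x K \<omega>) * complex_of_real (exp
        (\<theta>\<^sup>2 * d K \<omega> / 2))) \<partial>M)"
    proof (rule integral_mono[OF integrable_mult_right[OF i1] integrable_Re[OF i2]])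
      fix \<omega> assume \<omega>: "\<omega> \<in> space M"
      have "\<theta> * \<bar>x K \<omega>\<bar> \<le> \<theta>" using x1[OF \<omega>, of K] \<theta> by (simp add: mult_left_le)
      then have "cos \<theta> \<le> cos (\<theta> * \<bar>x K \<omega>\<bar>)" using \<theta> by (intro cos_monotone_0_pi_le) auto
      also have "\<dots> = cos (\<theta> * x K \<omega>)" by (cases "0 \<le> x K \<omega>") auto
      finally have "cos \<theta> \<le> cos (\<theta> * x K \<omega>)" .
      then show "cos \<theta> * exp (\<theta>\<^sup>2 * d K \<omega> / 2) \<le> Re (iexp (\<theta> * x K \<omega>) * complex_of_real (exp (\<theta>\<^sup>2 * d K \<omega> / 2)))"
        by (simp add: Re_exp)
    qed
    ultimately have "(\<integral>\<omega>. exp (\<theta>\<^sup>2 * d K \<omega> / 2) \<partial>M) \<le> 1 / cos \<theta>"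
      using c0 by (simp add: field_simps)
    then show ?thesis by (subst nn_integral_eq_integral[OF i1]) (auto intro: ennreal_leI)
  qed
  have "(\<integral>\<^sup>+\<omega>. ennreal (exp (\<theta>\<^sup>2 * gap n \<omega> / 2)) \<partial>M) = (\<integral>\<^sup>+\<omega>. liminf (\<lambda>K. ennreal (exp (\<theta>\<^sup>2 * d K \<omega> / 2))) \<partial>M)"
  proof (rule nn_integral_cong)
    fix \<omega> assume "\<omega> \<in> space M"
    then have "(\<lambda>K. ennreal (exp (\<theta>\<^sup>2 * d K \<omega> / 2))) \<longlonglongrightarrow> ennreal (exp (\<theta>\<^sup>2 * gap n \<omega> / 2))"
      by (intro tendsto_eventually eventually_mono[OF ev]) auto
    then show "ennreal (exp (\<theta>\<^sup>2 * gap n \<omega> / 2)) = liminf (\<lambda>K. ennreal (exp (\<theta>\<^sup>2 * d K \<omega> / 2)))"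
      by (rule lim_imp_Liminf[OF trivial_limit_sequentially, symmetric])
  qed
  also have "\<dots> \<le> liminf (\<lambda>K. \<integral>\<^sup>+\<omega>. ennreal (exp (\<theta>\<^sup>2 * d K \<omega> / 2)) \<partial>M)"
    by (rule nn_integral_liminf) measurable
  also have "\<dots> \<le> liminf (\<lambda>K::nat. ennreal (1 / cos \<theta>))"
    by (intro Liminf_mono always_eventually allI le)
  also have "\<dots> = ennreal (1 / cos \<theta>)" by (simp add: Liminf_const)
  finally have fin: "(\<integral>\<^sup>+\<omega>. ennreal (exp (\<theta>\<^sup>2 * gap n \<omega> / 2)) \<partial>M) \<le> ennreal (1 / cos \<theta>)" .
  show int: "integrable M (\<lambda>\<omega>. exp (\<theta>\<^sup>2 * gap n \<omega> / 2))"
    using fin by (intro integrableI_bounded) (auto simp: le_less_trans[OF fin])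
  define f where "f K \<omega> = (if \<omega> \<in> A then iexp (\<theta> * x K \<omega>) * of_real (exp (\<theta>\<^sup>2 * d K \<omega> / 2)) else 0)" for K \<omega>
  define g where "g \<omega> = (if \<omega> \<in> A then iexp (\<theta> * (R (Suc n) \<omega> - R n \<omega>)) * of_real (exp (\<theta>\<^sup>2 * gap n \<omega> / 2))
      else 0)" for \<omega>
  have "(\<lambda>K. \<integral>\<omega>. f K \<omega> \<partial>M) \<longlonglongrightarrow> (\<integral>\<omega>. g \<omega> \<partial>M)"
  proof (rule integral_dominated_convergence[OF _ _ int])
    show "g \<in> borel_measurable M" unfolding g_def by measurable
    show "f K \<in> borel_measurable M" for K unfolding f_def by measurable
    show "AE \<omega> in M. (\<lambda>K. f K \<omega>) \<longlonglongrightarrow> g \<omega>"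
      by (intro AE_I2 tendsto_eventually eventually_mono[OF ev]) (auto simp: f_def g_def)
    show "AE \<omega> in M. cmod (f K \<omega>) \<le> exp (\<theta>\<^sup>2 * gap n \<omega> / 2)" for K
      by (intro AE_I2) (auto simp: f_def norm_mult intro!: divide_right_mono mult_left_mono d0)
  qed
  moreover have "(\<integral>\<omega>. f K \<omega> \<partial>M) = of_real (prob A)" for K unfolding f_def by (rule ident[OF A])
  ultimately have "(\<lambda>K::nat. complex_of_real (prob A)) \<longlonglongrightarrow> (\<integral>\<omega>. g \<omega> \<partial>M)" by (simp only:)
  then have "(\<integral>\<omega>. g \<omega> \<partial>M) = of_real (prob A)" by (rule LIMSEQ_unique[OF _ tendsto_const])
  then show "(\<integral>\<omega>. (if \<omega> \<in> A then iexp (\<theta> * (R (Suc n) \<omega> - R n \<omega>)) * of_real (exp (\<theta>\<^sup>2 * gap n \<omega> / 2)) else 0)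
      \<partial>M) = of_real (prob A)"
    by (simp only: g_def)
qed

text \<open>The step is 1 or -1, so the exponential of the step has real part
  \<open>cos \<theta>\<close> and imaginary part \<open>sin \<theta>\<close> times the step.
  Comparing real and imaginary parts of the identity gives the two claims,
  \<open>sin \<theta>\<close> and \<open>cos \<theta>\<close> being nonzero.\<close>

lemma exp_gap_expectation:
  assumes A: "A \<in> sets (pre_sigma (\<tau> n))" and \<theta>: "0 < \<theta>" "\<theta> < pi / 2"
  shows "(\<integral>\<omega>. indicator A \<omega> * exp (\<theta>\<^sup>2 * gap n \<omega> / 2) \<partial>M) = prob A / cos \<theta>"
    and "(\<integral>\<omega>. indicator A \<omega> * ((R (Suc n) \<omega> - R n \<omega>) * exp (\<theta>\<^sup>2 * gap n \<omega> / 2)) \<partial>M) = 0"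
proof -
  have AM [measurable]: "A \<in> sets M" using A sets_pre_sigma_subset[OF stopping_time_\<tau>] by auto
  note ident = exp_gap_identity[OF A less_imp_le[OF \<theta>(1)] \<theta>(2)]
  define g where "g \<omega> = (if \<omega> \<in> A then iexp (\<theta> * (R (Suc n) \<omega> - R n \<omega>)) * of_real (exp (\<theta>\<^sup>2 * gap n \<omega> / 2))
      else 0)" for \<omega>
  have [measurable]: "g \<in> borel_measurable M" unfolding g_def by measurable
  have ig: "integrable M g"
    by (rule Bochner_Integration.integrable_bound[OF ident(1)]) (auto simp: g_def norm_mult)
  have Eg: "(\<integral>\<omega>. g \<omega> \<partial>M) = of_real (prob A)" using ident(2) by (simp only: g_def)
  have pm: "R (Suc n) \<omega> - R n \<omega> = 1 \<or> R (Suc n) \<omega> - R n \<omega> = - 1" if "\<omega> \<in> space M" for \<omega>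
    using abs_R_step[OF that, of n] by linarith
  have re: "Re (g \<omega>) = cos \<theta> * (indicator A \<omega> * exp (\<theta>\<^sup>2 * gap n \<omega> / 2))" if "\<omega> \<in> space M" for \<omega>
    using pm[OF that] by (auto simp: g_def Re_exp)
  have im: "Im (g \<omega>) = sin \<theta> * (indicator A \<omega> * ((R (Suc n) \<omega> - R n \<omega>) * exp (\<theta>\<^sup>2 * gap n \<omega> / 2)))"
      if "\<omega> \<in> space M" for \<omega>
    using pm[OF that] by (auto simp: g_def Im_exp)
  have c0: "cos \<theta> > 0" using \<theta> by (intro cos_gt_zero_pi) auto
  have s0: "sin \<theta> > 0" using \<theta> by (intro sin_gt_zero) auto
  have "prob A = (\<integral>\<omega>. Re (g \<omega>) \<partial>M)" using integral_Re[OF ig] Eg by simp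
  also have "\<dots> = (\<integral>\<omega>. cos \<theta> * (indicator A \<omega> * exp (\<theta>\<^sup>2 * gap n \<omega> / 2)) \<partial>M)"
    by (intro Bochner_Integration.integral_cong refl re)
  also have "\<dots> = cos \<theta> * (\<integral>\<omega>. indicator A \<omega> * exp (\<theta>\<^sup>2 * gap n \<omega> / 2) \<partial>M)" by simp
  finally show "(\<integral>\<omega>. indicator A \<omega> * exp (\<theta>\<^sup>2 * gap n \<omega> / 2) \<partial>M) = prob A / cos \<theta>"
    using c0 by (simp add: field_simps)
  have "0 = (\<integral>\<omega>. Im (g \<omega>) \<partial>M)" using integral_Im[OF ig] Eg by simp
  also have "\<dots> = (\<integral>\<omega>. sin \<theta> * (indicator A \<omega> * ((R (Suc n) \<omega> - R n \<omega>) * exp (\<theta>\<^sup>2 * gap n \<omega> / 2))) \<partial>M)"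
    by (intro Bochner_Integration.integral_cong refl im)
  also have "\<dots> = sin \<theta> * (\<integral>\<omega>. indicator A \<omega> * ((R (Suc n) \<omega> - R n \<omega>) * exp (\<theta>\<^sup>2 * gap n \<omega> / 2)) \<partial>M)" by simp
  finally show "(\<integral>\<omega>. indicator A \<omega> * ((R (Suc n) \<omega> - R n \<omega>) * exp (\<theta>\<^sup>2 * gap n \<omega> / 2)) \<partial>M) = 0"
    using s0 by simp
qed

lemma one_less_pi_half: "1 < pi / 2"
  using pi_gt3 by simp

text \<open>As \<open>\<theta>\<close> tends to 0 along \<open>1 / (k + 1)\<close>, the exponential
  weight tends to 1, dominated by the weight for \<open>\<theta> = 1\<close>. So the step has mean 0
  over \<open>A\<close>, and a variable with values 1 and -1 and mean 0 takes both with equal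
  weight.\<close>

lemma prob_R_step:
  assumes A: "A \<in> sets (pre_sigma (\<tau> n))" and s: "s = 1 \<or> s = - 1"
  shows "prob (A \<inter> {\<omega>\<in>space M. R (Suc n) \<omega> = R n \<omega> + s}) = prob A / 2"
proof -
  have AM [measurable]: "A \<in> sets M" using A sets_pre_sigma_subset[OF stopping_time_\<tau>] by auto
  define c where "c k = 1 / real (k + 1)" for k
  have c: "0 < c k" "c k \<le> 1" for k by (auto simp: c_def)
  have c1: "c k < pi / 2" for k using c(2)[of k] one_less_pi_half by linarith
  define f where "f k \<omega> = indicator A \<omega> * ((R (Suc n) \<omega> - R n \<omega>) * exp ((c k)\<^sup>2 * gap n \<omega> / 2))" for k \<omega>
  have int: "integrable M (\<lambda>\<omega>. exp (1\<^sup>2 * gap n \<omega> / 2))"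
    by (rule exp_gap_identity(1)[OF A _ one_less_pi_half]) simp
  have "(\<lambda>k. \<integral>\<omega>. f k \<omega> \<partial>M) \<longlonglongrightarrow> (\<integral>\<omega>. indicator A \<omega> * (R (Suc n) \<omega> - R n \<omega>) \<partial>M)"
  proof (rule integral_dominated_convergence[OF _ _ int])
    show "AE \<omega> in M. (\<lambda>k. f k \<omega>) \<longlonglongrightarrow> indicator A \<omega> * (R (Suc n) \<omega> - R n \<omega>)"
    proof (rule AE_I2)
      fix \<omega>
      have "c \<longlonglongrightarrow> 0" unfolding c_def using LIMSEQ_inverse_real_of_nat by (simp add: inverse_eq_divide add.commute)
      then have "(\<lambda>k. f k \<omega>) \<longlonglongrightarrow> indicator A \<omega> * ((R (Suc n) \<omega> - R n \<omega>) * exp (0\<^sup>2 * gap n \<omega> / 2))"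
        unfolding f_def by (intro tendsto_intros) auto
      then show "(\<lambda>k. f k \<omega>) \<longlonglongrightarrow> indicator A \<omega> * (R (Suc n) \<omega> - R n \<omega>)" by simp
    qed
    show "AE \<omega> in M. norm (f k \<omega>) \<le> exp (1\<^sup>2 * gap n \<omega> / 2)" for k
    proof (rule AE_I2)
      fix \<omega> assume \<omega>: "\<omega> \<in> space M"
      have "(c k)\<^sup>2 \<le> 1\<^sup>2" using c[of k] by (intro power_mono) auto
      then have "exp ((c k)\<^sup>2 * gap n \<omega> / 2) \<le> exp (1\<^sup>2 * gap n \<omega> / 2)"
        using gap_pos[OF \<omega>, of n] by (simp add: divide_right_mono mult_right_mono)
      then show "norm (f k \<omega>) \<le> exp (1\<^sup>2 * gap n \<omega> / 2)"
        using abs_R_step[OF \<omega>, of n] by (simp add: f_def abs_mult indicator_def)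
    qed
  qed (auto simp: f_def)
  moreover have "(\<integral>\<omega>. f k \<omega> \<partial>M) = 0" for k unfolding f_def by (rule exp_gap_expectation(2)[OF A c(1) c1])
  ultimately have "(\<lambda>k::nat. 0::real) \<longlonglongrightarrow> (\<integral>\<omega>. indicator A \<omega> * (R (Suc n) \<omega> - R n \<omega>) \<partial>M)" by (simp only:)
  then have 0: "(\<integral>\<omega>. indicator A \<omega> * (R (Suc n) \<omega> - R n \<omega>) \<partial>M) = 0" by (rule LIMSEQ_unique[OF _ tendsto_const])
  define E where "E = A \<inter> {\<omega>\<in>space M. R (Suc n) \<omega> = R n \<omega> + s}"
  have [measurable]: "E \<in> sets M" unfolding E_def by measurable
  have "indicator A \<omega> * (R (Suc n) \<omega> - R n \<omega>) = s * (2 * indicator E \<omega> - indicator A \<omega>)" if "\<omega> \<in> space M" for \<omega>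
    using abs_R_step[OF that, of n] s that by (auto simp: E_def indicator_def)
  then have "0 = (\<integral>\<omega>. s * (2 * indicator E \<omega> - indicator A \<omega>) \<partial>M)"
    unfolding 0[symmetric] by (intro Bochner_Integration.integral_cong refl)
  also have "\<dots> = s * (2 * prob E - prob A)"
    using sets.sets_into_space[of E M] sets.sets_into_space[of A M] by (simp add: Int_absorb2 less_top[symmetric])
  finally show ?thesis using s by (auto simp: E_def)
qed

text \<open>With \<open>\<theta> = sqrt (2 * l)\<close> the weight of the martingale is
  \<open>exp (l * gap n \<omega>)\<close>. For \<open>s = 1\<close> the bound is
  \<open>1 / cos \<theta> \<le> 1 + l + 4 * l\<^sup>2\<close>; for \<open>s = - 1\<close> it follows
  from \<open>1 / cos \<theta> \<ge> 1 + l\<close> through \<open>exp_sym_bound\<close>. The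
  constant is 48 * 24 / 11, rounded up to 105.\<close>

lemma mgf_gap:
  assumes A: "A \<in> sets (pre_sigma (\<tau> n))" and l: "0 < l" "l \<le> 1 / 4" and s: "s = 1 \<or> s = - 1"
  shows "(\<integral>\<^sup>+\<omega>. indicator A \<omega> * ennreal (exp (s * (l * (gap n \<omega> - 1)))) \<partial>M) \<le> ennreal (exp (105 * l\<^sup>2)) *
      emeasure M A"
proof -
  have AM [measurable]: "A \<in> sets M" using A sets_pre_sigma_subset[OF stopping_time_\<tau>] by auto
  define \<theta> where "\<theta> = sqrt (2 * l)"
  have \<theta>2: "\<theta>\<^sup>2 = 2 * l" using l by (simp add: \<theta>_def)
  have \<theta>: "0 < \<theta>" using l by (simp add: \<theta>_def)
  have "\<theta>\<^sup>2 \<le> 1\<^sup>2" using l by (simp add: \<theta>2)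
  then have "\<theta> \<le> 1" by (rule power2_le_imp_le) simp
  then have \<theta>': "\<theta> < pi / 2" using one_less_pi_half by linarith
  have \<theta>4: "\<theta> ^ 4 = 4 * l\<^sup>2" using power_mult[of \<theta> 2 2] by (simp add: \<theta>2 power_mult_distrib)
  have c: "1 - l - l\<^sup>2 / 6 \<le> cos \<theta>" "cos \<theta> \<le> 1 - l + l\<^sup>2 / 6"
    using cos_quadratic_bounds[of \<theta>] by (simp_all add: \<theta>2 \<theta>4)
  have l2: "l\<^sup>2 \<le> l / 4" using l by (simp add: power2_eq_square)
  have c0: "cos \<theta> > 0" using c l l2 by linarith
  have up: "1 / cos \<theta> \<le> 1 + l + 4 * l\<^sup>2"
  proof -
    have e: "(1 + l + 4 * l\<^sup>2) * (1 - l - l\<^sup>2 / 6) = 1 + l\<^sup>2 * (17/6 - 25/6 * l - 2/3 * l\<^sup>2)"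
      by (simp add: field_simps power2_eq_square)
    have "0 \<le> 17/6 - 25/6 * l - 2/3 * l\<^sup>2" using l l2 by linarith
    then have "1 \<le> (1 + l + 4 * l\<^sup>2) * (1 - l - l\<^sup>2 / 6)" unfolding e by simp
    also have "\<dots> \<le> (1 + l + 4 * l\<^sup>2) * cos \<theta>" using c l by (intro mult_left_mono) auto
    finally show ?thesis using c0 by (simp add: pos_divide_le_eq)
  qed
  have lo: "1 + l \<le> 1 / cos \<theta>"
  proof -
    have "(1 + l) * cos \<theta> \<le> (1 + l) * (1 - l + l\<^sup>2 / 6)" using c l by (intro mult_left_mono) auto
    also have "\<dots> = 1 - l\<^sup>2 * (5/6 - l / 6)" by (simp add: field_simps power2_eq_square)
    also have "\<dots> \<le> 1" using l by simp
    finally show ?thesis using c0 by (simp add: pos_le_divide_eq)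
  qed
  have E: "(\<integral>\<omega>. indicator A \<omega> * exp (l * gap n \<omega>) \<partial>M) = prob A / cos \<theta>"
    using exp_gap_expectation(1)[OF A \<theta> \<theta>'] by (simp add: \<theta>2)
  have i0: "integrable M (\<lambda>\<omega>. exp (l * gap n \<omega>))"
    using exp_gap_identity(1)[OF A less_imp_le[OF \<theta>] \<theta>'] by (simp add: \<theta>2)
  have i: "integrable M (\<lambda>\<omega>. indicator A \<omega> * exp (l * gap n \<omega>))"
    by (rule Bochner_Integration.integrable_bound[OF i0]) (auto simp: indicator_def)
  have E1: "(\<integral>\<omega>. indicator A \<omega> * exp (gap n \<omega> / 2) \<partial>M) = prob A / cos 1"
    using exp_gap_expectation(1)[OF A _ one_less_pi_half] by simp
  have j0: "integrable M (\<lambda>\<omega>. exp (gap n \<omega> / 2))"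
    using exp_gap_identity(1)[OF A _ one_less_pi_half] by simp
  have j: "integrable M (\<lambda>\<omega>. indicator A \<omega> * exp (gap n \<omega> / 2))"
    by (rule Bochner_Integration.integrable_bound[OF j0]) (auto simp: indicator_def)
  \<comment> \<open>The quadratic error in the case \<open>s = - 1\<close> is controlled by the
    moment for \<open>\<theta> = 1\<close>: \<open>1 - 1/2 - 1/24 = 11/24\<close>.\<close>
  have "cos 1 \<ge> (11/24::real)" using cos_quadratic_bounds(1)[of 1] by simp
  then have "prob A / cos 1 \<le> prob A / (11/24)" by (intro divide_left_mono) auto
  then have E1': "(\<integral>\<omega>. indicator A \<omega> * exp (gap n \<omega> / 2) \<partial>M) \<le> 24/11 * prob A" by (simp add: E1)
  have main: "(\<integral>\<omega>. indicator A \<omega> * exp (s * (l * (gap n \<omega> - 1))) \<partial>M) \<le> exp (105 * l\<^sup>2) * prob A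
    \<and> integrable M (\<lambda>\<omega>. indicator A \<omega> * exp (s * (l * (gap n \<omega> - 1))))"
    using s
  proof
    assume s: "s = 1"
    have eq: "indicator A \<omega> * exp (s * (l * (gap n \<omega> - 1))) = exp (- l) * (indicator A \<omega> * exp (l * gap n \<omega>))" for \<omega>
      by (simp add: s right_diff_distrib exp_diff exp_minus field_simps)
    have "(\<integral>\<omega>. indicator A \<omega> * exp (s * (l * (gap n \<omega> - 1))) \<partial>M) = exp (- l) * (prob A * (1 / cos \<theta>))"
      unfolding eq by (simp add: E)
    also have "\<dots> \<le> exp (- l) * (prob A * exp (l + 4 * l\<^sup>2))"
    proof -
      have "1 / cos \<theta> \<le> exp (l + 4 * l\<^sup>2)" using up exp_ge_add_one_self[of "l + 4 * l\<^sup>2"] by linarith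
      then show ?thesis by (intro mult_left_mono) auto
    qed
    also have "\<dots> = exp (4 * l\<^sup>2) * prob A" by (simp add: exp_add exp_minus field_simps)
    also have "\<dots> \<le> exp (105 * l\<^sup>2) * prob A" by (intro mult_right_mono) auto
    finally show ?thesis unfolding eq using i by simp
  next
    assume s: "s = - 1"
    have eq: "indicator A \<omega> * exp (s * (l * (gap n \<omega> - 1))) = exp l * (indicator A \<omega> * exp (- (l * gap n \<omega>)))" for \<omega>
      by (simp add: s algebra_simps exp_diff exp_minus field_simps)
    have k: "integrable M (\<lambda>\<omega>. indicator A \<omega> * exp (- (l * gap n \<omega>)))"
      by (rule integrable_const_bound[of _ 1]) (use l in \<open>auto simp: indicator_def intro!: AE_I2
          mult_nonneg_nonneg less_imp_le[OF gap_pos]\<close>)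
    have iA: "integrable M (indicator A :: 'a \<Rightarrow> real)" by (simp add: less_top[symmetric])
    have k2: "integrable M (\<lambda>\<omega>. 2 * indicator A \<omega> - indicator A \<omega> * exp (l * gap n \<omega>) + 48 * l\<^sup>2 * (indicator A
        \<omega> * exp (gap n \<omega> / 2)))"
      by (intro Bochner_Integration.integrable_add Bochner_Integration.integrable_diff integrable_mult_right iA i j)
    have "(\<integral>\<omega>. indicator A \<omega> * exp (- (l * gap n \<omega>)) \<partial>M) \<le>
      (\<integral>\<omega>. 2 * indicator A \<omega> - indicator A \<omega> * exp (l * gap n \<omega>) + 48 * l\<^sup>2 * (indicator A \<omega> * exp (gap n \<omega> / 2)) \<partial>M)"
    proof (rule integral_mono[OF k k2])
      fix \<omega> assume \<omega>: "\<omega> \<in> space M"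
      define D where "D = gap n \<omega>"
      have D: "D > 0" using gap_pos[OF \<omega>] by (simp add: D_def)
      \<comment> \<open>The exponent \<open>1/2\<close> available for \<open>\<theta> = 1\<close> is
        shared: one quarter absorbs \<open>D\<^sup>2\<close>, at the cost of the factor 32, the
        other absorbs \<open>exp (l * D)\<close> because \<open>l \<le> 1/4\<close>. Then 3/2 * 32 =
        48.\<close>
      have "(D / 4)\<^sup>2 / 2 \<le> exp (D / 4)" using exp_lower_Taylor_quadratic[of "D / 4"] D by simp
      then have D2: "D\<^sup>2 \<le> 32 * exp (D / 4)" by (simp add: power2_eq_square)
      have "l * D \<le> D / 4" using l D by simp
      then have "exp (l * D) \<le> exp (D / 4)" by simp
      then have "D\<^sup>2 * exp (l * D) \<le> (32 * exp (D / 4)) * exp (D / 4)" using D2 by (intro mult_mono) auto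
      also have "\<dots> = 32 * exp (D / 2)" by (simp add: exp_add[symmetric])
      finally have "3/2 * l\<^sup>2 * (D\<^sup>2 * exp (l * D)) \<le> 3/2 * l\<^sup>2 * (32 * exp (D / 2))" by (intro mult_left_mono) auto
      moreover have "exp (- (l * D)) \<le> 2 - exp (l * D) + 3/2 * (l * D)\<^sup>2 * exp (l * D)"
        using l D by (intro exp_sym_bound) simp
      moreover have "3/2 * l\<^sup>2 * (32 * exp (D / 2)) = 48 * l\<^sup>2 * exp (D / 2)" by simp
      moreover have "3/2 * (l * D)\<^sup>2 * exp (l * D) = 3/2 * l\<^sup>2 * (D\<^sup>2 * exp (l * D))"
          by (simp add: power_mult_distrib)
      ultimately have "exp (- (l * D)) \<le> 2 - exp (l * D) + 48 * l\<^sup>2 * exp (D / 2)" by linarith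
      then show "indicator A \<omega> * exp (- (l * gap n \<omega>)) \<le> 2 * indicator A \<omega> - indicator A \<omega> * exp (l * gap n \<omega>)
          + 48 * l\<^sup>2 * (indicator A \<omega> * exp (gap n \<omega> / 2))"
        by (simp add: indicator_def D_def)
    qed
    also have "\<dots> = 2 * prob A - prob A / cos \<theta> + 48 * l\<^sup>2 * (\<integral>\<omega>. indicator A \<omega> * exp (gap n \<omega> / 2) \<partial>M)"
      using iA i j sets.sets_into_space[OF AM] by (simp add: E Int_absorb2)
    also have "\<dots> \<le> 2 * prob A - prob A * (1 + l) + 48 * l\<^sup>2 * (24/11 * prob A)"
      using mult_left_mono[OF lo, of "prob A"] E1' by (intro add_mono diff_mono mult_left_mono) auto
    also have "\<dots> \<le> prob A * (1 + (- l + 105 * l\<^sup>2))" by (simp add: algebra_simps)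
    also have "\<dots> \<le> prob A * exp (- l + 105 * l\<^sup>2)" by (intro mult_left_mono exp_ge_add_one_self) auto
    finally have "exp l * (\<integral>\<omega>. indicator A \<omega> * exp (- (l * gap n \<omega>)) \<partial>M) \<le> exp l * (prob A * exp (- l + 105 * l\<^sup>2))"
      by (intro mult_left_mono) auto
    also have "exp l * (prob A * exp (- l + 105 * l\<^sup>2)) = (exp l * exp (- l + 105 * l\<^sup>2)) * prob A" by simp
    also have "exp l * exp (- l + 105 * l\<^sup>2) = exp (105 * l\<^sup>2)" unfolding exp_add[symmetric] by simp
    finally show ?thesis unfolding eq using k by simp
  qed
  have "(\<integral>\<^sup>+\<omega>. indicator A \<omega> * ennreal (exp (s * (l * (gap n \<omega> - 1)))) \<partial>M) = (\<integral>\<^sup>+\<omega>. ennreal (indicator A \<omega> *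
      exp (s * (l * (gap n \<omega> - 1)))) \<partial>M)"
    by (intro nn_integral_cong) (auto simp: indicator_def)
  also have "\<dots> = ennreal (\<integral>\<omega>. indicator A \<omega> * exp (s * (l * (gap n \<omega> - 1))) \<partial>M)"
    using main by (intro nn_integral_eq_integral) auto
  also have "\<dots> \<le> ennreal (exp (105 * l\<^sup>2) * prob A)" using main by (intro ennreal_leI) auto
  also have "\<dots> = ennreal (exp (105 * l\<^sup>2)) * emeasure M A" by (simp add: ennreal_mult' emeasure_eq_measure)
  finally show ?thesis .
qed

end

section \<open>Iterated-logarithm bound for the stopping times\<close>

context brownian_unbounded
begin

text \<open>Doob's inequality for the supermartingale
  \<open>exp (s * (l * (\<tau> i - i)) - 105 * l\<^sup>2 * i)\<close>. The term
  \<open>105 * l * n\<close> in the threshold absorbs the compensator for all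
  \<open>i \<le> n\<close>.\<close>

lemma deviation_\<tau>:
  assumes l: "0 < l" "l \<le> 1 / 4" and s: "s = 1 \<or> s = - 1"
  shows "prob {\<omega>\<in>space M. \<exists>i\<le>n. c + 105 * l * real n \<le> s * (\<tau> i \<omega> - real i)} \<le> exp (- (l * c))"
proof -
  define N where "N i \<omega> = ennreal (exp (s * (l * (\<tau> i \<omega> - real i)) - 105 * l\<^sup>2 * real i))" for i \<omega>
  define a where "a = ennreal (exp (l * c))"
  have [measurable]: "N i \<in> borel_measurable M" for i unfolding N_def by measurable
  have NF: "N i \<in> borel_measurable (pre_sigma (\<tau> k))" if "i \<le> k" for i k
  proof -
    have [measurable]: "\<tau> i \<in> borel_measurable (pre_sigma (\<tau> k))"
      by (rule measurable_pre_sigma_\<tau>_mono[OF measurable_pre_sigma_\<tau> that])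
    show ?thesis unfolding N_def by measurable
  qed
  have NS: "N (Suc k) \<omega> = ennreal (exp (- (105 * l\<^sup>2))) * (N k \<omega> * ennreal (exp (s * (l * (gap k \<omega> - 1)))))" for k \<omega>
    unfolding N_def gap_def
    by (simp add: ennreal_mult'[symmetric] exp_add[symmetric] algebra_simps)
  have step: "(\<integral>\<^sup>+\<omega>. N (Suc k) \<omega> * indicator {\<omega>\<in>space M. \<forall>i\<le>k. N i \<omega> < a} \<omega> \<partial>M)
      \<le> (\<integral>\<^sup>+\<omega>. N k \<omega> * indicator {\<omega>\<in>space M. \<forall>i\<le>k. N i \<omega> < a} \<omega> \<partial>M)" for k
  proof -
    define G where "G = {\<omega>\<in>space M. \<forall>i\<le>k. N i \<omega> < a}"
    define Y where "Y \<omega> = N k \<omega> * indicator G \<omega>" for \<omega>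
    have "G = {\<omega>\<in>space (pre_sigma (\<tau> k)). \<forall>i\<in>{..k}. N i \<omega> < a}" by (auto simp: G_def space_pre_sigma)
    also have "\<dots> \<in> sets (pre_sigma (\<tau> k))"
      using NF by (intro sets.sets_Collect_finite_All') (auto intro!: borel_measurable_less)
    finally have GF: "G \<in> sets (pre_sigma (\<tau> k))" .
    have YF: "Y \<in> borel_measurable (pre_sigma (\<tau> k))"
      unfolding Y_def using NF[of k k] GF by measurable
    note [measurable] = measurable_pre_sigma_imp[OF stopping_time_\<tau> YF]
    have "(\<integral>\<^sup>+\<omega>. N (Suc k) \<omega> * indicator G \<omega> \<partial>M)
      = (\<integral>\<^sup>+\<omega>. ennreal (exp (- (105 * l\<^sup>2))) * (Y \<omega> * ennreal (exp (s * (l * (gap k \<omega> - 1))))) \<partial>M)"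
      by (intro nn_integral_cong) (simp add: NS Y_def mult_ac)
    also have "\<dots> = ennreal (exp (- (105 * l\<^sup>2))) * (\<integral>\<^sup>+\<omega>. Y \<omega> * ennreal (exp (s * (l * (gap k \<omega> - 1)))) \<partial>M)"
      by (rule nn_integral_cmult) measurable
    also have "\<dots> \<le> ennreal (exp (- (105 * l\<^sup>2))) * (ennreal (exp (105 * l\<^sup>2)) * (\<integral>\<^sup>+\<omega>. Y \<omega> \<partial>M))"
      by (intro mult_left_mono nn_integral_subalgebra_bound[OF sets_pre_sigma_subset[OF stopping_time_\<tau>]
          space_pre_sigma _ _ YF]
            mgf_gap[OF _ l s]) auto
    also have "\<dots> = (\<integral>\<^sup>+\<omega>. Y \<omega> \<partial>M)"
      unfolding mult.assoc[symmetric] by (simp add: ennreal_mult'[symmetric] exp_add[symmetric])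
    finally show ?thesis by (simp add: G_def Y_def)
  qed
  have N0: "(\<integral>\<^sup>+\<omega>. N 0 \<omega> \<partial>M) = 1"
    by (simp add: N_def \<tau>_def emeasure_space_1)
  define E where "E = {\<omega>\<in>space M. \<exists>i\<le>n. a \<le> N i \<omega>}"
  have [measurable]: "E \<in> sets M" unfolding E_def by measurable
  have "a * emeasure M E \<le> 1"
    using doob_maximal[of N a n, OF _ step] unfolding N0 E_def by simp
  then have "ennreal (exp (l * c) * prob E) \<le> ennreal 1"
    by (simp add: a_def emeasure_eq_measure ennreal_mult'')
  then have "exp (l * c) * prob E \<le> 1" by simp
  then have "prob E \<le> exp (- (l * c))" by (simp add: exp_minus field_simps)
  moreover have "{\<omega>\<in>space M. \<exists>i\<le>n. c + 105 * l * real n \<le> s * (\<tau> i \<omega> - real i)} \<subseteq> E"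
  proof safe
    fix \<omega> i assume \<omega>: "\<omega> \<in> space M" and i: "i \<le> n" "c + 105 * l * real n \<le> s * (\<tau> i \<omega> - real i)"
    have "105 * l * real i \<le> 105 * l * real n" using i l by (intro mult_left_mono) auto
    then have "c + 105 * l * real i \<le> s * (\<tau> i \<omega> - real i)" using i by linarith
    then have "l * (c + 105 * l * real i) \<le> l * (s * (\<tau> i \<omega> - real i))" using l by (intro mult_left_mono) auto
    then have "l * c \<le> s * (l * (\<tau> i \<omega> - real i)) - 105 * l\<^sup>2 * real i" by (simp add: algebra_simps power2_eq_square)
    then have "a \<le> N i \<omega>" unfolding a_def N_def by (intro ennreal_leI) simp
    then show "\<omega> \<in> E" using \<omega> i by (auto simp: E_def)
  qed
  then have "prob {\<omega>\<in>space M. \<exists>i\<le>n. c + 105 * l * real n \<le> s * (\<tau> i \<omega> - real i)} \<le> prob E"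
    by (intro finite_measure_mono) auto
  ultimately show ?thesis by linarith
qed

text \<open>Take \<open>l = v k / 2 ^ k\<close> and \<open>c = 2 * v k\<close> in the deviation
  bound. The threshold becomes \<open>(2 + 105) * v k\<close>, the exponent \<open>2 * ln k\<close>,
  and the probabilities \<open>1 / k\<^sup>2\<close> are summable. For \<open>k \<ge> 8\<close> one
  has \<open>16 * k \<le> 2 ^ k\<close>, which gives \<open>l \<le> 1/4\<close>.\<close>

lemma AE_\<tau>_dyadic:
  "AE \<omega> in M. \<forall>\<^sub>F k in sequentially. \<forall>i\<le>2 ^ k. \<bar>\<tau> i \<omega> - real i\<bar> \<le> 107 * sqrt (2 ^ k * ln (real k))"
proof -
  define v where "v k = sqrt (2 ^ k * ln (real k))" for k :: nat
  define A where "A s k = {\<omega>\<in>space M. \<exists>i\<le>2 ^ k. 107 * v k \<le> s * (\<tau> i \<omega> - real i)}" for s :: real and k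
  have [measurable]: "A s k \<in> sets M" for s k unfolding A_def by measurable
  have PA: "prob (A s k) \<le> 1 / (real k)\<^sup>2" if k: "8 \<le> k" and s: "s = 1 \<or> s = - 1" for s k
  proof -
    have lnk: "ln (real k) > 0" using k by simp
    have v: "v k > 0" "(v k)\<^sup>2 = 2 ^ k * ln (real k)" using lnk by (auto simp: v_def)
    define l where "l = v k / 2 ^ k"
    have k16: "16 * k \<le> 2 ^ k" using k by (induction k rule: dec_induct) auto
    have "ln (real k) \<le> real k" using ln_le_minus_one[of "real k"] k by simp
    moreover have "16 * real k \<le> 2 ^ k" using k16 by (metis of_nat_le_iff of_nat_mult of_nat_numeral of_nat_power)
    ultimately have "16 * ln (real k) \<le> 2 ^ k" by linarith
    then have "2 ^ k * ln (real k) \<le> 2 ^ k * (2 ^ k / 16)" by (intro mult_left_mono) auto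
    also have "2 ^ k * (2 ^ k / 16) = (2 ^ k / 4 :: real)\<^sup>2" by (simp add: power2_eq_square)
    finally have "(v k)\<^sup>2 \<le> (2 ^ k / 4)\<^sup>2" by (simp only: v(2))
    then have "v k \<le> 2 ^ k / 4" by (rule power2_le_imp_le) simp
    then have l: "0 < l" "l \<le> 1 / 4" using v(1) by (auto simp: l_def field_simps)
    have "2 * v k + 105 * l * real (2 ^ k) = 107 * v k" by (simp add: l_def)
    then have "prob (A s k) \<le> exp (- (l * (2 * v k)))"
      using deviation_\<tau>[OF l s, of "2 ^ k" "2 * v k"] by (simp only: A_def)
    also have "l * (2 * v k) = 2 * ln (real k)"
      using v(2) by (simp add: l_def power2_eq_square field_simps)
    also have "exp (- (2 * ln (real k))) = 1 / (real k)\<^sup>2"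
      using k by (simp add: exp_minus exp_double[of "ln (real k)", simplified] inverse_eq_divide)
    finally show ?thesis .
  qed
  have ev: "AE \<omega> in M. \<forall>\<^sub>F k in sequentially. \<omega> \<in> space M - A s k" if s: "s = 1 \<or> s = - 1" for s
  proof (rule borel_cantelli_AE1)
    show "summable (\<lambda>k. prob (A s k))"
      by (rule summable_comparison_test'[OF inverse_power_summable[of 2], where N=8])
         (use PA[OF _ s] in \<open>auto simp: inverse_eq_divide\<close>)
  qed (auto simp: less_top[symmetric])
  show ?thesis
    using ev[of 1, simplified] ev[of "- 1", simplified] AE_space
  proof eventually_elim
    case (elim \<omega>)
    note \<omega> = elim(3)
    from elim(1,2) show ?case
    proof eventually_elim
      case (elim k)
      show ?case
      proof (intro allI impI)
        fix i :: nat assume i: "i \<le> 2 ^ k"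
        have "\<omega> \<notin> A 1 k" "\<omega> \<notin> A (- 1) k" "\<omega> \<in> space M" using elim \<omega> by auto
        then have "\<not> 107 * v k \<le> 1 * (\<tau> i \<omega> - real i)" "\<not> 107 * v k \<le> - 1 * (\<tau> i \<omega> - real i)"
          using i unfolding A_def by blast+
        then show "\<bar>\<tau> i \<omega> - real i\<bar> \<le> 107 * sqrt (2 ^ k * ln (real k))"
          unfolding v_def by (simp add: not_le abs_le_iff less_imp_le)
      qed
    qed
  qed
qed

text \<open>With \<open>2 ^ (k - 1) \<le> n < 2 ^ k\<close> one has
  \<open>2 ^ k \<le> 2 * n\<close>, and \<open>k \<le> 3 * ln n \<le> (ln n)\<^sup>2\<close> gives
  \<open>ln k \<le> 2 * ln (ln n)\<close>. So the root grows by at most the factor 2, and 214 = 2 *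
  107. The bound \<open>n \<ge> 32\<close> ensures \<open>ln n \<ge> 3\<close>.\<close>

lemma AE_\<tau>_lil:
  "AE \<omega> in M. \<forall>\<^sub>F n in sequentially. \<bar>\<tau> n \<omega> - real n\<bar> \<le> 214 * sqrt (real n * ln (ln (real n)))"
  using AE_\<tau>_dyadic
proof eventually_elim
  case (elim \<omega>)
  then obtain k0 where k0: "\<And>k i. k0 \<le> k \<Longrightarrow> i \<le> 2 ^ k \<Longrightarrow> \<bar>\<tau> i \<omega> - real i\<bar> \<le> 107 * sqrt (2 ^ k * ln (real k))"
    by (auto simp: eventually_sequentially)
  show ?case
    unfolding eventually_sequentially
  proof (intro exI[of _ "max 32 (2 ^ k0)"] allI impI)
    fix n :: nat assume n: "max 32 (2 ^ k0) \<le> n"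
    obtain j where j: "2 ^ j \<le> n" "n < 2 ^ (j + 1)" using ex_power_ivl1[of 2 n] n by auto
    define k where "k = j + 1"
    have "2 ^ k0 < (2::nat) ^ k" using n j(2) by (simp add: k_def)
    then have "k0 \<le> k" by (simp add: less_imp_le)
    have n0: "real n \<ge> 32" using n by simp
    have l2: "ln 2 \<ge> (2/3::real)" by (rule ln2_ge_two_thirds)
    have "ln (real n) \<ge> ln (2 ^ 5)" using n0 by (intro ln_mono) auto
    moreover have "ln (2 ^ 5) = 5 * ln (2::real)" by (subst ln_realpow) auto
    ultimately have ln3: "ln (real n) \<ge> 3" using l2 by linarith
    have "real (2 ^ j) \<le> real n" using j(1) by (simp only: of_nat_le_iff)
    then have "ln (2 ^ j) \<le> ln (real n)" using n0 by (intro ln_mono) auto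
    then have jl: "real j * ln 2 \<le> ln (real n)" by (simp add: ln_realpow)
    have "real j * (2/3) \<le> real j * ln 2" using l2 by (intro mult_left_mono) auto
    then have "real k \<le> 2 * ln (real n) + 1" using jl ln3 by (simp add: k_def)
    also have "\<dots> \<le> 3 * ln (real n)" using ln3 by simp
    also have "\<dots> \<le> (ln (real n))\<^sup>2" using ln3 by (simp add: power2_eq_square)
    finally have "real k \<le> (ln (real n))\<^sup>2" .
    then have "ln (real k) \<le> ln ((ln (real n))\<^sup>2)" using ln3 by (intro ln_mono) (auto simp: k_def)
    also have "\<dots> = 2 * ln (ln (real n))" using ln3 by (simp add: ln_realpow)
    finally have lk: "ln (real k) \<le> 2 * ln (ln (real n))" .
    have "(2::nat) ^ k \<le> 2 * n" using j by (simp add: k_def)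
    then have "real (2 ^ k) \<le> real (2 * n)" by (simp only: of_nat_le_iff)
    then have "2 ^ k \<le> 2 * real n" by simp
    then have "2 ^ k * ln (real k) \<le> (2 * real n) * (2 * ln (ln (real n)))"
      using lk by (intro mult_mono) (auto simp: k_def)
    then have "sqrt (2 ^ k * ln (real k)) \<le> sqrt (4 * (real n * ln (ln (real n))))" by simp
    also have "\<dots> = 2 * sqrt (real n * ln (ln (real n)))" by (simp add: real_sqrt_mult)
    finally have "sqrt (2 ^ k * ln (real k)) \<le> 2 * sqrt (real n * ln (ln (real n)))" .
    moreover have "\<bar>\<tau> n \<omega> - real n\<bar> \<le> 107 * sqrt (2 ^ k * ln (real k))"
      using \<open>k0 \<le> k\<close> j(2) by (intro k0) (auto simp: k_def)
    ultimately show "\<bar>\<tau> n \<omega> - real n\<bar> \<le> 214 * sqrt (real n * ln (ln (real n)))" by linarith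
  qed
qed

section \<open>Oscillation of the path over short windows\<close>

lemma mgf_F_increment:
  assumes A: "A \<in> sets (F (real j / 2 ^ m))" and t': "real j / 2 ^ m < t'"
  shows "(\<integral>\<^sup>+\<omega>. indicator A \<omega> * ennreal (exp (\<theta> * (B t' \<omega> - B (real j / 2 ^ m) \<omega>))) \<partial>M)
    = ennreal (exp (\<theta>\<^sup>2 * (t' - real j / 2 ^ m) / 2)) * emeasure M A"
proof -
  have AM [measurable]: "A \<in> sets M" using A sets_F_subset by blast
  have p: "0 \<le> real j / 2 ^ m" by simp
  then have t'0: "0 \<le> t'" using t' by linarith
  define g where "g \<omega> = exp (\<theta> * (B t' \<omega> - B (real j / 2 ^ m) \<omega>))" for \<omega>
  have [measurable]: "g \<in> borel_measurable M" unfolding g_def using t'0 by measurable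
  have nn: "(\<integral>\<^sup>+\<omega>. ennreal (g \<omega>) \<partial>M) = ennreal (exp (\<theta>\<^sup>2 * (t' - real j / 2 ^ m) / 2))"
    unfolding g_def by (rule mgf_increment[OF p t'])
  have ig: "integrable M g"
    by (rule integrableI_nonneg) (auto simp: nn, simp add: g_def)
  have Eg: "(\<integral>\<omega>. g \<omega> \<partial>M) = exp (\<theta>\<^sup>2 * (t' - real j / 2 ^ m) / 2)"
  proof -
    have g0: "0 \<le> g \<omega>" for \<omega> by (simp add: g_def)
    have "ennreal (\<integral>\<omega>. g \<omega> \<partial>M) = ennreal (exp (\<theta>\<^sup>2 * (t' - real j / 2 ^ m) / 2))"
      using nn_integral_eq_integral[OF ig AE_I2[OF g0]] nn by simp
    then show ?thesis using Bochner_Integration.integral_nonneg[of M g, OF g0] by (subst (asm) ennreal_inj) auto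
  qed
  have iA: "integrable M (indicator A :: 'a \<Rightarrow> real)" by (simp add: less_top[symmetric])
  have ind: "indep_var borel (indicator A :: 'a \<Rightarrow> real) borel g"
    unfolding g_def
    by (rule indep_var_F_increment[OF _ t', where f="\<lambda>x. exp (\<theta> * x)"]) (use A in measurable)
  have "(\<integral>\<^sup>+\<omega>. indicator A \<omega> * ennreal (g \<omega>) \<partial>M) = (\<integral>\<^sup>+\<omega>. ennreal (indicator A \<omega> * g \<omega>) \<partial>M)"
    by (intro nn_integral_cong) (auto simp: indicator_def)
  also have "\<dots> = ennreal (\<integral>\<omega>. indicator A \<omega> * g \<omega> \<partial>M)"
    by (rule nn_integral_eq_integral[OF indep_var_integrable[OF ind iA ig]]) (auto simp: g_def)
  also have "\<dots> = ennreal (prob A * exp (\<theta>\<^sup>2 * (t' - real j / 2 ^ m) / 2))"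
    using sets.sets_into_space[OF AM] unfolding indep_var_lebesgue_integral[OF ind iA ig] Eg
        by (simp add: Int_absorb2)
  also have "\<dots> = ennreal (exp (\<theta>\<^sup>2 * (t' - real j / 2 ^ m) / 2)) * emeasure M A"
    by (simp add: emeasure_eq_measure ennreal_mult' mult.commute)
  finally show ?thesis unfolding g_def .
qed

text \<open>Doob's inequality for the real exponential martingale started at time \<open>a\<close>,
  with the optimal parameter \<open>l = x / H\<close>. The bound is the same for every mesh, which
  is what the passage to continuous time uses.\<close>

lemma deviation_B_grid:
  fixes a H m :: nat
  assumes H: "0 < H" and x: "0 < x" and s: "s = 1 \<or> s = (- 1 :: real)"
  shows "prob {\<omega>\<in>space M. \<exists>i\<le>H * 2 ^ m. x \<le> s * (B (real (a * 2 ^ m + i) / 2 ^ m) \<omega> - B (real a) \<omega>)}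
      \<le> exp (- (x\<^sup>2 / (2 * real H)))"
proof -
  define l where "l = x / real H"
  have l: "l > 0" using H x by (simp add: l_def)
  define u where "u i = real (a * 2 ^ m + i) / 2 ^ m" for i
  have u0: "u 0 = real a" by (simp add: u_def)
  have uS: "u (Suc i) - u i = 1 / 2 ^ m" "u i < u (Suc i)" for i by (simp_all add: u_def field_simps)
  have up: "0 \<le> u i" for i by (simp add: u_def)
  define N where "N i \<omega> = ennreal (exp (l * s * (B (u i) \<omega> - B (u 0) \<omega>) - l\<^sup>2 * (real i / 2 ^ m) / 2))" for i \<omega>
  define b where "b = ennreal (exp (l * x - l\<^sup>2 * real H / 2))"
  have [measurable]: "B (u i) \<in> borel_measurable M" for i using up by measurable
  have [measurable]: "N i \<in> borel_measurable M" for i unfolding N_def by measurable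
  have BF: "B (u i) \<in> borel_measurable (F (u k))" if "i \<le> k" for i k
    unfolding u_def using that by (intro measurable_F_B divide_right_mono) simp_all
  have NF: "N i \<in> borel_measurable (F (u k))" if "i \<le> k" for i k
  proof -
    note [measurable] = BF[OF that] BF[of 0 k, simplified]
    show ?thesis unfolding N_def by measurable
  qed
  have NS: "N (Suc k) \<omega> = ennreal (exp (- (l\<^sup>2 * (1 / 2 ^ m) / 2))) * (N k \<omega> * ennreal (exp (l * s *
      (B (u (Suc k)) \<omega> - B (u k) \<omega>))))" for k \<omega>
    unfolding N_def by (simp add: ennreal_mult'[symmetric] exp_add[symmetric] algebra_simps add_divide_distrib)
  have step: "(\<integral>\<^sup>+\<omega>. N (Suc k) \<omega> * indicator {\<omega>\<in>space M. \<forall>i\<le>k. N i \<omega> < b} \<omega> \<partial>M)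
      \<le> (\<integral>\<^sup>+\<omega>. N k \<omega> * indicator {\<omega>\<in>space M. \<forall>i\<le>k. N i \<omega> < b} \<omega> \<partial>M)" for k
  proof -
    define G where "G = {\<omega>\<in>space M. \<forall>i\<le>k. N i \<omega> < b}"
    define Y where "Y \<omega> = N k \<omega> * indicator G \<omega>" for \<omega>
    have "G = {\<omega>\<in>space (F (u k)). \<forall>i\<in>{..k}. N i \<omega> < b}" by (auto simp: G_def space_F)
    also have "\<dots> \<in> sets (F (u k))"
      using NF by (intro sets.sets_Collect_finite_All') (auto intro!: borel_measurable_less)
    finally have GF: "G \<in> sets (F (u k))" .
    have YF: "Y \<in> borel_measurable (F (u k))"
      unfolding Y_def using NF[of k k] GF by measurable
    note [measurable] = measurable_F_imp[OF YF]
    have "(l * s)\<^sup>2 = l\<^sup>2" using s by (auto simp: power2_eq_square)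
    then have gb: "(\<integral>\<^sup>+\<omega>. indicator A \<omega> * ennreal (exp (l * s * (B (u (Suc k)) \<omega> - B (u k) \<omega>))) \<partial>M)
      \<le> ennreal (exp (l\<^sup>2 * (1 / 2 ^ m) / 2)) * emeasure M A" if "A \<in> sets (F (u k))" for A
      using mgf_F_increment[of A "a * 2 ^ m + k" m "u (Suc k)" "l * s"] that uS[of k]
      unfolding u_def[of k, symmetric] by simp
    have "(\<integral>\<^sup>+\<omega>. N (Suc k) \<omega> * indicator G \<omega> \<partial>M)
      = (\<integral>\<^sup>+\<omega>. ennreal (exp (- (l\<^sup>2 * (1 / 2 ^ m) / 2))) * (Y \<omega> * ennreal (exp (l * s * (B (u (Suc k)) \<omega> - B
          (u k) \<omega>)))) \<partial>M)"
      by (intro nn_integral_cong) (simp add: NS Y_def mult_ac)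
    also have "\<dots> = ennreal (exp (- (l\<^sup>2 * (1 / 2 ^ m) / 2))) * (\<integral>\<^sup>+\<omega>. Y \<omega> * ennreal (exp (l * s *
        (B (u (Suc k)) \<omega> - B (u k) \<omega>))) \<partial>M)"
      by (rule nn_integral_cmult) measurable
    also have "\<dots> \<le> ennreal (exp (- (l\<^sup>2 * (1 / 2 ^ m) / 2))) * (ennreal (exp (l\<^sup>2 * (1 / 2 ^ m) / 2)) * (\<integral>\<^sup>+\<omega>.
        Y \<omega> \<partial>M))"
      by (intro mult_left_mono nn_integral_subalgebra_bound[OF sets_F_subset space_F _ _ YF] gb) auto
    also have "\<dots> = (\<integral>\<^sup>+\<omega>. Y \<omega> \<partial>M)"
      unfolding mult.assoc[symmetric] by (simp add: ennreal_mult'[symmetric] exp_add[symmetric])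
    finally show ?thesis by (simp add: G_def Y_def)
  qed
  have N0: "(\<integral>\<^sup>+\<omega>. N 0 \<omega> \<partial>M) = 1"
    by (simp add: N_def emeasure_space_1)
  define E where "E = {\<omega>\<in>space M. \<exists>i\<le>H * 2 ^ m. b \<le> N i \<omega>}"
  have [measurable]: "E \<in> sets M" unfolding E_def by measurable
  have "b * emeasure M E \<le> 1"
    using doob_maximal[of N b "H * 2 ^ m", OF _ step] unfolding N0 E_def by simp
  then have "ennreal (exp (l * x - l\<^sup>2 * real H / 2) * prob E) \<le> ennreal 1"
    by (simp add: b_def emeasure_eq_measure ennreal_mult'')
  then have "exp (l * x - l\<^sup>2 * real H / 2) * prob E \<le> 1" by simp
  moreover have "p \<le> exp (- y)" if "exp y * p \<le> 1" for p y :: real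
    using that by (simp add: exp_minus field_simps)
  ultimately have "prob E \<le> exp (- (l * x - l\<^sup>2 * real H / 2))" by blast
  also have "l * x - l\<^sup>2 * real H / 2 = x\<^sup>2 / (2 * real H)"
    using H by (simp add: l_def power2_eq_square field_simps)
  finally have PE: "prob E \<le> exp (- (x\<^sup>2 / (2 * real H)))" .
  have "{\<omega>\<in>space M. \<exists>i\<le>H * 2 ^ m. x \<le> s * (B (u i) \<omega> - B (u 0) \<omega>)} \<subseteq> E"
  proof safe
    fix \<omega> i assume \<omega>: "\<omega> \<in> space M" and i: "i \<le> H * 2 ^ m" "x \<le> s * (B (u i) \<omega> - B (u 0) \<omega>)"
    have "real i \<le> real (H * 2 ^ m)" using i(1) by (simp only: of_nat_le_iff)
    then have "real i / 2 ^ m \<le> real H" by (simp add: field_simps)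
    then have 1: "l\<^sup>2 * (real i / 2 ^ m) \<le> l\<^sup>2 * real H" by (intro mult_left_mono) auto
    have 2: "l * x \<le> l * (s * (B (u i) \<omega> - B (u 0) \<omega>))" using i l by (intro mult_left_mono) auto
    have "l * x - l\<^sup>2 * real H / 2 \<le> l * s * (B (u i) \<omega> - B (u 0) \<omega>) - l\<^sup>2 * (real i / 2 ^ m) / 2"
      unfolding mult.assoc[of l s] by (rule diff_mono[OF 2 divide_right_mono[OF 1]]) simp
    then have "b \<le> N i \<omega>" unfolding b_def N_def by (intro ennreal_leI) simp
    then show "\<omega> \<in> E" using \<omega> i by (auto simp: E_def)
  qed
  then have "prob {\<omega>\<in>space M. \<exists>i\<le>H * 2 ^ m. x \<le> s * (B (u i) \<omega> - B (u 0) \<omega>)} \<le> prob E"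
    by (intro finite_measure_mono) auto
  then show ?thesis using PE unfolding u0 by (simp add: u_def)
qed

text \<open>The exceptional events of the grids increase with the refinement, since grid point
  \<open>i\<close> becomes point \<open>2 * i\<close>; so their union obeys the same bound. Outside
  this single set, all times \<open>u\<close> follow by continuity.\<close>

lemma deviation_B_window:
  fixes a H :: nat
  assumes H: "0 < H" and x: "0 < x"
  obtains E where "E \<in> sets M" "prob E \<le> 2 * exp (- (x\<^sup>2 / (2 * real H)))"
    "\<And>\<omega> u. \<omega> \<in> space M \<Longrightarrow> \<omega> \<notin> E \<Longrightarrow> real a \<le> u \<Longrightarrow> u \<le> real (a + H) \<Longrightarrow> \<bar>B u \<omega> - B (real a) \<omega>\<bar> \<le> x"
proof -
  define D where "D s m = {\<omega>\<in>space M. \<exists>i\<le>H * 2 ^ m. x \<le> s * (B (real (a * 2 ^ m + i) / 2 ^ m) \<omega> - B (real a)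
      \<omega>)}" for s :: real and m :: nat
  have [measurable]: "D s m \<in> sets M" for s m unfolding D_def by measurable
  define E where "E = (\<Union>m. D 1 m) \<union> (\<Union>m. D (- 1) m)"
  have PD: "prob (\<Union>m. D s m) \<le> exp (- (x\<^sup>2 / (2 * real H)))" if s: "s = 1 \<or> s = - 1" for s
  proof -
    have "incseq (D s)"
    proof (rule incseq_SucI, safe)
      fix m \<omega> assume "\<omega> \<in> D s m"
      then obtain i where i: "\<omega> \<in> space M" "i \<le> H * 2 ^ m" "x \<le> s * (B (real (a * 2 ^ m + i) / 2 ^ m) \<omega> - B
          (real a) \<omega>)"
        by (auto simp: D_def)
      have "real (a * 2 ^ Suc m + 2 * i) / 2 ^ Suc m = real (a * 2 ^ m + i) / 2 ^ m"
        by (simp add: field_simps)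
      then show "\<omega> \<in> D s (Suc m)"
        unfolding D_def using i by (auto intro!: exI[of _ "2 * i"] simp del: of_nat_add of_nat_mult power_Suc) simp
    qed
    then have "(SUP m. emeasure M (D s m)) = emeasure M (\<Union>m. D s m)"
      by (intro SUP_emeasure_incseq) auto
    moreover have "(SUP m. emeasure M (D s m)) \<le> ennreal (exp (- (x\<^sup>2 / (2 * real H))))"
    proof (rule SUP_least)
      fix m
      show "emeasure M (D s m) \<le> ennreal (exp (- (x\<^sup>2 / (2 * real H))))"
        unfolding emeasure_eq_measure D_def by (intro ennreal_leI deviation_B_grid H x s)
    qed
    ultimately have "emeasure M (\<Union>m. D s m) \<le> ennreal (exp (- (x\<^sup>2 / (2 * real H))))" by simp
    then show ?thesis by (simp add: emeasure_eq_measure)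
  qed
  have "prob E \<le> prob (\<Union>m. D 1 m) + prob (\<Union>m. D (- 1) m)"
    unfolding E_def by (intro measure_Un_le) auto
  also have "\<dots> \<le> 2 * exp (- (x\<^sup>2 / (2 * real H)))" using PD[of 1] PD[of "- 1"] by simp
  finally have PE: "prob E \<le> 2 * exp (- (x\<^sup>2 / (2 * real H)))" .
  have path_bound: "\<bar>B u \<omega> - B (real a) \<omega>\<bar> \<le> x"
    if \<omega>: "\<omega> \<in> space M" "\<omega> \<notin> E" and u: "real a \<le> u" "u \<le> real (a + H)" for \<omega> u
  proof -
    have grid: "\<bar>B (real (nat \<lfloor>2 ^ k * u\<rfloor>) / 2 ^ k) \<omega> - B (real a) \<omega>\<bar> \<le> x" for k
    proof -
      define i where "i = nat \<lfloor>2 ^ k * u\<rfloor> - a * 2 ^ k"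
      have "2 ^ k * real a \<le> 2 ^ k * u" "2 ^ k * u \<le> 2 ^ k * real (a + H)" using u by (intro mult_left_mono; simp)+
      then have "real (a * 2 ^ k) \<le> 2 ^ k * u" "2 ^ k * u \<le> real ((a + H) * 2 ^ k)" by (simp_all add: mult.commute)
      then have "a * 2 ^ k \<le> nat \<lfloor>2 ^ k * u\<rfloor>" "nat \<lfloor>2 ^ k * u\<rfloor> \<le> (a + H) * 2 ^ k" by linarith+
      then have i: "nat \<lfloor>2 ^ k * u\<rfloor> = a * 2 ^ k + i" "i \<le> H * 2 ^ k" by (auto simp: i_def add_mult_distrib)
      have "\<omega> \<notin> D 1 k" "\<omega> \<notin> D (- 1) k" using \<omega>(2) by (auto simp: E_def)
      then have "\<not> x \<le> 1 * (B (real (a * 2 ^ k + i) / 2 ^ k) \<omega> - B (real a) \<omega>)"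
        "\<not> x \<le> - 1 * (B (real (a * 2 ^ k + i) / 2 ^ k) \<omega> - B (real a) \<omega>)"
        using i(2) \<omega>(1) unfolding D_def by blast+
      then show ?thesis unfolding i(1) by (simp add: not_le abs_le_iff less_imp_le)
    qed
    have "0 \<le> u" using u by linarith
    then have "(\<lambda>k. \<bar>B (real (nat \<lfloor>2 ^ k * u\<rfloor>) / 2 ^ k) \<omega> - B (real a) \<omega>\<bar>) \<longlonglongrightarrow> \<bar>B u \<omega> - B (real a) \<omega>\<bar>"
      by (intro tendsto_rabs tendsto_diff tendsto_const B_tendsto \<omega>(1) dyadic_floor_LIMSEQ) auto
    then show ?thesis by (rule LIMSEQ_le_const2) (use grid in auto)
  qed
  have "E \<in> sets M" unfolding E_def by measurable
  from that[OF this PE path_bound] show ?thesis .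
qed

text \<open>The bound on the deviation of \<open>\<tau> n\<close> from \<open>n\<close>, rounded up
  to an integer because the windows of \<open>deviation_B_window\<close> start and end at
  integers.\<close>

definition half_window :: "nat \<Rightarrow> nat" where
  "half_window n = nat \<lceil>214 * sqrt (real n * ln (ln (real n)))\<rceil>"

lemma ln_ln_ge_1:
  assumes "32 \<le> n"
  shows "1 \<le> ln (ln (real n))" "3 \<le> ln (real n)"
proof -
  have "ln (real n) \<ge> ln (2 ^ 5)" using assms by (intro ln_mono) auto
  moreover have "ln (2 ^ 5) = 5 * ln (2::real)" by (subst ln_realpow) auto
  ultimately show 3: "3 \<le> ln (real n)" using ln2_ge_two_thirds by linarith
  have "exp 1 \<le> (3::real)" using exp_le by simp
  then have "ln (exp 1) \<le> ln (ln (real n))" using 3 by (intro ln_mono) auto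
  then show "1 \<le> ln (ln (real n))" by simp
qed

lemma half_window_bounds:
  assumes "32 \<le> n"
  shows "0 < half_window n" "214 * sqrt (real n * ln (ln (real n))) \<le> real (half_window n)"
    "real (half_window n) \<le> 215 * sqrt (real n * ln (ln (real n)))"
proof -
  have "1 * 1 \<le> real n * ln (ln (real n))" using assms ln_ln_ge_1[OF assms] by (intro mult_mono) auto
  then have "sqrt 1 \<le> sqrt (real n * ln (ln (real n)))" by (intro real_sqrt_le_mono) simp
  then have 1: "1 \<le> sqrt (real n * ln (ln (real n)))" by simp
  then show "0 < half_window n" "214 * sqrt (real n * ln (ln (real n))) \<le> real (half_window n)"
    "real (half_window n) \<le> 215 * sqrt (real n * ln (ln (real n)))"
    unfolding half_window_def by linarith+
qed

text \<open>The window has length \<open>2 * h n\<close>, so \<open>x n\<close> squared over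
  \<open>4 * h n\<close> is \<open>2 * ln n\<close>, and the probabilities
  \<open>2 / n\<^sup>2\<close> are summable. The factor 2 in the conclusion arises because
  \<open>u\<close> and \<open>n\<close> are both compared with the left end. If
  \<open>h n > n\<close>, truncated subtraction lets the window start at 0 and it still covers all
  admissible \<open>u\<close>.\<close>

lemma AE_window:
  "AE \<omega> in M. \<forall>\<^sub>F n in sequentially. \<forall>u\<ge>0. \<bar>u - real n\<bar> \<le> real (half_window n) \<longrightarrow>
     \<bar>B u \<omega> - B (real n) \<omega>\<bar> \<le> 2 * sqrt (8 * real (half_window n) * ln (real n))"
proof -
  define h where "h n = half_window n" for n
  define x where "x n = sqrt (8 * real (h n) * ln (real n))" for n
  have "\<exists>E. E \<in> sets M \<and> (32 \<le> n \<longrightarrow> prob E \<le> 2 * (1 / (real n)\<^sup>2) \<and>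
     (\<forall>\<omega> u. \<omega> \<in> space M \<longrightarrow> \<omega> \<notin> E \<longrightarrow> real (n - h n) \<le> u \<longrightarrow> u \<le> real (n - h n + 2 * h n) \<longrightarrow> \<bar>B u \<omega> - B (real (n - h
         n)) \<omega>\<bar> \<le> x n))" for n
  proof (cases "32 \<le> n")
    case True
    have h: "0 < 2 * h n" using half_window_bounds(1)[OF True] by (simp add: h_def)
    have x: "0 < x n" using h ln_ln_ge_1[OF True] by (simp add: x_def)
    obtain E where E: "E \<in> sets M" "prob E \<le> 2 * exp (- ((x n)\<^sup>2 / (2 * real (2 * h n))))"
      "\<And>\<omega> u. \<omega> \<in> space M \<Longrightarrow> \<omega> \<notin> E \<Longrightarrow> real (n - h n) \<le> u \<Longrightarrow> u \<le> real (n - h n + 2 * h n) \<Longrightarrow>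
          \<bar>B u \<omega> - B (real (n - h n)) \<omega>\<bar> \<le> x n"
      by (rule deviation_B_window[OF h x, of "n - h n"]) blast
    have "(x n)\<^sup>2 / (2 * real (2 * h n)) = 2 * ln (real n)"
      using h ln_ln_ge_1[OF True] by (simp add: x_def)
    moreover have "exp (- (2 * ln (real n))) = 1 / (real n)\<^sup>2"
      using True by (simp add: exp_minus exp_double[of "ln (real n)", simplified] inverse_eq_divide)
    ultimately have "prob E \<le> 2 * (1 / (real n)\<^sup>2)" using E(2) by simp
    then show ?thesis using E by blast
  qed (auto intro!: exI[of _ "{}"])
  then obtain E where E: "\<And>n. E n \<in> sets M" "\<And>n. 32 \<le> n \<Longrightarrow> prob (E n) \<le> 2 * (1 / (real n)\<^sup>2)"
    "\<And>n \<omega> u. 32 \<le> n \<Longrightarrow> \<omega> \<in> space M \<Longrightarrow> \<omega> \<notin> E n \<Longrightarrow> real (n - h n) \<le> u \<Longrightarrow> u \<le> real (n - h n + 2 * h n) \<Longrightarrow>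
        \<bar>B u \<omega> - B (real (n - h n)) \<omega>\<bar> \<le> x n"
    by metis
  have "AE \<omega> in M. \<forall>\<^sub>F n in sequentially. \<omega> \<in> space M - E n"
  proof (rule borel_cantelli_AE1)
    show "summable (\<lambda>n. prob (E n))"
      by (rule summable_comparison_test'[OF summable_mult[OF inverse_power_summable[of 2]], where N=32 and c1=2])
         (use E(2) in \<open>auto simp: inverse_eq_divide\<close>)
  qed (use E(1) in \<open>auto simp: less_top[symmetric]\<close>)
  then show ?thesis
  proof eventually_elim
    case (elim \<omega>)
    have "\<forall>\<^sub>F n in sequentially. 32 \<le> n" by (rule eventually_ge_at_top)
    with elim show ?case
    proof eventually_elim
      case (elim n)
      show ?case
      proof (intro allI impI)
        fix u :: real assume u: "0 \<le> u" "\<bar>u - real n\<bar> \<le> real (half_window n)"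
        then have "real (n - h n) \<le> u" "u \<le> real (n - h n + 2 * h n)"
          by (cases "h n \<le> n"; simp add: h_def[symmetric] of_nat_diff; linarith)+
        then have 1: "\<bar>B u \<omega> - B (real (n - h n)) \<omega>\<bar> \<le> x n" using elim by (intro E(3)) auto
        have "\<bar>B (real n) \<omega> - B (real (n - h n)) \<omega>\<bar> \<le> x n"
          using elim by (intro E(3)) auto
        then show "\<bar>B u \<omega> - B (real n) \<omega>\<bar> \<le> 2 * sqrt (8 * real (half_window n) * ln (real n))"
          using 1 unfolding x_def h_def by linarith
      qed
    qed
  qed
qed

theorem AE_oscillation_up_to_\<tau>:
  "AE \<omega> in M. \<forall>\<^sub>F n in sequentially. \<forall>u\<ge>0. \<bar>u - real n\<bar> \<le> \<bar>\<tau> n \<omega> - real n\<bar> \<longrightarrow>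
     \<bar>B u \<omega> - B (real n) \<omega>\<bar> \<le> 84 * ((real n * ln (ln (real n))) powr (1/4) * ln (real n) powr (1/2))"
  using AE_\<tau>_lil AE_window
proof eventually_elim
  case (elim \<omega>)
  have "\<forall>\<^sub>F n in sequentially. 32 \<le> n" by (rule eventually_ge_at_top)
  with elim show ?case
  proof eventually_elim
    case (elim n)
    define g where "g = real n * ln (ln (real n))"
    have g: "0 \<le> g" using ln_ln_ge_1[OF elim(3)] by (simp add: g_def)
    have ln0: "0 \<le> ln (real n)" using ln_ln_ge_1[OF elim(3)] by simp
    have "8 * real (half_window n) * ln (real n) \<le> 8 * (215 * sqrt g) * ln (real n)"
      using half_window_bounds(3)[OF elim(3)] ln0 by (intro mult_right_mono mult_left_mono) (auto simp: g_def)
    \<comment> \<open>8 * 215 = 1720 is rounded up to the square 1764, which makes the root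
      explicit; finally 84 = 2 * 42.\<close>
    also have "\<dots> \<le> 42\<^sup>2 * (sqrt g * ln (real n))" using g ln0 by (simp add: mult_right_mono)
    finally have "sqrt (8 * real (half_window n) * ln (real n)) \<le> sqrt (42\<^sup>2 * (sqrt g * ln (real n)))" by simp
    also have "\<dots> = 42 * (sqrt (sqrt g) * sqrt (ln (real n)))" by (simp add: real_sqrt_mult)
    also have "sqrt (sqrt g) = g powr (1/4)"
      using g by (simp add: powr_half_sqrt[symmetric] powr_powr)
    also have "sqrt (ln (real n)) = ln (real n) powr (1/2)" using ln0 by (simp add: powr_half_sqrt)
    finally have *: "sqrt (8 * real (half_window n) * ln (real n)) \<le> 42 * (g powr (1/4) * ln (real n) powr (1/2))" .
    show ?case
    proof (intro allI impI)
      fix u :: real assume u: "0 \<le> u" "\<bar>u - real n\<bar> \<le> \<bar>\<tau> n \<omega> - real n\<bar>"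
      then have "\<bar>u - real n\<bar> \<le> real (half_window n)"
        using elim(1) half_window_bounds(2)[OF elim(3)] by linarith
      then have "\<bar>B u \<omega> - B (real n) \<omega>\<bar> \<le> 2 * sqrt (8 * real (half_window n) * ln (real n))"
        using elim(2) u by blast
      then show "\<bar>B u \<omega> - B (real n) \<omega>\<bar> \<le> 84 * ((real n * ln (ln (real n))) powr (1/4) * ln (real n) powr (1/2))"
        using * unfolding g_def by linarith
    qed
  qed
qed

end

section \<open>Excursion intervals\<close>

text \<open>\<open>s\<close> and \<open>t\<close> lie in the same excursion interval.\<close>

definition joined :: "(real \<Rightarrow> real) \<Rightarrow> real \<Rightarrow> real \<Rightarrow> bool" where
  "joined b s t \<longleftrightarrow> (\<forall>u. min s t \<le> u \<and> u \<le> max s t \<longrightarrow> b u \<noteq> 0)"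

lemma joined_sym: "joined b s t \<Longrightarrow> joined b t s"
  by (simp add: joined_def min.commute max.commute)

lemma joined_refl: "joined b t t \<longleftrightarrow> b t \<noteq> 0"
  by (auto simp: joined_def)

lemma joined_trans:
  assumes "joined b s t" "joined b t u"
  shows "joined b s u"
  unfolding joined_def
proof (intro allI impI)
  fix x assume x: "min s u \<le> x \<and> x \<le> max s u"
  then have "min s t \<le> x \<and> x \<le> max s t \<or> min t u \<le> x \<and> x \<le> max t u" by linarith
  then show "b x \<noteq> 0" using assms by (auto simp: joined_def)
qed

lemma connected_component_joined:
  assumes "0 \<le> s"
  shows "connected_component {t. t \<ge> 0 \<and> \<bar>b t\<bar> \<noteq> (0::real)} s t \<longleftrightarrow> 0 \<le> t \<and> joined b s t"
proof
  assume "connected_component {t. t \<ge> 0 \<and> \<bar>b t\<bar> \<noteq> 0} s t"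
  then obtain T where T: "connected T" "T \<subseteq> {t. t \<ge> 0 \<and> \<bar>b t\<bar> \<noteq> 0}" "s \<in> T" "t \<in> T"
    by (auto simp: connected_component_def)
  then have "min s t \<in> T" "max s t \<in> T" by (auto simp: min_def max_def)
  then have sub: "{min s t..max s t} \<subseteq> T" by (intro connected_contains_Icc T)
  have "b u \<noteq> 0" if "min s t \<le> u \<and> u \<le> max s t" for u
  proof -
    have "u \<in> T" using sub that by auto
    then show ?thesis using T(2) by auto
  qed
  moreover have "0 \<le> t" using T(2,4) by auto
  ultimately show "0 \<le> t \<and> joined b s t" by (simp add: joined_def)
next
  assume t: "0 \<le> t \<and> joined b s t"
  show "connected_component {t. t \<ge> 0 \<and> \<bar>b t\<bar> \<noteq> 0} s t"
    unfolding connected_component_def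
    by (rule exI[of _ "{min s t..max s t}"]) (use t assms in \<open>auto simp: joined_def\<close>)
qed

lemma connected_component_set_joined:
  "0 \<le> s \<Longrightarrow> connected_component_set {t. t \<ge> 0 \<and> \<bar>b t\<bar> \<noteq> (0::real)} s = {t. 0 \<le> t \<and> joined b s t}"
  using connected_component_joined[of s b] by (intro Collect_cong)

text \<open>An enumeration, with repetitions, of the nonnegative dyadic rationals.\<close>

definition dyadic :: "nat \<Rightarrow> real" where
  "dyadic k = real (snd (prod_decode k)) / 2 ^ fst (prod_decode k)"

lemma dyadic_nonneg: "0 \<le> dyadic k"
  by (simp add: dyadic_def)

lemma ex_dyadic_between:
  assumes "0 \<le> a" "a < c"
  obtains k where "a < dyadic k" "dyadic k < c"
proof -
  obtain n i :: nat where "a < real i / 2 ^ n" "real i / 2 ^ n < c"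
    by (rule dyadic_between[OF assms])
  then show ?thesis by (intro that[of "prod_encode (n, i)"]) (auto simp: dyadic_def)
qed

text \<open>Selects one representative per excursion: the point that comes first in the enumeration
  among all dyadic points of that excursion.\<close>

definition fresh :: "(real \<Rightarrow> real) \<Rightarrow> nat \<Rightarrow> bool" where
  "fresh b k \<longleftrightarrow> b (dyadic k) \<noteq> 0 \<and> (\<forall>j<k. \<not> joined b (dyadic j) (dyadic k))"

text \<open>The number of fresh indices below the argument. The recursion lets its measurability be
  proved by induction.\<close>

primrec fresh_rank :: "(real \<Rightarrow> real) \<Rightarrow> nat \<Rightarrow> nat" where
  "fresh_rank b 0 = 0"
| "fresh_rank b (Suc k) = (if fresh b k then Suc (fresh_rank b k) else fresh_rank b k)"

text \<open>The excursion intervals are enumerated in the order in which they receive their first dyadic point.\<close>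

definition exc_interval :: "(real \<Rightarrow> real) \<Rightarrow> nat \<Rightarrow> real set" where
  "exc_interval b m = {t. 0 \<le> t \<and> (\<exists>k. fresh b k \<and> fresh_rank b k = m \<and> joined b (dyadic k) t)}"

text \<open>Excursions with different numbers are disjoint, so the least number is the only one. At
  a zero of \<open>b\<close> no excursion contains \<open>t\<close> and the value carries no
  meaning.\<close>

definition exc_index :: "(real \<Rightarrow> real) \<Rightarrow> real \<Rightarrow> nat" where
  "exc_index b t = (LEAST m. t \<in> exc_interval b m)"

lemma fresh_rank_card: "fresh_rank b k = card {j. j < k \<and> fresh b j}"
proof (induction k)
  case (Suc k)
  have "{j. j < Suc k \<and> fresh b j} = (if fresh b k then insert k {j. j < k \<and> fresh b j} else {j. j < k \<and> fresh b j})"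
    by (auto simp: less_Suc_eq)
  then show ?case using Suc by simp
qed simp

lemma fresh_rank_mono_strict: "fresh b j \<Longrightarrow> j < k \<Longrightarrow> fresh_rank b j < fresh_rank b k"
  unfolding fresh_rank_card by (rule psubset_card_mono) auto

lemma fresh_rank_inj: "fresh b j \<Longrightarrow> fresh b k \<Longrightarrow> fresh_rank b j = fresh_rank b k \<Longrightarrow> j = k"
  using fresh_rank_mono_strict[of b j k] fresh_rank_mono_strict[of b k j] by (cases j k rule: linorder_cases) auto

lemma ex_fresh_joined:
  assumes "joined b (dyadic k) t"
  obtains j where "fresh b j" "joined b (dyadic j) t"
proof -
  define j where "j = (LEAST j. joined b (dyadic j) t)"
  have j: "joined b (dyadic j) t" unfolding j_def by (rule LeastI[of _ k]) (rule assms)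
  have "b (dyadic j) \<noteq> 0" using j by (auto simp: joined_def)
  moreover have "\<not> joined b (dyadic i) (dyadic j)" if "i < j" for i
    using not_less_Least[OF that[unfolded j_def]] joined_trans[OF _ j] by blast
  ultimately have "fresh b j" by (simp add: fresh_def)
  then show ?thesis using j by (rule that)
qed

lemma exc_interval_joined:
  assumes "s \<in> exc_interval b m" "t \<in> exc_interval b m"
  shows "joined b s t"
proof -
  obtain k where k: "fresh b k" "fresh_rank b k = m" "joined b (dyadic k) s"
    using assms(1) by (auto simp: exc_interval_def)
  obtain k' where k': "fresh b k'" "fresh_rank b k' = m" "joined b (dyadic k') t"
    using assms(2) by (auto simp: exc_interval_def)
  have "k = k'" using fresh_rank_inj[of b k k'] k k' by simp
  then show ?thesis using joined_trans[OF joined_sym[OF k(3)]] k'(3) by simp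
qed

lemma joined_exc_interval: "s \<in> exc_interval b m \<Longrightarrow> joined b s t \<Longrightarrow> 0 \<le> t \<Longrightarrow> t \<in> exc_interval b m"
  unfolding exc_interval_def using joined_trans by blast

lemma exc_interval_unique:
  assumes "t \<in> exc_interval b m" "t \<in> exc_interval b m'"
  shows "m = m'"
proof -
  obtain k where k: "fresh b k" "fresh_rank b k = m" "joined b (dyadic k) t"
    using assms(1) by (auto simp: exc_interval_def)
  obtain k' where k': "fresh b k'" "fresh_rank b k' = m'" "joined b (dyadic k') t"
    using assms(2) by (auto simp: exc_interval_def)
  have j: "joined b (dyadic k) (dyadic k')" by (rule joined_trans[OF k(3) joined_sym[OF k'(3)]])
  have "\<not> k < k'" using k'(1) j by (auto simp: fresh_def)
  moreover have "\<not> k' < k" using k(1) joined_sym[OF j] by (auto simp: fresh_def)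
  ultimately have "k = k'" by simp
  then show ?thesis using k k' by simp
qed

lemma exc_index_eq: "t \<in> exc_interval b m \<Longrightarrow> exc_index b t = m"
  unfolding exc_index_def by (rule Least_equality) (auto dest: exc_interval_unique)

context unbounded_continuous_path
begin

lemma joined_nearby:
  assumes "0 \<le> t" "b t \<noteq> 0"
  obtains k where "joined b (dyadic k) t"
proof -
  obtain d where d: "d > 0" "\<And>x. 0 \<le> x \<Longrightarrow> \<bar>x - t\<bar> < d \<Longrightarrow> \<bar>b x - b t\<bar> < \<bar>b t\<bar>"
    using cont[unfolded continuous_on_iff, rule_format, of t "\<bar>b t\<bar>"] assms by (auto simp: dist_real_def)
  obtain k where k: "t < dyadic k" "dyadic k < t + d"
    by (rule ex_dyadic_between[of t "t + d"]) (use assms d(1) in auto)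
  have "joined b (dyadic k) t"
    unfolding joined_def
  proof (intro allI impI)
    fix u assume "min (dyadic k) t \<le> u \<and> u \<le> max (dyadic k) t"
    then have "\<bar>b u - b t\<bar> < \<bar>b t\<bar>" using k assms(1) by (intro d(2)) auto
    then show "b u \<noteq> 0" by auto
  qed
  then show ?thesis by (rule that)
qed

lemma ex_exc_interval:
  assumes "0 \<le> t" "b t \<noteq> 0"
  shows "t \<in> exc_interval b (exc_index b t)"
proof -
  obtain k where "joined b (dyadic k) t" by (rule joined_nearby[OF assms])
  then obtain j where "fresh b j" "joined b (dyadic j) t" by (rule ex_fresh_joined)
  then have "t \<in> exc_interval b (fresh_rank b j)" using assms by (auto simp: exc_interval_def)
  from exc_index_eq[OF this] this show ?thesis by simp
qed

lemma zero_after: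
  assumes "0 \<le> s"
  shows "\<exists>z\<ge>s. b z = 0"
proof -
  obtain t where t: "t \<ge> s" "b t > 0" using large_after by blast
  obtain u where u: "u \<ge> t" "b u < 0" using small_after by blast
  have "\<exists>x\<ge>t. x \<le> u \<and> b x = 0"
    by (rule IVT2') (use t u assms in \<open>auto intro!: continuous_on_subset[OF cont]\<close>)
  then show ?thesis using t by (meson order_trans)
qed

text \<open>Every excursion ends at some zero. With finitely many fresh points there would be a last
  one of the chosen zeros; beyond it the path is positive somewhere, and that excursion has a fresh
  point whose zero it would have to cross.\<close>

lemma infinite_fresh: "infinite {k. fresh b k}"
proof
  assume fin: "finite {k. fresh b k}"
  have "\<exists>z\<ge>dyadic k. b z = 0" for k by (rule zero_after[OF dyadic_nonneg])
  then obtain z where z: "\<And>k. z k \<ge> dyadic k" "\<And>k. b (z k) = 0" by metis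
  define c where "c = Max (insert 0 (z ` {k. fresh b k}))"
  have c: "0 \<le> c" "\<And>k. fresh b k \<Longrightarrow> z k \<le> c" using fin by (auto simp: c_def)
  obtain t where t: "t \<ge> c" "b t > 0" using large_after by blast
  obtain k where "joined b (dyadic k) t" by (rule joined_nearby[of t]) (use t c in auto)
  then obtain j where j: "fresh b j" "joined b (dyadic j) t" by (rule ex_fresh_joined)
  then have "b (z j) \<noteq> 0" using z(1)[of j] c(2)[of j] t(1) by (auto simp: joined_def min_def max_def)
  then show False using z by simp
qed

text \<open>The rank inverts the increasing enumeration of the infinitely many fresh indices, so
  interval \<open>m\<close> is the component of the fresh point with rank \<open>m\<close>. Every
  component is reached because by continuity it contains a dyadic point.\<close>

lemma bij_betw_exc_interval:
  "bij_betw (exc_interval b) UNIV (components {t. t \<ge> 0 \<and> \<bar>b t\<bar> \<noteq> 0})"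
proof -
  define I where "I = {k. fresh b k}"
  have I: "infinite I" unfolding I_def by (rule infinite_fresh)
  have rank: "fresh_rank b (enumerate I m) = m" for m
  proof -
    have "{j. j < enumerate I m \<and> fresh b j} = enumerate I ` {..<m}"
    proof (safe)
      fix j assume "j < enumerate I m" "fresh b j"
      then obtain i where "j = enumerate I i" using enumerate_Ex[OF I, of j] by (auto simp: I_def)
      then show "j \<in> enumerate I ` {..<m}" using \<open>j < enumerate I m\<close> enumerate_mono_iff[OF I] by auto
    next
      fix i assume "i < m"
      then show "enumerate I i < enumerate I m" by (rule enumerate_mono[OF _ I])
      show "fresh b (enumerate I i)" using enumerate_in_set[OF I, of i] by (simp add: I_def)
    qed
    moreover have "inj_on (enumerate I) {..<m}"
      by (rule inj_onI) (use enumerate_mono[OF _ I] in \<open>metis less_irrefl nat_neq_iff\<close>)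
    ultimately show ?thesis by (simp add: fresh_rank_card card_image)
  qed
  have fresh: "fresh b (enumerate I m)" for m using enumerate_in_set[OF I, of m] by (simp add: I_def)
  have eq: "exc_interval b m = connected_component_set {t. t \<ge> 0 \<and> \<bar>b t\<bar> \<noteq> 0} (dyadic (enumerate I m))" for m
  proof -
    have "k = enumerate I m" if "fresh b k" "fresh_rank b k = m" for k
      using fresh_rank_inj[OF that(1) fresh] that(2) rank by simp
    then show ?thesis
      unfolding exc_interval_def connected_component_set_joined[OF dyadic_nonneg] using fresh rank by auto
  qed
  have mem: "dyadic (enumerate I m) \<in> exc_interval b m" for m
    using fresh[of m] rank[of m] by (auto simp: exc_interval_def dyadic_nonneg joined_refl fresh_def)
  show ?thesis
    unfolding bij_betw_def
  proof
    show "inj (exc_interval b)"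
      by (rule injI) (metis mem exc_interval_unique)
    show "range (exc_interval b) = components {t. t \<ge> 0 \<and> \<bar>b t\<bar> \<noteq> 0}"
    proof
      show "range (exc_interval b) \<subseteq> components {t. t \<ge> 0 \<and> \<bar>b t\<bar> \<noteq> 0}"
      proof safe
        fix m
        have "dyadic (enumerate I m) \<in> {t. t \<ge> 0 \<and> \<bar>b t\<bar> \<noteq> 0}" using fresh[of m]
            by (simp add: dyadic_nonneg fresh_def)
        then show "exc_interval b m \<in> components {t. t \<ge> 0 \<and> \<bar>b t\<bar> \<noteq> 0}" unfolding eq by (rule componentsI)
      qed
      show "components {t. t \<ge> 0 \<and> \<bar>b t\<bar> \<noteq> 0} \<subseteq> range (exc_interval b)"
      proof
        fix C assume "C \<in> components {t. t \<ge> 0 \<and> \<bar>b t\<bar> \<noteq> 0}"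
        then obtain t where t: "0 \<le> t" "b t \<noteq> 0" "C = connected_component_set {t. t \<ge> 0 \<and> \<bar>b t\<bar> \<noteq> 0} t"
          by (auto simp: components_def)
        have t': "t \<in> exc_interval b (exc_index b t)" by (rule ex_exc_interval[OF t(1,2)])
        have "C = exc_interval b (exc_index b t)"
        proof (intro set_eqI iffI)
          fix u assume "u \<in> C"
          then have "0 \<le> u" "joined b t u" unfolding t(3) connected_component_set_joined[OF t(1)] by auto
          then show "u \<in> exc_interval b (exc_index b t)" by (intro joined_exc_interval[OF t'])
        next
          fix u assume u: "u \<in> exc_interval b (exc_index b t)"
          then have "0 \<le> u" by (simp add: exc_interval_def)
          then show "u \<in> C" using exc_interval_joined[OF t' u]
              unfolding t(3) connected_component_set_joined[OF t(1)] by auto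
        qed
        then show "C \<in> range (exc_interval b)" by simp
      qed
    qed
  qed
qed

text \<open>A countable form, again for measurability. On a compact interval, having no zero amounts
  to a positive lower bound \<open>1 / real (Suc l)\<close> for the modulus, and by continuity that
  bound can be tested at dyadic times. The end points are mentioned separately because for
  \<open>s = t\<close> there may be no dyadic time in between.\<close>

lemma joined_iff_dyadic:
  assumes s: "0 \<le> s" and t: "0 \<le> t"
  shows "joined b s t \<longleftrightarrow> b s \<noteq> 0 \<and> b t \<noteq> 0 \<and>
    (\<exists>l::nat. \<forall>k. min s t \<le> dyadic k \<and> dyadic k \<le> max s t \<longrightarrow> 1 / real (Suc l) \<le> \<bar>b (dyadic k)\<bar>)"
proof safe
  assume j: "joined b s t"
  have "\<exists>u\<in>{min s t..max s t}. \<forall>x\<in>{min s t..max s t}. \<bar>b u\<bar> \<le> \<bar>b x\<bar>"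
    by (rule continuous_attains_inf) (use s t in \<open>auto intro!: continuous_intros continuous_on_subset[OF cont]\<close>)
  then obtain u where u: "u \<in> {min s t..max s t}" "\<And>x. x \<in> {min s t..max s t} \<Longrightarrow> \<bar>b u\<bar> \<le> \<bar>b x\<bar>" by blast
  have "0 < \<bar>b u\<bar>" using j u(1) by (auto simp: joined_def)
  then obtain l :: nat where "1 / real (Suc l) < \<bar>b u\<bar>"
    using reals_Archimedean[of "\<bar>b u\<bar>"] by (auto simp: inverse_eq_divide)
  then show "\<exists>l. \<forall>k. min s t \<le> dyadic k \<and> dyadic k \<le> max s t \<longrightarrow> 1 / real (Suc l) \<le> \<bar>b (dyadic k)\<bar>"
    using u(2) by (intro exI[of _ l]) (fastforce intro: order_trans less_imp_le)
next
  assume "joined b s t" "b s = 0" then show False by (auto simp: joined_def)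
next
  assume "joined b s t" "b t = 0" then show False by (auto simp: joined_def)
next
  fix l :: nat
  assume st: "b s \<noteq> 0" "b t \<noteq> 0"
    and l: "\<forall>k. min s t \<le> dyadic k \<and> dyadic k \<le> max s t \<longrightarrow> 1 / real (Suc l) \<le> \<bar>b (dyadic k)\<bar>"
  show "joined b s t"
    unfolding joined_def
  proof (intro allI impI notI)
    fix u assume u: "min s t \<le> u \<and> u \<le> max s t" "b u = 0"
    have lt: "min s t < max s t" using u st by (cases "s = t") (auto simp: min_def max_def split: if_splits)
    have u0: "0 \<le> u" using u s t by auto
    have "0 < 1 / real (Suc l)" by simp
    then obtain d where d: "d > 0" "\<And>x. 0 \<le> x \<Longrightarrow> \<bar>x - u\<bar> < d \<Longrightarrow> \<bar>b x - b u\<bar> < 1 / real (Suc l)"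
      using cont[unfolded continuous_on_iff, rule_format, of u "1 / real (Suc l)"] u0 by (auto simp: dist_real_def)
    have "max (min s t) (u - d) < min (max s t) (u + d)" "0 \<le> max (min s t) (u - d)"
      using lt d(1) u(1) s t by auto
    then obtain k where k: "max (min s t) (u - d) < dyadic k" "dyadic k < min (max s t) (u + d)"
      using ex_dyadic_between by blast
    have "\<bar>b (dyadic k) - b u\<bar> < 1 / real (Suc l)" using k by (intro d(2)) (auto simp: dyadic_nonneg)
    moreover have "1 / real (Suc l) \<le> \<bar>b (dyadic k)\<bar>" using k l by auto
    ultimately show False using u(2) by simp
  qed
qed

end

section \<open>The sigma-algebra of the whole path\<close>

context brownian
begin

abbreviation "paths \<equiv> path_algebra M B"

lemma space_paths: "space paths = space M"
  by (simp add: path_algebra_def)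

lemma measurable_paths_B [measurable]: "0 \<le> t \<Longrightarrow> B t \<in> borel_measurable paths"
proof -
  assume t: "0 \<le> t"
  have "(\<lambda>\<omega>. (\<lambda>t\<in>{0..}. B t \<omega>) t) \<in> borel_measurable paths"
    unfolding path_algebra_def
    by (rule measurable_compose[OF measurable_vimage_algebra1 measurable_component_singleton])
       (use t in \<open>auto simp: space_PiM PiE_def extensional_def\<close>)
  then show ?thesis using t by simp
qed

lemma sets_paths_least:
  assumes "space N = space M" "\<And>t. 0 \<le> t \<Longrightarrow> B t \<in> borel_measurable N"
  shows "sets paths \<subseteq> sets N"
proof -
  have m: "(\<lambda>\<omega>. \<lambda>t\<in>{0..}. B t \<omega>) \<in> measurable N (\<Pi>\<^sub>M t\<in>{0..}. borel)"
    by (rule measurable_restrict) (use assms in auto)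
  show ?thesis
    unfolding path_algebra_def assms(1)[symmetric] sets_vimage_algebra
    by (rule sets.sigma_sets_subset) (use measurable_sets[OF m] in auto)
qed

end

section \<open>Labels of the excursions\<close>

context brownian_unbounded
begin

lemma sets_paths_subset: "sets paths \<subseteq> sets M"
  by (rule sets_paths_least) auto

lemma measurable_paths_imp: "f \<in> measurable paths N \<Longrightarrow> f \<in> measurable M N"
  using sets_paths_subset by (auto simp: measurable_def space_paths)

lemma sets_F_paths: "sets (F t) \<subseteq> sets paths"
  unfolding sets_F space_paths[symmetric]
  by (rule sets.sigma_sets_subset) (auto intro!: measurable_sets[OF measurable_paths_B])

lemma sets_pre_sigma_paths:
  assumes T: "stopping_time F T"
  shows "sets (pre_sigma T) \<subseteq> sets paths"
proof
  fix A assume A: "A \<in> sets (pre_sigma T)"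
  have m: "{\<omega>\<in>A. T \<omega> \<le> real n} \<in> sets paths" for n
    using sets_pre_sigmaD[OF T A] sets_F_paths by blast
  have "A = (\<Union>n::nat. {\<omega>\<in>A. T \<omega> \<le> real n})" using reals_Archimedean2 by (auto intro: less_imp_le)
  moreover have "(\<Union>n::nat. {\<omega>\<in>A. T \<omega> \<le> real n}) \<in> sets paths" by (rule sets.countable_UN) (use m in auto)
  ultimately show "A \<in> sets paths" by (rule ssubst)
qed

lemma measurable_pre_sigma_paths:
  "stopping_time F T \<Longrightarrow> f \<in> measurable (pre_sigma T) N \<Longrightarrow> f \<in> measurable paths N"
  using sets_pre_sigma_paths[of T] by (auto simp: measurable_def space_pre_sigma space_paths)

lemma measurable_paths_\<tau> [measurable]: "\<tau> n \<in> borel_measurable paths"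
  by (rule measurable_pre_sigma_paths[OF stopping_time_\<tau> measurable_pre_sigma_\<tau>])

lemma measurable_paths_R [measurable]: "R n \<in> borel_measurable paths"
  by (rule measurable_pre_sigma_paths[OF stopping_time_\<tau> measurable_pre_sigma_R])

lemma measurable_paths_B_dyadic [measurable]: "B (dyadic k) \<in> borel_measurable paths"
  by (rule measurable_paths_B[OF dyadic_nonneg])

lemma pred_joined:
  assumes [measurable]: "s \<in> borel_measurable paths" "t \<in> borel_measurable paths"
      "(\<lambda>\<omega>. B (s \<omega>) \<omega>) \<in> borel_measurable paths" "(\<lambda>\<omega>. B (t \<omega>) \<omega>) \<in> borel_measurable paths"
    and nonneg: "\<And>\<omega>. \<omega> \<in> space M \<Longrightarrow> 0 \<le> s \<omega>" "\<And>\<omega>. \<omega> \<in> space M \<Longrightarrow> 0 \<le> t \<omega>"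
  shows "Measurable.pred paths (\<lambda>\<omega>. joined (\<lambda>t. B t \<omega>) (s \<omega>) (t \<omega>))"
proof -
  define Q where "Q \<omega> \<longleftrightarrow> B (s \<omega>) \<omega> \<noteq> 0 \<and> B (t \<omega>) \<omega> \<noteq> 0 \<and>
    (\<exists>l::nat. \<forall>k. min (s \<omega>) (t \<omega>) \<le> dyadic k \<and> dyadic k \<le> max (s \<omega>) (t \<omega>) \<longrightarrow> 1 / real (Suc l)
        \<le> \<bar>B (dyadic k) \<omega>\<bar>)" for \<omega>
  have Q: "Measurable.pred paths Q" unfolding Q_def by measurable
  have "joined (\<lambda>t. B t \<omega>) (s \<omega>) (t \<omega>) \<longleftrightarrow> Q \<omega>" if "\<omega> \<in> space paths" for \<omega>
    unfolding Q_def using that nonneg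
    by (intro unbounded_continuous_path.joined_iff_dyadic path) (auto simp: space_paths)
  then show ?thesis
    using Q by (rule measurable_cong[of paths "\<lambda>\<omega>. joined (\<lambda>t. B t \<omega>) (s \<omega>) (t \<omega>)" Q "count_space UNIV", THEN iffD2])
qed

lemma pred_fresh [measurable]: "Measurable.pred paths (\<lambda>\<omega>. fresh (\<lambda>t. B t \<omega>) k)"
proof -
  have [measurable]: "Measurable.pred paths (\<lambda>\<omega>. joined (\<lambda>t. B t \<omega>) (dyadic j) (dyadic k))" for j k
    by (rule pred_joined) (auto simp: dyadic_nonneg)
  show ?thesis unfolding fresh_def by measurable
qed

lemma pred_fresh_rank [measurable]: "Measurable.pred paths (\<lambda>\<omega>. fresh_rank (\<lambda>t. B t \<omega>) k = m)"
proof (induction k arbitrary: m)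
  case (Suc k)
  note [measurable] = Suc
  have "Measurable.pred paths (\<lambda>\<omega>. fresh (\<lambda>t. B t \<omega>) k \<and> 0 < m \<and> fresh_rank (\<lambda>t. B t \<omega>) k = m - 1 \<or>
    \<not> fresh (\<lambda>t. B t \<omega>) k \<and> fresh_rank (\<lambda>t. B t \<omega>) k = m)"
    by measurable
  moreover have "fresh_rank (\<lambda>t. B t \<omega>) (Suc k) = m \<longleftrightarrow> fresh (\<lambda>t. B t \<omega>) k \<and> 0 < m \<and> fresh_rank (\<lambda>t. B t \<omega>) k = m - 1 \<or>
    \<not> fresh (\<lambda>t. B t \<omega>) k \<and> fresh_rank (\<lambda>t. B t \<omega>) k = m" for \<omega>
    by auto
  ultimately show ?case by (simp only:)
qed simp

lemma pred_exc_interval: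
  assumes [measurable]: "t \<in> borel_measurable paths" "(\<lambda>\<omega>. B (t \<omega>) \<omega>) \<in> borel_measurable paths"
    and nonneg: "\<And>\<omega>. \<omega> \<in> space M \<Longrightarrow> 0 \<le> t \<omega>"
  shows "Measurable.pred paths (\<lambda>\<omega>. t \<omega> \<in> exc_interval (\<lambda>t. B t \<omega>) m)"
proof -
  have [measurable]: "Measurable.pred paths (\<lambda>\<omega>. joined (\<lambda>t. B t \<omega>) (dyadic k) (t \<omega>))" for k
    by (rule pred_joined) (use nonneg in \<open>auto simp: dyadic_nonneg\<close>)
  show ?thesis unfolding exc_interval_def mem_Collect_eq by measurable
qed

lemma excursion_enum_exc_interval: "excursion_enum M B (\<lambda>m \<omega>. exc_interval (\<lambda>t. B t \<omega>) m)"
  unfolding excursion_enum_def excursions_def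
proof (intro conjI allI impI)
  show "AE \<omega> in M. bij_betw (exc_interval (\<lambda>t. B t \<omega>)) UNIV (components {t. 0 \<le> t \<and> \<bar>B t \<omega>\<bar> \<noteq> 0})"
    by (intro AE_I2 unbounded_continuous_path.bij_betw_exc_interval path)
  show "{\<omega> \<in> space M. t \<in> exc_interval (\<lambda>t. B t \<omega>) m} \<in> sets paths" if "0 \<le> t" for t m
    using pred_exc_interval[of "\<lambda>_. t" m] that by (simp add: pred_def space_paths)
qed

lemma measurable_exc_index:
  assumes "t \<in> borel_measurable paths" "(\<lambda>\<omega>. B (t \<omega>) \<omega>) \<in> borel_measurable paths"
    and "\<And>\<omega>. \<omega> \<in> space M \<Longrightarrow> 0 \<le> t \<omega>"
  shows "(\<lambda>\<omega>. exc_index (\<lambda>t. B t \<omega>) (t \<omega>)) \<in> measurable paths (count_space UNIV)"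
  unfolding exc_index_def by (rule measurable_Least) (rule pred_exc_interval[OF assms])

text \<open>\<open>R n\<close> is an integer, so the floor only changes the type; a natural number
  is what the conditions on the walk refer to.\<close>

definition height :: "nat \<Rightarrow> 'a \<Rightarrow> nat" where
  "height n \<omega> = nat \<lfloor>\<bar>R n \<omega>\<bar>\<rfloor>"

lemma real_height: "\<omega> \<in> space M \<Longrightarrow> real (height n \<omega>) = \<bar>R n \<omega>\<bar>"
proof -
  assume "\<omega> \<in> space M"
  then have "R n \<omega> \<in> \<int>" unfolding R_def \<tau>_def by (rule unbounded_continuous_path.b_hit_time_Ints[OF path])
  then have "\<bar>R n \<omega>\<bar> \<in> \<int>" by (rule Ints_abs)
  then obtain k where "\<bar>R n \<omega>\<bar> = of_int k" by (auto elim: Ints_cases)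
  then show ?thesis by (simp add: height_def)
qed

lemma height_0_iff: "\<omega> \<in> space M \<Longrightarrow> height n \<omega> = 0 \<longleftrightarrow> R n \<omega> = 0"
  using real_height[of \<omega> n] by (metis abs_eq_0 of_nat_eq_0_iff)

lemma measurable_pre_sigma_height: "height n \<in> measurable (pre_sigma (\<tau> n)) (count_space UNIV)"
proof -
  note [measurable] = measurable_pre_sigma_R[of n]
  show ?thesis unfolding height_def[abs_def] by measurable
qed

lemma measurable_paths_height [measurable]: "height n \<in> measurable paths (count_space UNIV)"
  by (rule measurable_pre_sigma_paths[OF stopping_time_\<tau> measurable_pre_sigma_height])

text \<open>The number of the excursion in progress at time \<open>\<tau> n\<close>; it is
  meaningful where \<open>R n\<close> is not 0.\<close>

definition idx :: "nat \<Rightarrow> 'a \<Rightarrow> nat" where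
  "idx n \<omega> = exc_index (\<lambda>t. B t \<omega>) (\<tau> n \<omega>)"

lemma measurable_paths_idx [measurable]: "idx n \<in> measurable paths (count_space UNIV)"
  unfolding idx_def[abs_def]
  by (rule measurable_exc_index) (use measurable_paths_R[of n] in \<open>auto simp: R_def[abs_def] \<tau>_nonneg\<close>)

lemma \<tau>_exc_interval: "\<omega> \<in> space M \<Longrightarrow> R n \<omega> \<noteq> 0 \<Longrightarrow> \<tau> n \<omega> \<in> exc_interval (\<lambda>t. B t \<omega>) (idx n \<omega>)"
  unfolding idx_def by (intro unbounded_continuous_path.ex_exc_interval path \<tau>_nonneg) (auto simp: R_def)

text \<open>From height at least 1 the path moves by less than 1 before the next hit, so it has no
  zero in between and stays in its excursion.\<close>

lemma idx_Suc:
  assumes \<omega>: "\<omega> \<in> space M" and R: "R n \<omega> \<noteq> 0" "R (Suc n) \<omega> \<noteq> 0"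
  shows "idx (Suc n) \<omega> = idx n \<omega>"
proof -
  have "1 \<le> height n \<omega>" using height_0_iff[OF \<omega>, of n] R by simp
  then have R1: "1 \<le> \<bar>R n \<omega>\<bar>" using real_height[OF \<omega>, of n] by linarith
  have "joined (\<lambda>t. B t \<omega>) (\<tau> n \<omega>) (\<tau> (Suc n) \<omega>)"
    unfolding joined_def
  proof (intro allI impI)
    fix u assume "min (\<tau> n \<omega>) (\<tau> (Suc n) \<omega>) \<le> u \<and> u \<le> max (\<tau> n \<omega>) (\<tau> (Suc n) \<omega>)"
    then have u: "\<tau> n \<omega> \<le> u" "u \<le> \<tau> (Suc n) \<omega>" using \<tau>_less[OF \<omega>, of n] by auto
    show "B u \<omega> \<noteq> 0"
    proof (cases "u = \<tau> (Suc n) \<omega>")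
      case True
      then show ?thesis using R by (simp add: R_def)
    next
      case False
      then have "\<bar>B u \<omega> - R n \<omega>\<bar> < 1"
        using unbounded_continuous_path.hit_before[OF path[OF \<omega>], of n u] u by (simp add: \<tau>_def R_def)
      then show ?thesis using R1 by auto
    qed
  qed
  from joined_exc_interval[OF \<tau>_exc_interval[OF \<omega> R(1)] this \<tau>_nonneg[OF \<omega>]]
  have "\<tau> (Suc n) \<omega> \<in> exc_interval (\<lambda>t. B t \<omega>) (idx n \<omega>)" .
  then show ?thesis unfolding idx_def[of "Suc n"] by (rule exc_index_eq)
qed

lemma \<tau>_strict_mono: "\<omega> \<in> space M \<Longrightarrow> i < j \<Longrightarrow> \<tau> i \<omega> < \<tau> j \<omega>"
  by (rule lift_Suc_mono_less[of "\<lambda>n. \<tau> n \<omega>"]) (auto intro: \<tau>_less)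

text \<open>The zero at time \<open>\<tau> n\<close> separates every earlier \<open>\<tau> k\<close>
  from \<open>\<tau> (Suc n)\<close>, so these times cannot share an excursion.\<close>

lemma idx_new:
  assumes \<omega>: "\<omega> \<in> space M" and R: "R n \<omega> = 0" "R (Suc n) \<omega> \<noteq> 0" and k: "k \<le> n" "R k \<omega> \<noteq> 0"
  shows "idx k \<omega> \<noteq> idx (Suc n) \<omega>"
proof
  assume eq: "idx k \<omega> = idx (Suc n) \<omega>"
  have "k < n" using R k by (cases "k = n") auto
  then have lt: "\<tau> k \<omega> < \<tau> n \<omega>" "\<tau> n \<omega> < \<tau> (Suc n) \<omega>" using \<tau>_strict_mono[OF \<omega>] by auto
  have "joined (\<lambda>t. B t \<omega>) (\<tau> k \<omega>) (\<tau> (Suc n) \<omega>)"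
    using exc_interval_joined[OF \<tau>_exc_interval[OF \<omega> k(2)] \<tau>_exc_interval[OF \<omega> R(2), folded eq]] .
  then have "B (\<tau> n \<omega>) \<omega> \<noteq> 0" using lt by (auto simp: joined_def)
  then show False using R by (simp add: R_def)
qed

text \<open>The event is split by the sign of \<open>R n\<close>; on each part the required change
  of height is one particular sign of the step, which has probability one half. The form
  \<open>r = Suc q\<close> keeps the height positive; at 0 both steps lead upwards.\<close>

lemma prob_height_step:
  assumes A: "A \<in> sets (pre_sigma (\<tau> n))" and r: "r = Suc q"
    and h: "\<And>\<omega>. \<omega> \<in> A \<Longrightarrow> height n \<omega> = r" and r': "r' = r + 1 \<or> r' = r - 1"
  shows "prob (A \<inter> {\<omega>\<in>space M. height (Suc n) \<omega> = r'}) = prob A / 2"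
proof -
  have AM [measurable]: "A \<in> sets M" using A sets_pre_sigma_subset[OF stopping_time_\<tau>] by auto
  have [measurable]: "height (Suc n) \<in> measurable M (count_space UNIV)"
      by (rule measurable_paths_imp[OF measurable_paths_height])
  have Asp: "\<omega> \<in> space M" if "\<omega> \<in> A" for \<omega> using sets.sets_into_space[OF AM] that by auto
  have signed: "prob ((A \<inter> {\<omega>\<in>space M. R n \<omega> = s * real r}) \<inter> {\<omega>\<in>space M. height (Suc n) \<omega> = r'})
      = prob (A \<inter> {\<omega>\<in>space M. R n \<omega> = s * real r}) / 2"
    (is "prob (?A s \<inter> _) = _") if s: "s = 1 \<or> s = - 1" for s :: real
  proof -
    have "{\<omega>\<in>space (pre_sigma (\<tau> n)). R n \<omega> = s * real r} \<in> sets (pre_sigma (\<tau> n))"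
    proof -
      note [measurable] = measurable_pre_sigma_R[of n]
      show ?thesis by measurable
    qed
    then have A': "?A s \<in> sets (pre_sigma (\<tau> n))" using A by (auto simp: space_pre_sigma)
    \<comment> \<open>Moving outwards means stepping in the direction of the sign \<open>s\<close>,
      moving inwards against it.\<close>
    define e :: real where "e = (if r' = r + 1 then s else - s)"
    have e: "e = 1 \<or> e = - 1" using s by (auto simp: e_def)
    have iff: "height (Suc n) \<omega> = r' \<longleftrightarrow> R (Suc n) \<omega> = R n \<omega> + e" if "\<omega> \<in> ?A s" for \<omega>
    proof -
      have \<omega>: "\<omega> \<in> space M" and Rn: "R n \<omega> = s * real r" using that by auto
      have "height (Suc n) \<omega> = r' \<longleftrightarrow> \<bar>R (Suc n) \<omega>\<bar> = real r'"
        using real_height[OF \<omega>, of "Suc n"] by (metis of_nat_eq_iff)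
      moreover have "real r' = (if r' = r + 1 then real r + 1 else real r - 1)" using r r' by auto
      moreover have "R (Suc n) \<omega> = R n \<omega> + 1 \<or> R (Suc n) \<omega> = R n \<omega> - 1" using abs_R_step[OF \<omega>, of n] by linarith
      moreover have "real r \<ge> 1" using r by simp
      ultimately show ?thesis using s Rn by (auto simp: e_def)
    qed
    have "?A s \<inter> {\<omega>\<in>space M. height (Suc n) \<omega> = r'} = ?A s \<inter> {\<omega>\<in>space M. R (Suc n) \<omega> = R n \<omega> + e}"
      using iff by blast
    then show ?thesis using prob_R_step[OF A' e] by simp
  qed
  have r0: "real r > 0" using r by simp
  have AU: "A = ?A 1 \<union> ?A (- 1)"
  proof (intro set_eqI iffI)
    fix \<omega> assume \<omega>: "\<omega> \<in> A"
    have "\<bar>R n \<omega>\<bar> = real r" using real_height[OF Asp[OF \<omega>], of n] h[OF \<omega>] by simp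
    then have "R n \<omega> = 1 * real r \<or> R n \<omega> = - 1 * real r" by auto
    then show "\<omega> \<in> ?A 1 \<union> ?A (- 1)" using \<omega> Asp[OF \<omega>] by blast
  qed blast
  have disj: "?A 1 \<inter> ?A (- 1) = {}" using r0 by auto
  have m [measurable]: "?A s \<in> sets M" for s by measurable
  have p1: "prob A = prob (?A 1) + prob (?A (- 1))"
    by (subst AU, rule finite_measure_Union[OF m m disj])
  have e1: "A \<inter> {\<omega>\<in>space M. height (Suc n) \<omega> = r'} =
     (?A 1 \<inter> {\<omega>\<in>space M. height (Suc n) \<omega> = r'}) \<union> (?A (- 1) \<inter> {\<omega>\<in>space M. height (Suc n) \<omega> = r'})"
    by (subst AU) (rule Int_Un_distrib2)
  have p2: "prob ((?A 1 \<inter> {\<omega>\<in>space M. height (Suc n) \<omega> = r'}) \<union> (?A (- 1) \<inter> {\<omega>\<in>space M. height (Suc n) \<omega>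
      = r'})) = prob (?A 1 \<inter> {\<omega>\<in>space M. height (Suc n) \<omega> = r'}) + prob (?A (- 1) \<inter> {\<omega>\<in>space M. height (Suc n)
      \<omega> = r'})"
    by (rule finite_measure_Union) (use disj in auto)
  show ?thesis
    unfolding e1 p2 signed[of 1, OF disjI1[OF refl]] signed[of "- 1", OF disjI2[OF refl]] unfolding p1
    by (rule add_divide_distrib[symmetric])
qed

end

text \<open>\<open>h\<close> is a sequence of heights, \<open>m\<close> the indices of the excursions that contain the points of
  nonzero height: the index changes exactly at visits to \<open>0\<close>, and then to one not used before.\<close>

definition compatible :: "nat \<Rightarrow> (nat \<Rightarrow> nat) \<Rightarrow> (nat \<Rightarrow> nat) \<Rightarrow> bool" where
  "compatible n h m \<longleftrightarrow> (\<forall>i<n. 0 < h (Suc i) \<longrightarrow>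
     (if 0 < h i then m (Suc i) = m i else (\<forall>k\<le>i. 0 < h k \<longrightarrow> m k \<noteq> m (Suc i))))"

text \<open>The conditional probability of the labels \<open>l\<close> given the heights
  \<open>h\<close>: a factor \<open>p\<close> whenever the walk leaves the body, and the requirement
  of constancy along an excursion. At height 0 the factor is 1, since the body belongs to every
  leg.\<close>

fun label_weight :: "(nat \<Rightarrow> real) \<Rightarrow> (nat \<Rightarrow> nat) \<Rightarrow> (nat \<Rightarrow> nat) \<Rightarrow> nat \<Rightarrow> real" where
  "label_weight p h l 0 = 1"
| "label_weight p h l (Suc n) = label_weight p h l n *
     (if h (Suc n) = 0 then 1 else if h n = 0 then p (l (Suc n)) else if l (Suc n) = l n then 1 else 0)"

section \<open>Independent labels attached to the excursions\<close>

locale labelled_brownian = brownian_unbounded +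
  fixes N :: nat and p :: "nat \<Rightarrow> real" and \<kappa> :: "nat \<Rightarrow> 'a \<Rightarrow> nat"
  assumes N: "1 \<le> N" and labels: "leg_labels N p M B \<kappa>"
begin

lemma \<kappa>_range: "\<omega> \<in> space M \<Longrightarrow> \<kappa> m \<omega> \<in> {1..N}"
  using labels by (simp add: leg_labels_def)

lemma indep_\<kappa>: "indep_vars (\<lambda>_. count_space UNIV) \<kappa> UNIV"
  using labels by (simp add: leg_labels_def)

lemma measurable_\<kappa> [measurable]: "\<kappa> m \<in> measurable M (count_space UNIV)"
  using indep_\<kappa> by (simp add: indep_vars_def)

lemma prob_\<kappa>: "j \<in> {1..N} \<Longrightarrow> prob {\<omega>\<in>space M. \<kappa> m \<omega> = j} = p j"
  using labels by (simp add: leg_labels_def)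

definition label_algebra :: "'a measure" where
  "label_algebra = vimage_algebra (space M) (\<lambda>\<omega> m. \<kappa> m \<omega>) (\<Pi>\<^sub>M m\<in>UNIV. count_space UNIV)"

lemma indep_paths_labels: "indep_set (sets paths) (sets label_algebra)"
  using labels by (simp add: leg_labels_def label_algebra_def)

lemma measurable_label_algebra_\<kappa> [measurable]: "\<kappa> m \<in> measurable label_algebra (count_space UNIV)"
proof -
  have "(\<lambda>\<omega>. (\<lambda>m. \<kappa> m \<omega>) m) \<in> measurable label_algebra (count_space UNIV)"
    unfolding label_algebra_def
    by (rule measurable_compose[OF measurable_vimage_algebra1 measurable_component_singleton]) (auto simp: space_PiM)
  then show ?thesis by simp
qed

lemma space_label_algebra: "space label_algebra = space M"
  by (simp add: label_algebra_def)

text \<open>The list \<open>m\<close> of excursion numbers is deterministic here, so the event is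
  decided by the labels alone and is independent of the path.\<close>

definition label_event :: "nat \<Rightarrow> (nat \<Rightarrow> nat) \<Rightarrow> (nat \<Rightarrow> nat) \<Rightarrow> (nat \<Rightarrow> nat) \<Rightarrow> 'a set" where
  "label_event n h l m = {\<omega>\<in>space M. \<forall>i\<le>n. 0 < h i \<longrightarrow> \<kappa> (m i) \<omega> = l i}"

lemma sets_label_event: "label_event n h l m \<in> sets label_algebra"
  unfolding label_event_def space_label_algebra[symmetric] by measurable

lemma prob_label_event_new:
  assumes new: "\<And>k. k \<le> n \<Longrightarrow> 0 < h k \<Longrightarrow> m k \<noteq> q"
  shows "prob (label_event n h l m \<inter> {\<omega>\<in>space M. \<kappa> q \<omega> = j}) = prob (label_event n h l m) * prob {\<omega>\<in>space M. \<kappa>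
      q \<omega> = j}"
proof -
  define I where "I = m ` {k. k \<le> n \<and> 0 < h k}"
  define A where "A i = (if i = q then {j} else {x. \<forall>k\<le>n. 0 < h k \<and> m k = i \<longrightarrow> x = l k})" for i
  have fin: "finite I" by (simp add: I_def)
  have q: "q \<notin> I" using new by (auto simp: I_def)
  have Q: "{\<omega>\<in>space M. \<kappa> q \<omega> = j} = \<kappa> q -` A q \<inter> space M" by (auto simp: A_def)
  have AI: "A i = {x. \<forall>k\<le>n. 0 < h k \<and> m k = i \<longrightarrow> x = l k}" if "i \<in> I" for i using that q by (auto simp: A_def)
  show ?thesis
  proof (cases "I = {}")
    case True
    then have "label_event n h l m = space M" by (auto simp: label_event_def I_def)
    moreover have "space M \<inter> {\<omega>\<in>space M. \<kappa> q \<omega> = j} = {\<omega>\<in>space M. \<kappa> q \<omega> = j}" by auto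
    ultimately show ?thesis by (simp add: prob_space)
  next
    case False
    have L: "label_event n h l m = (\<Inter>i\<in>I. \<kappa> i -` A i \<inter> space M)"
    proof (intro set_eqI iffI)
      fix \<omega> assume "\<omega> \<in> label_event n h l m"
      then show "\<omega> \<in> (\<Inter>i\<in>I. \<kappa> i -` A i \<inter> space M)" by (auto simp: label_event_def AI)
    next
      fix \<omega> assume *: "\<omega> \<in> (\<Inter>i\<in>I. \<kappa> i -` A i \<inter> space M)"
      have "\<kappa> (m k) \<omega> = l k" if "k \<le> n" "0 < h k" for k
      proof -
        have "m k \<in> I" using that by (auto simp: I_def)
        then show ?thesis using * AI that by blast
      qed
      then show "\<omega> \<in> label_event n h l m" using * False by (auto simp: label_event_def)
    qed
    have "prob (\<Inter>i\<in>insert q I. \<kappa> i -` A i \<inter> space M) = (\<Prod>i\<in>insert q I. prob (\<kappa> i -` A i \<inter> space M))"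
      by (rule indep_varsD[OF indep_\<kappa>]) (use fin in auto)
    moreover have "prob (\<Inter>i\<in>I. \<kappa> i -` A i \<inter> space M) = (\<Prod>i\<in>I. prob (\<kappa> i -` A i \<inter> space M))"
      by (rule indep_varsD[OF indep_\<kappa>]) (use fin False in auto)
    moreover have "label_event n h l m \<inter> {\<omega>\<in>space M. \<kappa> q \<omega> = j} = (\<Inter>i\<in>insert q I. \<kappa> i -` A i \<inter> space M)"
      unfolding L Q by blast
    ultimately show ?thesis using fin q by (simp add: L Q)
  qed
qed

text \<open>Induction on \<open>n\<close>, following the cases of \<open>label_weight\<close>:
  compatibility makes the number new when the walk leaves the body, and repeats it along an
  excursion, where the new condition is either implied or contradictory.\<close>

lemma prob_label_event:
  assumes h0: "h 0 = 0" and l: "\<And>i. i \<le> n \<Longrightarrow> 0 < h i \<Longrightarrow> l i \<in> {1..N}" and c: "compatible n h m"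
  shows "prob (label_event n h l m) = label_weight p h l n"
  using l c
proof (induction n)
  case 0
  then show ?case using h0 by (simp add: label_event_def prob_space)
next
  case (Suc n)
  have IH: "prob (label_event n h l m) = label_weight p h l n"
    using Suc by (intro Suc.IH) (auto simp: compatible_def)
  have step: "0 < h (Suc n) \<Longrightarrow> (if 0 < h n then m (Suc n) = m n else (\<forall>k\<le>n. 0 < h k \<longrightarrow> m k \<noteq> m (Suc n)))"
    using Suc.prems(2) by (auto simp: compatible_def)
  have L: "label_event (Suc n) h l m = (if 0 < h (Suc n) then label_event n h l m \<inter> {\<omega>\<in>space M. \<kappa> (m (Suc n)) \<omega>
      = l (Suc n)} else label_event n h l m)"
    by (auto simp: label_event_def le_Suc_eq)
  consider "h (Suc n) = 0" | "0 < h (Suc n)" "h n = 0" | "0 < h (Suc n)" "0 < h n" "l (Suc n)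
      = l n" | "0 < h (Suc n)" "0 < h n" "l (Suc n) \<noteq> l n"
    by blast
  then show ?case
  proof cases
    case 1
    then show ?thesis using IH L by simp
  next
    case 2
    then have "\<And>k. k \<le> n \<Longrightarrow> 0 < h k \<Longrightarrow> m k \<noteq> m (Suc n)" using step by auto
    then have "prob (label_event n h l m \<inter> {\<omega>\<in>space M. \<kappa> (m (Suc n)) \<omega> = l (Suc n)}) = label_weight p h l n * p
        (l (Suc n))"
      using prob_label_event_new[where n=n and h=h and m=m and q="m (Suc n)" and l=l and j="l (Suc n)"] IH
        prob_\<kappa>[OF Suc.prems(1)[OF le_refl 2(1)], of "m (Suc n)"] by simp
    then show ?thesis using 2 L by simp
  next
    case 3
    then have "label_event n h l m \<inter> {\<omega>\<in>space M. \<kappa> (m (Suc n)) \<omega> = l (Suc n)} = label_event n h l m"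
      using step by (auto simp: label_event_def)
    then show ?thesis using 3 IH L by simp
  next
    case 4
    then have "label_event n h l m \<inter> {\<omega>\<in>space M. \<kappa> (m (Suc n)) \<omega> = l (Suc n)} = {}"
      using step by (auto simp: label_event_def)
    then show ?thesis using 4 L by simp
  qed
qed

definition label :: "nat \<Rightarrow> 'a \<Rightarrow> nat" where
  "label n \<omega> = \<kappa> (idx n \<omega>) \<omega>"

lemma compatible_idx: "\<omega> \<in> space M \<Longrightarrow> compatible n (\<lambda>i. height i \<omega>) (\<lambda>i. idx i \<omega>)"
  unfolding compatible_def using height_0_iff idx_Suc idx_new by (auto simp: neq0_conv[symmetric] simp del: neq0_conv)

lemma compatible_cong:
  assumes "\<And>i. i \<le> n \<Longrightarrow> h i = h' i" "\<And>i. i \<le> n \<Longrightarrow> m i = m' i"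
  shows "compatible n h m \<longleftrightarrow> compatible n h' m'"
  unfolding compatible_def using assms by (intro all_cong imp_cong refl if_cong) (auto simp: Suc_le_eq)

text \<open>Given the path, the labels of the finitely many excursions visited are those of distinct
  indices; summing over the possible index lists decouples them from the path.\<close>

lemma prob_labels:
  assumes E: "E \<in> sets paths" and h: "\<And>\<omega> i. \<omega> \<in> E \<Longrightarrow> i \<le> n \<Longrightarrow> height i \<omega> = h i"
    and h0: "h 0 = 0" and l: "\<And>i. i \<le> n \<Longrightarrow> 0 < h i \<Longrightarrow> l i \<in> {1..N}"
  shows "prob (E \<inter> {\<omega>\<in>space M. \<forall>i\<le>n. 0 < h i \<longrightarrow> label i \<omega> = l i}) = prob E * label_weight p h l n"
proof -
  \<comment> \<open>The excursion numbers up to time \<open>n\<close> form a list, so there are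
    countably many values. On the cell \<open>Ev v\<close> of one value the random numbers may be
    replaced by the entries of \<open>v\<close>, which turns the event into a
    \<open>label_event\<close>.\<close>
  define g where "g \<omega> = map (\<lambda>i. idx i \<omega>) [0..<Suc n]" for \<omega>
  define Ev where "Ev v = E \<inter> {\<omega>\<in>space M. g \<omega> = v}" for v
  define L where "L = {\<omega>\<in>space M. \<forall>i\<le>n. 0 < h i \<longrightarrow> label i \<omega> = l i}"
  have Esp: "E \<subseteq> space M" using sets.sets_into_space[OF E] by (simp add: space_paths)
  have Ev: "Ev v \<in> sets paths" for v
  proof -
    have "{\<omega>\<in>space M. g \<omega> = v} = {\<omega>\<in>space paths. length v = Suc n \<and> (\<forall>i\<in>{..n}. idx i \<omega> = v ! i)}"
      unfolding g_def by (auto simp: list_eq_iff_nth_eq less_Suc_eq_le space_paths simp del: upt_Suc)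
    also have "\<dots> \<in> sets paths" by measurable
    finally show ?thesis unfolding Ev_def using E by blast
  qed
  have EvM: "Ev v \<in> sets M" for v using Ev sets_paths_subset by blast
  have lab_meas: "label i \<in> measurable M (count_space UNIV)" for i
    unfolding label_def[abs_def]
    by (rule measurable_compose_countable[OF _ measurable_paths_imp[OF measurable_paths_idx]]) simp
  have LM: "L \<in> sets M" unfolding L_def using lab_meas by measurable
  have split: "A = (\<Union>v. A \<inter> Ev v)" if "A \<subseteq> E" for A using that Esp by (auto simp: Ev_def)
  have disj: "disjoint_family (\<lambda>v. A \<inter> Ev v)" for A by (auto simp: disjoint_family_on_def Ev_def)
  have each: "emeasure M ((E \<inter> L) \<inter> Ev v) = emeasure M (E \<inter> Ev v) * ennreal (label_weight p h l n)" for v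
  proof (cases "Ev v = {}")
    case False
    then obtain \<omega>0 where \<omega>0: "\<omega>0 \<in> E" "\<omega>0 \<in> space M" "g \<omega>0 = v" by (auto simp: Ev_def)
    have vi: "v ! i = idx i \<omega>" if "g \<omega> = v" "i \<le> n" for i \<omega>
      using that unfolding g_def by (auto simp: less_Suc_eq_le simp del: upt_Suc)
    \<comment> \<open>Compatibility is a property of the actual heights and numbers of any path; a
      nonempty cell passes it on to \<open>v\<close>.\<close>
    have comp: "compatible n h (\<lambda>i. v ! i)"
      by (rule iffD2[OF compatible_cong[of n h "\<lambda>i. height i \<omega>0" _ "\<lambda>i. idx i \<omega>0"] compatible_idx[OF \<omega>0(2)]])
        (use h[OF \<omega>0(1)] vi[OF \<omega>0(3)] in auto)
    have "(E \<inter> L) \<inter> Ev v = Ev v \<inter> label_event n h l (\<lambda>i. v ! i)"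
      using vi by (auto simp: Ev_def L_def label_event_def label_def)
    then have "prob ((E \<inter> L) \<inter> Ev v) = prob (Ev v) * prob (label_event n h l (\<lambda>i. v ! i))"
      using indep_setD[OF indep_paths_labels Ev sets_label_event] by simp
    also have "prob (label_event n h l (\<lambda>i. v ! i)) = label_weight p h l n"
      by (rule prob_label_event[OF h0 l comp])
    finally have "prob ((E \<inter> L) \<inter> Ev v) = prob (Ev v) * label_weight p h l n" .
    moreover have "E \<inter> Ev v = Ev v" by (auto simp: Ev_def)
    ultimately show ?thesis by (simp add: emeasure_eq_measure ennreal_mult')
  qed simp
  have EM: "E \<in> sets M" using E sets_paths_subset by blast
  have sum: "emeasure M A = (\<integral>\<^sup>+v. emeasure M (A \<inter> Ev v) \<partial>count_space UNIV)" if "A \<subseteq> E" "A \<in> sets M" for A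
  proof -
    have "emeasure M A = emeasure M (\<Union>v. A \<inter> Ev v)" using split[OF that(1)] by (rule arg_cong)
    also have "\<dots> = (\<integral>\<^sup>+v. emeasure M (A \<inter> Ev v) \<partial>count_space UNIV)"
      by (rule emeasure_UN_countable) (use that EvM disj in auto)
    finally show ?thesis .
  qed
  have "emeasure M (E \<inter> L) = (\<integral>\<^sup>+v. emeasure M ((E \<inter> L) \<inter> Ev v) \<partial>count_space UNIV)"
    by (rule sum) (use EM LM in auto)
  also have "\<dots> = (\<integral>\<^sup>+v. emeasure M (E \<inter> Ev v) * ennreal (label_weight p h l n) \<partial>count_space UNIV)"
    by (simp only: each)
  also have "\<dots> = (\<integral>\<^sup>+v. emeasure M (E \<inter> Ev v) \<partial>count_space UNIV) * ennreal (label_weight p h l n)"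
    by (rule nn_integral_multc) simp
  also have "(\<integral>\<^sup>+v. emeasure M (E \<inter> Ev v) \<partial>count_space UNIV) = emeasure M E"
    by (rule sum[symmetric]) (use EM in auto)
  finally have e: "emeasure M (E \<inter> L) = emeasure M E * ennreal (label_weight p h l n)" .
  \<comment> \<open>Returning from \<open>ennreal\<close> to real numbers requires a nonnegative
    weight. For nonempty \<open>E\<close> the weight is itself a probability, namely that of the
    label event along some path in \<open>E\<close>.\<close>
  show ?thesis
  proof (cases "E = {}")
    case False
    then obtain \<omega>0 where \<omega>0: "\<omega>0 \<in> E" by auto
    have "compatible n h (\<lambda>i. idx i \<omega>0)"
      by (rule iffD2[OF compatible_cong[of n h "\<lambda>i. height i \<omega>0"] compatible_idx]) (use h[OF \<omega>0] Esp \<omega>0 in auto)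
    from prob_label_event[OF h0 l this] have "label_weight p h l n = prob (label_event n h l (\<lambda>i. idx i \<omega>0))"
        by (rule sym)
    then have "0 \<le> label_weight p h l n" by simp
    then have "ennreal (prob (E \<inter> L)) = ennreal (prob E * label_weight p h l n)"
      using e by (simp add: emeasure_eq_measure ennreal_mult)
    then show ?thesis using \<open>0 \<le> label_weight p h l n\<close> by (simp add: L_def)
  qed simp
qed

definition spider_path :: "real \<Rightarrow> 'a \<Rightarrow> complex" where
  "spider_path t \<omega> = (if B t \<omega> = 0 then 0 else spider_pt N \<bar>B t \<omega>\<bar> (\<kappa> (exc_index (\<lambda>t. B t \<omega>) t) \<omega>))"

definition embedded_walk :: "nat \<Rightarrow> 'a \<Rightarrow> complex" where
  "embedded_walk n \<omega> = spider_path (\<tau> n \<omega>) \<omega>"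

lemma embedded_walk_eq:
  assumes "\<omega> \<in> space M"
  shows "embedded_walk n \<omega> = spider_pt N (real (height n \<omega>)) (label n \<omega>)"
  unfolding embedded_walk_def spider_path_def label_def idx_def real_height[OF assms] R_def by simp

lemma measurable_spider_pt [measurable]:
  assumes [measurable]: "f \<in> borel_measurable M'" "g \<in> measurable M' (count_space UNIV)"
  shows "(\<lambda>\<omega>. spider_pt N (f \<omega>) (g \<omega>)) \<in> borel_measurable M'"
proof (rule measurable_compose_countable[where f="\<lambda>j \<omega>. spider_pt N (f \<omega>) j" and g=g])
  show "(\<lambda>\<omega>. spider_pt N (f \<omega>) j) \<in> borel_measurable M'" for j
    unfolding spider_pt_def by measurable
qed simp

lemma measurable_spider_path [measurable]: "0 \<le> t \<Longrightarrow> spider_path t \<in> borel_measurable M"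
proof -
  assume t: "0 \<le> t"
  have [measurable]: "(\<lambda>\<omega>. \<kappa> (exc_index (\<lambda>t. B t \<omega>) t) \<omega>) \<in> measurable M (count_space UNIV)"
    by (rule measurable_compose_countable[OF _ measurable_paths_imp[OF measurable_exc_index]]) (use t in auto)
  show ?thesis unfolding spider_path_def[abs_def] using t by measurable
qed

lemma brownian_spider_spider_path: "brownian_spider N p M spider_path"
  unfolding brownian_spider_def
proof (intro conjI allI impI ballI exI)
  show "spider_path t \<in> borel_measurable M" if "0 \<le> t" for t using that by (rule measurable_spider_path)
  show "spider_path t \<omega> \<in> spider N" if "0 \<le> t" "\<omega> \<in> space M" for t \<omega>
  proof (cases "B t \<omega> = 0")
    case True
    have "spider_pt N 0 1 \<in> spider N"
      unfolding spider_def leg_def by (rule UN_I[of 1]) (use N in \<open>auto intro!: exI[of _ 0]\<close>)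
    then show ?thesis using True by (simp add: spider_path_def)
  next
    case False
    have "spider_pt N \<bar>B t \<omega>\<bar> j \<in> spider N" if "j \<in> {1..N}" for j
      unfolding spider_def leg_def by (rule UN_I[OF that]) auto
    from this[OF \<kappa>_range[OF that(2)]] show ?thesis using False by (simp add: spider_path_def)
  qed
  show "brownian_motion M B" by (rule bm)
  show "excursion_enum M B (\<lambda>m \<omega>. exc_interval (\<lambda>t. B t \<omega>) m)" by (rule excursion_enum_exc_interval)
  show "leg_labels N p M B \<kappa>" by (rule labels)
  show "spider_path t \<omega> = 0" if "B t \<omega> = 0" for t \<omega> using that by (simp add: spider_path_def)
  show "spider_path t \<omega> = spider_pt N \<bar>B t \<omega>\<bar> (\<kappa> m \<omega>)"
    if "B t \<omega> \<noteq> 0 \<and> t \<in> exc_interval (\<lambda>t. B t \<omega>) m" for t \<omega> m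
    using that exc_index_eq[of t "\<lambda>t. B t \<omega>" m] by (simp add: spider_path_def)
qed

end

section \<open>The embedded walk on the spider\<close>

lemma spider_pt_eq_iff:
  assumes "j \<in> {1..N}" "k \<in> {1..N}"
  shows "spider_pt N (real a) j = spider_pt N (real b) k \<longleftrightarrow> a = b \<and> (0 < b \<longrightarrow> j = k)"
proof
  assume eq: "spider_pt N (real a) j = spider_pt N (real b) k"
  then have "cmod (spider_pt N (real a) j) = cmod (spider_pt N (real b) k)" by simp
  then have "a = b" by simp
  moreover have "j = k" if "0 < b" using spider_pt_inj[OF assms _ _ eq] that \<open>a = b\<close> by simp
  ultimately show "a = b \<and> (0 < b \<longrightarrow> j = k)" by blast
qed (cases "b = 0"; simp)

context labelled_brownian
begin

lemma height_0: "\<omega> \<in> space M \<Longrightarrow> height 0 \<omega> = 0"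
  using bm by (simp add: height_0_iff R_def \<tau>_def brownian_motion_def)

lemma label_range: "\<omega> \<in> space M \<Longrightarrow> label n \<omega> \<in> {1..N}"
  unfolding label_def by (rule \<kappa>_range)

lemma measurable_label [measurable]: "label n \<in> measurable M (count_space UNIV)"
  unfolding label_def[abs_def]
  by (rule measurable_compose_countable[OF _ measurable_paths_imp[OF measurable_paths_idx]]) simp

lemma measurable_height [measurable]: "height n \<in> measurable M (count_space UNIV)"
  by (rule measurable_paths_imp[OF measurable_paths_height])

lemma measurable_embedded_walk [measurable]: "embedded_walk n \<in> borel_measurable M"
proof -
  have [measurable]: "(\<lambda>\<omega>. real (height n \<omega>)) \<in> borel_measurable M"
    by (rule measurable_compose[OF measurable_height]) simp
  show ?thesis
    by (rule iffD2[OF measurable_cong measurable_spider_pt]) (auto simp: embedded_walk_eq)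
qed

definition height_event :: "nat \<Rightarrow> (nat \<Rightarrow> nat) \<Rightarrow> 'a set" where
  "height_event n h = {\<omega>\<in>space M. \<forall>i\<le>n. height i \<omega> = h i}"

definition walk_event :: "nat \<Rightarrow> (nat \<Rightarrow> nat) \<Rightarrow> (nat \<Rightarrow> nat) \<Rightarrow> 'a set" where
  "walk_event n h l = {\<omega>\<in>space M. \<forall>i\<le>n. embedded_walk i \<omega> = spider_pt N (real (h i)) (l i)}"

lemma sets_height_event: "height_event n h \<in> sets (pre_sigma (\<tau> n))"
proof -
  have m: "height i \<in> measurable (pre_sigma (\<tau> n)) (count_space UNIV)" if "i \<le> n" for i
    using measurable_pre_sigma_height[of i] sets_pre_sigma_\<tau>_mono[OF that]
        by (auto simp: measurable_def space_pre_sigma)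
  have "{\<omega>\<in>space (pre_sigma (\<tau> n)). height i \<omega> = h i} \<in> sets (pre_sigma (\<tau> n))" if "i \<le> n" for i
    using m[OF that] by measurable
  then have "(\<Inter>i\<in>{..n}. {\<omega>\<in>space (pre_sigma (\<tau> n)). height i \<omega> = h i}) \<in> sets (pre_sigma (\<tau> n))"
    by (intro sets.finite_INT) auto
  moreover have "(\<Inter>i\<in>{..n}. {\<omega>\<in>space (pre_sigma (\<tau> n)). height i \<omega> = h i}) = height_event n h"
    by (auto simp: height_event_def space_pre_sigma)
  ultimately show ?thesis by simp
qed

text \<open>A point of the spider determines its height and, away from the body, its label. The
  heights are decided by the path, so the labels contribute the factor
  \<open>label_weight\<close>.\<close>

lemma prob_walk_event:
  assumes h0: "h 0 = 0" and l: "\<And>i. i \<le> n \<Longrightarrow> l i \<in> {1..N}"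
  shows "prob (walk_event n h l) = prob (height_event n h) * label_weight p h l n"
proof -
  have "walk_event n h l = height_event n h \<inter> {\<omega>\<in>space M. \<forall>i\<le>n. 0 < h i \<longrightarrow> label i \<omega> = l i}"
  proof (intro set_eqI)
    fix \<omega>
    have "embedded_walk i \<omega> = spider_pt N (real (h i)) (l i) \<longleftrightarrow> height i \<omega> = h i \<and> (0 < h i \<longrightarrow> label i \<omega> = l i)"
      if "\<omega> \<in> space M" "i \<le> n" for i
      unfolding embedded_walk_eq[OF that(1)] by (rule spider_pt_eq_iff[OF label_range[OF that(1)] l[OF that(2)]])
    then show "\<omega> \<in> walk_event n h l \<longleftrightarrow> \<omega> \<in> height_event n h \<inter> {\<omega>\<in>space M. \<forall>i\<le>n. 0 < h i \<longrightarrow> label i \<omega> = l i}"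
      unfolding walk_event_def height_event_def by blast
  qed
  moreover have "prob (height_event n h \<inter> {\<omega>\<in>space M. \<forall>i\<le>n. 0 < h i \<longrightarrow> label i \<omega> = l i})
      = prob (height_event n h) * label_weight p h l n"
  proof (rule prob_labels[where h=h, OF _ _ h0 l])
    show "height_event n h \<in> sets paths"
      by (rule subsetD[OF sets_pre_sigma_paths[OF stopping_time_\<tau>] sets_height_event])
  qed (simp_all add: height_event_def)
  ultimately show ?thesis by simp
qed

lemma height_event_Suc: "height_event (Suc n) h = height_event n h \<inter> {\<omega>\<in>space M. height (Suc n) \<omega> = h (Suc n)}"
  by (auto simp: height_event_def le_Suc_eq)

text \<open>From height 0 the next height is 1 with certainty, so all the randomness of this step
  sits in the new label.\<close>

lemma prob_walk_event_from_0:
  assumes h0: "h 0 = 0" and l: "\<And>i. i \<le> Suc n \<Longrightarrow> l i \<in> {1..N}" and h: "h n = 0" "h (Suc n) = 1"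
  shows "prob (walk_event (Suc n) h l) = prob (walk_event n h l) * p (l (Suc n))"
proof -
  have "height (Suc n) \<omega> = 1" if "\<omega> \<in> height_event n h" for \<omega>
  proof -
    have \<omega>: "\<omega> \<in> space M" and "height n \<omega> = 0" using that h by (auto simp: height_event_def)
    then have "R n \<omega> = 0" by (simp add: height_0_iff)
    then have "real (height (Suc n) \<omega>) = 1" using abs_R_step[OF \<omega>, of n] real_height[OF \<omega>, of "Suc n"] by simp
    then show ?thesis by simp
  qed
  then have "height_event (Suc n) h = height_event n h"
    unfolding height_event_Suc h(2) by (auto simp: height_event_def)
  then show ?thesis using prob_walk_event[of h "Suc n" l, OF h0] prob_walk_event[of h n l, OF h0] l h by simp
qed

text \<open>The label is carried along, so the weight does not change, also when the step ends at
  the body; the factor one half comes from the heights.\<close>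

lemma prob_walk_event_from_leg:
  assumes h0: "h 0 = 0" and l: "\<And>i. i \<le> Suc n \<Longrightarrow> l i \<in> {1..N}"
    and h: "0 < h n" "h (Suc n) = h n + 1 \<or> h (Suc n) = h n - 1" and eq: "l (Suc n) = l n"
  shows "prob (walk_event (Suc n) h l) = prob (walk_event n h l) / 2"
proof -
  have "prob (height_event (Suc n) h) = prob (height_event n h) / 2"
    unfolding height_event_Suc
  proof (rule prob_height_step[OF sets_height_event])
    show "h n = Suc (h n - 1)" using h(1) by simp
    show "h (Suc n) = h n + 1 \<or> h (Suc n) = h n - 1" by (rule h(2))
  qed (simp add: height_event_def)
  moreover have "label_weight p h l (Suc n) = label_weight p h l n" using h(1) eq by simp
  moreover have "prob (walk_event n h l) = prob (height_event n h) * label_weight p h l n"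
    by (rule prob_walk_event[of h n l, OF h0 l]) simp
  moreover have "prob (walk_event (Suc n) h l) = prob (height_event (Suc n) h) * label_weight p h l (Suc n)"
    by (rule prob_walk_event[of h "Suc n" l, OF h0 l])
  ultimately show ?thesis by (simp only: times_divide_eq_left)
qed

text \<open>A history of positive probability is realised by some \<open>\<omega>\<close>, from
  which its heights and labels are read off. The conditional probability then is a quotient of two
  values of \<open>prob_walk_event\<close>.\<close>

lemma spider_walk_embedded_walk: "spider_walk N p M embedded_walk"
  unfolding spider_walk_def
proof (intro conjI allI ballI impI)
  show "prob_space M" by (rule prob_space_axioms)
  show "embedded_walk n \<in> borel_measurable M" for n by (rule measurable_embedded_walk)
  show "embedded_walk n \<omega> \<in> {spider_pt N (real r) j |r j. j \<in> {1..N}}" if "\<omega> \<in> space M" for n \<omega>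
    unfolding embedded_walk_eq[OF that] using label_range[OF that] by blast
  show "embedded_walk 0 \<omega> = 0" if "\<omega> \<in> space M" for \<omega>
    by (simp add: embedded_walk_eq[OF that] height_0[OF that])
next
  fix n x assume pos: "0 < \<P>(\<omega> in M. \<forall>i\<le>n. embedded_walk i \<omega> = x i)"
  have "{\<omega>\<in>space M. \<forall>i\<le>n. embedded_walk i \<omega> = x i} \<noteq> {}"
  proof
    assume "{\<omega>\<in>space M. \<forall>i\<le>n. embedded_walk i \<omega> = x i} = {}"
    from pos[unfolded this] show False by simp
  qed
  then obtain \<omega> where \<omega>: "\<omega> \<in> space M" and x: "\<And>i. i \<le> n \<Longrightarrow> embedded_walk i \<omega> = x i" by blast
  have height_x: "real (height i \<omega>) = cmod (x i)" if "i \<le> n" for i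
    using x[OF that, symmetric] by (simp add: embedded_walk_eq[OF \<omega>])
  have cond: "\<P>(\<omega> in M. embedded_walk (Suc n) \<omega> = spider_pt N (real r) j \<bar> \<forall>i\<le>n. embedded_walk i \<omega> = x i) = c"
    if j: "j \<in> {1..N}" and
      c: "\<And>h l. h 0 = 0 \<Longrightarrow> (\<And>i. i \<le> Suc n \<Longrightarrow> l i \<in> {1..N}) \<Longrightarrow> h n = height n \<omega> \<Longrightarrow> l n = label n \<omega> \<Longrightarrow> h (Suc n) = r \<Longrightarrow>
          l (Suc n) = j \<Longrightarrow>
        prob (walk_event (Suc n) h l) = prob (walk_event n h l) * c" for r j c
  proof -
    \<comment> \<open>The heights and labels of the realised history, continued at time
      \<open>n + 1\<close> by the target point.\<close>
    define h where "h i = (if i \<le> n then height i \<omega> else r)" for i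
    define l where "l i = (if i \<le> n then label i \<omega> else j)" for i
    have xi: "x i = spider_pt N (real (h i)) (l i)" if "i \<le> n" for i
      using x[OF that] that by (simp add: embedded_walk_eq[OF \<omega>] h_def l_def)
    have e1: "{\<omega>\<in>space M. \<forall>i\<le>n. embedded_walk i \<omega> = x i} = walk_event n h l"
      unfolding walk_event_def using xi by auto
    have e2: "{\<omega>\<in>space M. embedded_walk (Suc n) \<omega> = spider_pt N (real r) j \<and> (\<forall>i\<le>n. embedded_walk i \<omega> = x i)}
        = walk_event (Suc n) h l"
      unfolding walk_event_def using xi by (auto simp: le_Suc_eq h_def l_def)
    have "prob (walk_event (Suc n) h l) = prob (walk_event n h l) * c"
      by (rule c) (use \<omega> j in \<open>auto simp: h_def l_def height_0 label_range[OF \<omega>, simplified]\<close>)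
    then show ?thesis using pos unfolding cond_prob_def e1 e2 by simp
  qed
  {
    fix j assume "x n = 0" and j: "j \<in> {1..N}"
    then have "height n \<omega> = 0" using height_x[of n] by simp
    have "\<P>(\<omega> in M. embedded_walk (Suc n) \<omega> = spider_pt N (real 1) j \<bar> \<forall>i\<le>n. embedded_walk i \<omega> = x i) = p j"
    proof (rule cond[OF j])
      fix h l :: "nat \<Rightarrow> nat"
      assume "h 0 = 0" "\<And>i. i \<le> Suc n \<Longrightarrow> l i \<in> {1..N}" "h n = height n \<omega>" "h (Suc n) = 1" "l (Suc n) = j"
      then show "prob (walk_event (Suc n) h l) = prob (walk_event n h l) * p j"
        using prob_walk_event_from_0[of h n l] \<open>height n \<omega> = 0\<close> by simp
    qed
    then show "\<P>(\<omega> in M. embedded_walk (Suc n) \<omega> = spider_pt N 1 j \<bar> \<forall>i\<le>n. embedded_walk i \<omega> = x i) = p j" by simp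
  }
  fix r j assume r: "1 \<le> r" and j: "j \<in> {1..N}" and xn: "x n = spider_pt N (real r) j"
  have "spider_pt N (real (height n \<omega>)) (label n \<omega>) = spider_pt N (real r) j"
    using x[OF le_refl] xn by (simp add: embedded_walk_eq[OF \<omega>])
  then have hl: "height n \<omega> = r" "label n \<omega> = j"
    using r unfolding spider_pt_eq_iff[OF label_range[OF \<omega>] j] by auto
  have leg: "\<P>(\<omega> in M. embedded_walk (Suc n) \<omega> = spider_pt N (real r') j \<bar> \<forall>i\<le>n. embedded_walk i \<omega> = x i) = 1 / 2"
    if "r' = r + 1 \<or> r' = r - 1" for r'
  proof (rule cond[OF j])
    fix h l :: "nat \<Rightarrow> nat"
    assume "h 0 = 0" "\<And>i. i \<le> Suc n \<Longrightarrow> l i \<in> {1..N}" "h n = height n \<omega>" "l n = label n \<omega>" "h (Suc n)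
        = r'" "l (Suc n) = j"
    then show "prob (walk_event (Suc n) h l) = prob (walk_event n h l) * (1 / 2)"
      using prob_walk_event_from_leg[of h n l] hl r that by simp
  qed
  show "\<P>(\<omega> in M. embedded_walk (Suc n) \<omega> = spider_pt N (real (r + 1)) j \<bar> \<forall>i\<le>n. embedded_walk i \<omega> = x i) = 1 / 2"
    "\<P>(\<omega> in M. embedded_walk (Suc n) \<omega> = spider_pt N (real (r - 1)) j \<bar> \<forall>i\<le>n. embedded_walk i \<omega> = x i) = 1 / 2"
    by (rule leg; simp)+
qed

text \<open>If \<open>0\<close> is not visited between the times \<open>\<tau> n\<close> and \<open>n\<close>, both points are on the same leg;
  otherwise both are as close to the body as the path oscillates.\<close>

lemma spider_dist_embedded_walk_le:
  assumes \<omega>: "\<omega> \<in> space M"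
    and y: "\<And>u. 0 \<le> u \<Longrightarrow> \<bar>u - real n\<bar> \<le> \<bar>\<tau> n \<omega> - real n\<bar> \<Longrightarrow> \<bar>B u \<omega> - B (real n) \<omega>\<bar> \<le> y"
  shows "spider_dist N (embedded_walk n \<omega>) (spider_path (real n) \<omega>) \<le> 3 * y"
proof -
  have \<tau>0: "0 \<le> \<tau> n \<omega>" by (rule \<tau>_nonneg[OF \<omega>])
  have R: "\<bar>B (\<tau> n \<omega>) \<omega> - B (real n) \<omega>\<bar> \<le> y" by (rule y[OF \<tau>0]) simp
  have norm: "cmod (spider_path t \<omega>) = \<bar>B t \<omega>\<bar>" for t by (simp add: spider_path_def)
  show ?thesis
  proof (cases "joined (\<lambda>t. B t \<omega>) (\<tau> n \<omega>) (real n)")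
    case True
    then have nz: "B (\<tau> n \<omega>) \<omega> \<noteq> 0" "B (real n) \<omega> \<noteq> 0" by (auto simp: joined_def)
    have "\<tau> n \<omega> \<in> exc_interval (\<lambda>t. B t \<omega>) (exc_index (\<lambda>t. B t \<omega>) (\<tau> n \<omega>))"
      by (rule unbounded_continuous_path.ex_exc_interval[OF path[OF \<omega>] \<tau>0 nz(1)])
    from joined_exc_interval[OF this True] have "exc_index (\<lambda>t. B t \<omega>) (real n) = exc_index (\<lambda>t. B t \<omega>) (\<tau> n \<omega>)"
      by (intro exc_index_eq) simp
    then have "spider_dist N (embedded_walk n \<omega>) (spider_path (real n) \<omega>) = \<bar>\<bar>B (\<tau> n \<omega>) \<omega>\<bar> - \<bar>B (real n) \<omega>\<bar>\<bar>"
      using nz \<kappa>_range[OF \<omega>] by (simp add: embedded_walk_def spider_path_def spider_dist_same_leg)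
    then show ?thesis using R by linarith
  next
    case False
    then obtain u where u: "min (\<tau> n \<omega>) (real n) \<le> u" "u \<le> max (\<tau> n \<omega>) (real n)" "B u \<omega> = 0"
      by (auto simp: joined_def)
    have "0 \<le> u" "\<bar>u - real n\<bar> \<le> \<bar>\<tau> n \<omega> - real n\<bar>" using u(1,2) \<tau>0 by auto
    \<comment> \<open>A zero within the range puts \<open>B (real n) \<omega>\<close> within
      \<open>y\<close> of 0, hence \<open>B (\<tau> n \<omega>) \<omega>\<close> within
      \<open>2 * y\<close>; the distance through the body is at most the sum
      \<open>3 * y\<close>.\<close>
    from y[OF this] have "\<bar>B (real n) \<omega>\<bar> \<le> y" using u(3) by simp
    moreover have "spider_dist N (embedded_walk n \<omega>) (spider_path (real n) \<omega>) \<le> \<bar>B (\<tau> n \<omega>) \<omega>\<bar> + \<bar>B (real n) \<omega>\<bar>"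
      unfolding spider_dist_def embedded_walk_def norm by auto
    ultimately show ?thesis using R by linarith
  qed
qed

lemma spider_dist_nonneg: "0 \<le> spider_dist N z w"
  by (simp add: spider_dist_def)

theorem AE_spider_dist_embedded_walk:
  "AE \<omega> in M. (\<lambda>n. spider_dist N (embedded_walk n \<omega>) (spider_path (real n) \<omega>))
     \<in> O(\<lambda>n. (real n * ln (ln (real n))) powr (1/4) * ln (real n) powr (1/2))"
  using AE_oscillation_up_to_\<tau> AE_space
proof eventually_elim
  case (elim \<omega>)
  show ?case
  proof (rule bigoI)
    \<comment> \<open>252 = 3 * 84: three oscillations, each with the constant 84.\<close>
    show "\<forall>\<^sub>F n in sequentially. norm (spider_dist N (embedded_walk n \<omega>) (spider_path (real n) \<omega>))
      \<le> 252 * norm ((real n * ln (ln (real n))) powr (1/4) * ln (real n) powr (1/2))"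
      using elim(1)
    proof eventually_elim
      case (elim n)
      have "spider_dist N (embedded_walk n \<omega>) (spider_path (real n) \<omega>)
        \<le> 3 * (84 * ((real n * ln (ln (real n))) powr (1/4) * ln (real n) powr (1/2)))"
        by (rule spider_dist_embedded_walk_le[OF \<open>\<omega> \<in> space M\<close>]) (use elim in blast)
      then show ?case by (simp add: spider_dist_nonneg)
    qed
  qed
qed

end

section \<open>Existence of the coupling\<close>

lemma indep_vars_coordinates:
  fixes D :: "'i \<Rightarrow> 'a measure" and f :: "'j \<Rightarrow> 'i"
  assumes D: "\<And>i. prob_space (D i)" and f: "inj f"
  shows "prob_space.indep_vars (\<Pi>\<^sub>M i\<in>UNIV. D i) (\<lambda>j. D (f j)) (\<lambda>j \<omega>. \<omega> (f j)) UNIV"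
proof -
  interpret prob_space "\<Pi>\<^sub>M i\<in>UNIV. D i" by (rule prob_space_PiM) (rule D)
  have "distr (PiM UNIV D) (\<Pi>\<^sub>M j\<in>UNIV. D (f j)) (\<lambda>\<omega>. \<lambda>j\<in>UNIV. \<omega> (f j)) = (\<Pi>\<^sub>M j\<in>UNIV. D (f j))"
    by (rule distr_PiM_reindex) (use D f in auto)
  moreover have "distr (PiM UNIV D) (D (f j)) (\<lambda>\<omega>. \<omega> (f j)) = D (f j)" for j
    by (rule distr_PiM_component) (use D in auto)
  ultimately show ?thesis
    by (subst indep_vars_iff_distr_eq_PiM) auto
qed

lemma (in prob_space) indep_set_mono:
  assumes "indep_set A B" "A' \<subseteq> A" "B' \<subseteq> B"
  shows "indep_set A' B'"
  using assms unfolding indep_set_def by (elim indep_sets_mono_sets) (auto split: bool.split)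

text \<open>All coordinates of the product space are real, so labels are stored as real numbers. The
  default 1 keeps the decoded label in the admissible range at every sample point.\<close>

definition decode_label :: "nat \<Rightarrow> real \<Rightarrow> nat" where
  "decode_label N x = (if nat \<lfloor>x\<rfloor> \<in> {1..N} then nat \<lfloor>x\<rfloor> else 1)"

lemma decode_label_range: "1 \<le> N \<Longrightarrow> decode_label N x \<in> {1..N}"
  by (simp add: decode_label_def)

lemma measurable_decode_label [measurable]: "decode_label N \<in> measurable borel (count_space UNIV)"
  unfolding decode_label_def[abs_def] by measurable

locale coordinate_space =
  fixes N :: nat and q :: "nat pmf"
  assumes N: "1 \<le> N" and q: "set_pmf q \<subseteq> {1..N}"
begin

text \<open>Even coordinates carry the normals that build the path, odd ones carry the labels; the
  independence of labels and path reduces to that of two disjoint sets of coordinates.\<close>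

definition D :: "nat \<Rightarrow> real measure" where
  "D i = (if even i then density lborel std_normal_density else distr (measure_pmf q) borel real)"

abbreviation M :: "(nat \<Rightarrow> real) measure" where
  "M \<equiv> \<Pi>\<^sub>M i\<in>UNIV. D i"

definition \<xi> :: "nat \<Rightarrow> nat \<Rightarrow> (nat \<Rightarrow> real) \<Rightarrow> real" where
  "\<xi> n k \<omega> = \<omega> (2 * prod_encode (n, k))"

definition \<kappa> :: "nat \<Rightarrow> (nat \<Rightarrow> real) \<Rightarrow> nat" where
  "\<kappa> m \<omega> = decode_label N (\<omega> (2 * m + 1))"

definition B :: "real \<Rightarrow> (nat \<Rightarrow> real) \<Rightarrow> real" where
  "B t \<omega> = fix_path (levy_path (\<lambda>n k. \<xi> n k \<omega>)) t"

lemma sets_D [measurable_cong]: "sets (D i) = sets borel"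
  by (simp add: D_def)

lemma prob_space_D: "prob_space (D i)"
  unfolding D_def
  by (auto intro!: prob_space_normal_density prob_space.prob_space_distr measure_pmf.prob_space_axioms)

sublocale prob_space M
  by (rule prob_space_PiM) (rule prob_space_D)

lemma indep_vars_coordinate: "inj f \<Longrightarrow> indep_vars (\<lambda>_. borel) (\<lambda>j \<omega>. \<omega> (f j)) UNIV"
  using indep_vars_coordinates[of D f, OF prob_space_D]
  by (subst indep_vars_cong[OF refl refl]) (auto simp: indep_vars_def sets_D measurable_cong_sets[OF refl sets_D])

lemma distr_coordinate: "distr M borel (\<lambda>\<omega>. \<omega> i) = D i"
proof -
  have "distr M borel (\<lambda>\<omega>. \<omega> i) = distr M (D i) (\<lambda>\<omega>. \<omega> i)" by (rule distr_cong) (auto simp: sets_D)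
  also have "\<dots> = D i" by (rule distr_PiM_component) (use prob_space_D in auto)
  finally show ?thesis .
qed

lemma measurable_coordinate [measurable]: "(\<lambda>\<omega>. \<omega> i) \<in> borel_measurable M"
  using indep_vars_coordinate[of id] by (simp add: indep_vars_def)

sublocale gauss_family M \<xi>
proof
  have "inj (\<lambda>i. 2 * prod_encode (fst i, snd i))" by (auto simp: inj_def prod_eq_iff)
  then show "indep_vars (\<lambda>_. borel) (\<lambda>i. \<xi> (fst i) (snd i)) UNIV"
    unfolding \<xi>_def[abs_def] by (rule indep_vars_coordinate)
  show "distributed M lborel (\<xi> n k) (\<lambda>x. ennreal (std_normal_density x))" for n k
  proof -
    have "distr M lborel (\<xi> n k) = distr M borel (\<xi> n k)" by (rule distr_cong) auto
    also have "\<dots> = D (2 * prod_encode (n, k))"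
      unfolding \<xi>_def[abs_def] by (rule distr_coordinate)
    also have "\<dots> = density lborel std_normal_density" by (simp add: D_def)
    finally have "distr M lborel (\<xi> n k) = density lborel std_normal_density" .
    moreover have "\<xi> n k \<in> borel_measurable M" unfolding \<xi>_def[abs_def] by measurable
    ultimately show ?thesis by (simp add: distributed_def)
  qed
qed

lemma brownian_motion_B: "brownian_motion M B"
proof -
  interpret brownian M "\<lambda>t \<omega>. levy_path (\<lambda>n k. \<xi> n k \<omega>) t" by unfold_locales (rule brownian_motion_levy)
  show ?thesis using brownian_motion_fix_path unfolding B_def[abs_def] .
qed

sublocale brownian_unbounded M B
  by unfold_locales (simp_all add: brownian_motion_B B_def unbounded_fix_path)

definition even_algebra :: "(nat \<Rightarrow> real) measure" where
  "even_algebra = vimage_algebra (space M) (\<lambda>\<omega>. \<lambda>i\<in>{i. even i}. \<omega> i) (\<Pi>\<^sub>M i\<in>{i. even i}. borel)"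

definition odd_algebra :: "(nat \<Rightarrow> real) measure" where
  "odd_algebra = vimage_algebra (space M) (\<lambda>\<omega>. \<lambda>i\<in>{i. odd i}. \<omega> i) (\<Pi>\<^sub>M i\<in>{i. odd i}. borel)"

lemma indep_even_odd: "indep_set (sets even_algebra) (sets odd_algebra)"
proof -
  have "indep_vars (\<lambda>_. borel) (\<lambda>i \<omega>. \<omega> i) UNIV" using indep_vars_coordinate[of id] by simp
  from indep_var_restrict[OF this, of "{i. even i}" "{i. odd i}"]
  show ?thesis unfolding indep_var_eq even_algebra_def odd_algebra_def sets_vimage_algebra by auto
qed

lemma measurable_restrict_coordinate:
  assumes "i \<in> I"
  shows "(\<lambda>\<omega>. \<omega> i) \<in> borel_measurable (vimage_algebra (space M) (\<lambda>\<omega>. \<lambda>i\<in>I. \<omega> i) (\<Pi>\<^sub>M i\<in>I. borel))"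
proof -
  have "(\<lambda>\<omega>. (\<lambda>i\<in>I. \<omega> i) i) \<in> borel_measurable (vimage_algebra (space M) (\<lambda>\<omega>. \<lambda>i\<in>I. \<omega> i) (\<Pi>\<^sub>M i\<in>I. borel))"
    by (rule measurable_compose[OF measurable_vimage_algebra1 measurable_component_singleton])
       (use assms in \<open>auto simp: space_PiM PiE_def extensional_def\<close>)
  then show ?thesis using assms by simp
qed

text \<open>Each value of the corrected path is a measurable function of the normals
  \<open>\<xi> n k\<close>, all of which are even coordinates.\<close>

lemma sets_paths_even: "sets paths \<subseteq> sets even_algebra"
proof (rule sets_paths_least)
  show "space even_algebra = space M" by (simp add: even_algebra_def)
  have [measurable]: "\<xi> n k \<in> borel_measurable even_algebra" for n k
    unfolding \<xi>_def[abs_def] even_algebra_def by (rule measurable_restrict_coordinate) simp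
  have [measurable]: "(\<lambda>\<omega>. levy_path (\<lambda>n k. \<xi> n k \<omega>) t) \<in> borel_measurable even_algebra" for t
    by measurable
  show "B t \<in> borel_measurable even_algebra" for t
    unfolding B_def[abs_def] fix_path_def unbounded_path_def by measurable
qed

lemma sets_labels_odd:
  "sets (vimage_algebra (space M) (\<lambda>\<omega> m. \<kappa> m \<omega>) (\<Pi>\<^sub>M m\<in>UNIV. count_space UNIV)) \<subseteq> sets odd_algebra"
proof -
  have [measurable]: "(\<lambda>\<omega>. \<omega> (2 * m + 1)) \<in> borel_measurable odd_algebra" for m
    unfolding odd_algebra_def by (rule measurable_restrict_coordinate) simp
  have k: "\<kappa> m \<in> measurable odd_algebra (count_space UNIV)" for m
    unfolding \<kappa>_def[abs_def] by measurable
  have "(\<lambda>\<omega>. \<lambda>m\<in>UNIV. \<kappa> m \<omega>) \<in> measurable odd_algebra (\<Pi>\<^sub>M m\<in>UNIV. count_space UNIV)"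
    by (rule measurable_restrict) (rule k)
  then have m: "(\<lambda>\<omega> m. \<kappa> m \<omega>) \<in> measurable odd_algebra (\<Pi>\<^sub>M m\<in>UNIV. count_space UNIV)"
    by (simp add: restrict_def)
  have s: "space M = space odd_algebra" by (simp add: odd_algebra_def)
  show ?thesis
    unfolding sets_vimage_algebra s by (rule sets.sigma_sets_subset) (use measurable_sets[OF m] in auto)
qed

lemma prob_label: "j \<in> {1..N} \<Longrightarrow> \<P>(\<omega> in M. \<kappa> m \<omega> = j) = pmf q j"
proof -
  assume j: "j \<in> {1..N}"
  have "\<P>(\<omega> in M. \<kappa> m \<omega> = j) = measure (distr M borel (\<lambda>\<omega>. \<omega> (2 * m + 1))) {x. decode_label N x = j}"
    by (subst measure_distr) (auto simp: \<kappa>_def vimage_def intro!: arg_cong[where f=prob])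
  also have "\<dots> = measure (distr (measure_pmf q) borel real) {x. decode_label N x = j}"
    unfolding distr_coordinate by (simp add: D_def)
  also have "\<dots> = measure (measure_pmf q) {k. decode_label N (real k) = j}"
    by (subst measure_distr) (auto simp: vimage_def)
  also have "\<dots> = measure (measure_pmf q) ({k. decode_label N (real k) = j} \<inter> set_pmf q)"
    by (rule measure_Int_set_pmf[symmetric])
  \<comment> \<open>On the support of \<open>q\<close>, which lies in the range from 1 to
    \<open>N\<close>, decoding inverts the embedding into the reals, so the default contributes
    nothing.\<close>
  also have "{k. decode_label N (real k) = j} \<inter> set_pmf q = {j} \<inter> set_pmf q"
    using q j by (auto simp: decode_label_def)
  also have "measure (measure_pmf q) \<dots> = pmf q j" by (simp add: measure_Int_set_pmf measure_pmf_single)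
  finally show ?thesis .
qed

lemma leg_labels_\<kappa>: "leg_labels N (pmf q) M B \<kappa>"
  unfolding leg_labels_def
proof (intro conjI allI ballI)
  show "\<kappa> m \<omega> \<in> {1..N}" for m \<omega> unfolding \<kappa>_def by (rule decode_label_range[OF N])
  have "inj (\<lambda>m::nat. 2 * m + 1)" by (auto simp: inj_def)
  from indep_vars_compose2[OF indep_vars_coordinate[OF this] measurable_decode_label]
  show "indep_vars (\<lambda>_. count_space UNIV) \<kappa> UNIV" unfolding \<kappa>_def[abs_def] .
  show "\<P>(\<omega> in M. \<kappa> m \<omega> = j) = pmf q j" if "j \<in> {1..N}" for m j by (rule prob_label[OF that])
  show "indep_set (sets paths) (sets (vimage_algebra (space M) (\<lambda>\<omega> m. \<kappa> m \<omega>) (\<Pi>\<^sub>M m\<in>UNIV. count_space UNIV)))"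
    by (rule indep_set_mono[OF indep_even_odd sets_paths_even sets_labels_odd])
qed

end

lemma leg_labels_cong: "(\<And>j. j \<in> {1..N} \<Longrightarrow> p j = p' j) \<Longrightarrow> leg_labels N p M B \<kappa> \<longleftrightarrow> leg_labels N p' M B \<kappa>"
  by (simp add: leg_labels_def)

theorem theorem2p2:
  fixes N :: nat and p :: "nat \<Rightarrow> real"
  assumes "N \<ge> 1"
    and "\<And>j. j \<in> {1..N} \<Longrightarrow> p j \<ge> 0"
    and "(\<Sum>j=1..N. p j) = 1"
  shows "\<exists>(M :: (nat \<Rightarrow> real) measure) X S.
           prob_space M \<and> brownian_spider N p M X \<and> spider_walk N p M S \<and>
           (AE \<omega> in M. (\<lambda>n. spider_dist N (S n \<omega>) (X (real n) \<omega>))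
              \<in> O(\<lambda>n. (real n * ln (ln (real n))) powr (1/4) * ln (real n) powr (1/2)))"
proof -
  \<comment> \<open>The values of \<open>p\<close> outside the legs are arbitrary; cutting them off
    gives a probability mass function on the natural numbers that agrees with \<open>p\<close> on
    the legs.\<close>
  define p' where "p' j = (if j \<in> {1..N} then p j else 0)" for j
  have nonneg: "0 \<le> p' j" for j using assms(2) by (simp add: p'_def)
  have "(\<integral>\<^sup>+j. ennreal (p' j) \<partial>count_space UNIV) = (\<Sum>j\<in>{1..N}. ennreal (p' j))"
    by (rule nn_integral_count_space'[symmetric, THEN sym]) (auto simp: p'_def)
  also have "\<dots> = ennreal (\<Sum>j\<in>{1..N}. p' j)" by (rule sum_ennreal) (rule nonneg)
  also have "(\<Sum>j\<in>{1..N}. p' j) = 1" using assms(3) by (simp add: p'_def)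
  finally have one: "(\<integral>\<^sup>+j. ennreal (p' j) \<partial>count_space UNIV) = 1" by simp
  define q where "q = embed_pmf p'"
  have pmf_q: "pmf q j = p' j" for j unfolding q_def by (rule pmf_embed_pmf[OF nonneg one])
  interpret coordinate_space N q
    by unfold_locales (use assms(1) in \<open>auto simp: set_pmf_eq pmf_q p'_def split: if_splits\<close>)
  have "leg_labels N p M B \<kappa>"
    using leg_labels_\<kappa> by (subst leg_labels_cong[of N p "pmf q"]) (auto simp: pmf_q p'_def)
  then interpret labelled_brownian M B N p \<kappa> by unfold_locales (rule assms(1))
  show ?thesis
    using prob_space_axioms brownian_spider_spider_path spider_walk_embedded_walk AE_spider_dist_embedded_walk
        by blast
qed

end
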